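(* Let $\Bbbk$ be a field, let $n\ge2$ be an integer, let $q\in\Bbbk^\times$, $q\neq 1$, be a root of unity of order $m$, let $v$ be a positive integer, and let $A=\Bbbk_q[x_1,\dots,x_n]^{(v)}$. Suppose that one of the following is true: (a) $n$ is even and $m$ does not divide $v$; (b) $n$ is odd and $\gcd(m,v)\ne1$. Then $A$ is cancellative.
   Context: All algebras are associative unital $\Bbbk$-algebras and isomorphisms are of $\Bbbk$-algebras. An algebra $A$ is cancellative if, for any algebra $B$, $A[t]\cong B[t]$ implies $A\cong B$ (here $t$ is a central polynomial variable). $\Bbbk_q[x_1,\dots,x_n]$ is the $\Bbbk$-algebra generated by $x_1,\dots,x_n$ subject to $x_jx_i=q\,x_ix_j$ for all $1\le i<j\le n$; it is $\mathbb{N}$-graded with $\deg x_i=1$. For a $\mathbb{Z}$-graded algebra $C=\bigoplus_i C_i$ and a positive integer $v$, the $v$th Veronese subring is $C^{(v)}=\bigoplus_i C_{vi}$. *)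

theory Defs
  imports "HOL-Algebra.UnivPoly" "HOL-Algebra.QuotRing" "HOL-Algebra.Multiplicative_Group"
begin

text \<open>
  The locale \<open>algebra\<close> of HOL-Algebra only covers commutative algebras.
\<close>

locale assoc_algebra = module K A + A?: ring A for K (structure) and A (structure) +
  assumes smult_mult_left:
      "\<lbrakk>c \<in> carrier K; x \<in> carrier A; y \<in> carrier A\<rbrakk> \<Longrightarrow>
       (c \<odot>\<^bsub>A\<^esub> x) \<otimes>\<^bsub>A\<^esub> y = c \<odot>\<^bsub>A\<^esub> (x \<otimes>\<^bsub>A\<^esub> y)"
    and smult_mult_right:
      "\<lbrakk>c \<in> carrier K; x \<in> carrier A; y \<in> carrier A\<rbrakk> \<Longrightarrow>
       x \<otimes>\<^bsub>A\<^esub> (c \<odot>\<^bsub>A\<^esub> y) = c \<odot>\<^bsub>A\<^esub> (x \<otimes>\<^bsub>A\<^esub> y)"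

definition algebra_iso ::
  "('k, 'm) ring_scheme \<Rightarrow> ('k, 'a, 'r) module_scheme \<Rightarrow> ('k, 'b, 's) module_scheme \<Rightarrow> ('a \<Rightarrow> 'b) set"
  where "algebra_iso K A B =
    {h \<in> ring_iso A B. \<forall>c\<in>carrier K. \<forall>x\<in>carrier A. h (c \<odot>\<^bsub>A\<^esub> x) = c \<odot>\<^bsub>B\<^esub> h x}"

definition isomorphic_algebras ::
  "('k, 'm) ring_scheme \<Rightarrow> ('k, 'a, 'r) module_scheme \<Rightarrow> ('k, 'b, 's) module_scheme \<Rightarrow> bool"
  where "isomorphic_algebras K A B \<longleftrightarrow> algebra_iso K A B \<noteq> {}"

text \<open>
  \<open>A[t]\<close> with \<open>t\<close> central: \<^const>\<open>UP\<close> makes sense over noncommutative rings, and its product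
  lets coefficients commute with \<open>t\<close>.  Its own scalars are the elements of \<open>A\<close>; they are
  replaced here by those of the ground field.
\<close>

definition poly_algebra :: "('k, 'a, 'r) module_scheme \<Rightarrow> ('k, nat \<Rightarrow> 'a) module"
  where "poly_algebra A =
    \<lparr>carrier = carrier (UP A), mult = mult (UP A), one = one (UP A),
     zero = zero (UP A), add = add (UP A), smult = (\<lambda>c p i. c \<odot>\<^bsub>A\<^esub> p i)\<rparr>"

text \<open>
  HOL cannot quantify over types inside a formula, so the type \<open>'b\<close> of the elements of \<open>B\<close> is
  a parameter.  A theorem concluding \<open>cancellative TYPE('b) K A\<close> with \<open>'b\<close> a free
  type variable is about all algebras \<open>B\<close>.
\<close>

definition cancellative ::
  "'b itself \<Rightarrow> ('k, 'm) ring_scheme \<Rightarrow> ('k, 'a, 'r) module_scheme \<Rightarrow> bool"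
  where "cancellative _ K A \<longleftrightarrow>
    assoc_algebra K A \<and>
    (\<forall>B :: ('k, 'b) module. assoc_algebra K B \<longrightarrow>
       isomorphic_algebras K (poly_algebra A) (poly_algebra B) \<longrightarrow> isomorphic_algebras K A B)"

text \<open>
  The free algebra on generators indexed by \<open>S\<close>: finitely supported coefficient
  functions on words over \<open>S\<close>, multiplied by concatenating words.
\<close>

definition free_algebra ::
  "('k, 'm) ring_scheme \<Rightarrow> 's set \<Rightarrow> ('k, 's list \<Rightarrow> 'k) module"
  where "free_algebra K S =
    \<lparr>carrier = {f \<in> UNIV \<rightarrow> carrier K.
        finite {w. f w \<noteq> \<zero>\<^bsub>K\<^esub>} \<and> {w. f w \<noteq> \<zero>\<^bsub>K\<^esub>} \<subseteq> lists S},
     mult = (\<lambda>f g w. \<Oplus>\<^bsub>K\<^esub>i \<in> {..length w}. f (take i w) \<otimes>\<^bsub>K\<^esub> g (drop i w)),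
     one = (\<lambda>w. if w = [] then \<one>\<^bsub>K\<^esub> else \<zero>\<^bsub>K\<^esub>),
     zero = (\<lambda>w. \<zero>\<^bsub>K\<^esub>),
     add = (\<lambda>f g w. f w \<oplus>\<^bsub>K\<^esub> g w),
     smult = (\<lambda>c f w. c \<otimes>\<^bsub>K\<^esub> f w)\<rparr>"

definition free_gen :: "('k, 'm) ring_scheme \<Rightarrow> 's \<Rightarrow> 's list \<Rightarrow> 'k"
  where "free_gen K s = (\<lambda>w. if w = [s] then \<one>\<^bsub>K\<^esub> else \<zero>\<^bsub>K\<^esub>)"

definition quot_algebra ::
  "('k, 'a, 'r) module_scheme \<Rightarrow> 'a set \<Rightarrow> ('k, 'a set) module"
  where "quot_algebra A I =
    \<lparr>carrier = carrier (A Quot I), mult = mult (A Quot I), one = one (A Quot I),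
     zero = zero (A Quot I), add = add (A Quot I),
     smult = (\<lambda>c X. \<Union>x\<in>X. I +>\<^bsub>A\<^esub> (c \<odot>\<^bsub>A\<^esub> x))\<rparr>"

definition quantum_ideal :: "('k, 'm) ring_scheme \<Rightarrow> 'k \<Rightarrow> nat \<Rightarrow> (nat list \<Rightarrow> 'k) set"
  where "quantum_ideal K q n =
    (let F = free_algebra K {1..n}; x = free_gen K in
     genideal F
       {x j \<otimes>\<^bsub>F\<^esub> x i \<ominus>\<^bsub>F\<^esub> q \<odot>\<^bsub>F\<^esub> (x i \<otimes>\<^bsub>F\<^esub> x j) | i j. 1 \<le> i \<and> i < j \<and> j \<le> n})"

definition quantum_poly ::
  "('k, 'm) ring_scheme \<Rightarrow> 'k \<Rightarrow> nat \<Rightarrow> ('k, (nat list \<Rightarrow> 'k) set) module"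
  where "quantum_poly K q n = quot_algebra (free_algebra K {1..n}) (quantum_ideal K q n)"

text \<open>
  The homogeneous components for \<open>deg x\<^sub>i = 1\<close>: images of the combinations of words of
  length \<open>d\<close>.  For negative \<open>d\<close> this is the zero submodule.
\<close>

definition quantum_component ::
  "('k, 'm) ring_scheme \<Rightarrow> 'k \<Rightarrow> nat \<Rightarrow> int \<Rightarrow> (nat list \<Rightarrow> 'k) set set"
  where "quantum_component K q n d =
    (\<lambda>f. quantum_ideal K q n +>\<^bsub>free_algebra K {1..n}\<^esub> f) `
      {f \<in> carrier (free_algebra K {1..n}). \<forall>w. f w \<noteq> \<zero>\<^bsub>K\<^esub> \<longrightarrow> int (length w) = d}"

definition veronese ::
  "('k, 'a) module \<Rightarrow> (int \<Rightarrow> 'a set) \<Rightarrow> nat \<Rightarrow> ('k, 'a) module"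
  where "veronese C G v =
    C\<lparr>carrier := {\<Oplus>\<^bsub>C\<^esub>i \<in> S. f i | S f. finite S \<and> f \<in> (\<Pi> i\<in>S. G (int v * i))}\<rparr>"

end

theory Submission
  imports Defs "HOL-Library.Multiset_Order" "HOL-Number_Theory.Cong"
    "HOL-Combinatorics.Multiset_Permutations"
begin

text \<open>
  The idea is to attach to every ring \<open>R\<close> a set of central elements that is invariant under
  isomorphisms, is compatible with adjoining a central variable, and for the Veronese algebra \<open>A\<close>
  sees all the variables \<open>x\<^sub>i\<close>.  Let the multiplication algebra of \<open>R\<close> be generated by the left and
  right multiplications.  The central conductor \<open>I(R)\<close> consists of the values \<open>\<phi> 1\<close> of those \<open>\<phi>\<close> in the
  multiplication algebra that map all of \<open>R\<close> into its centre.  Taking coefficients of \<open>\<phi>\<close> shows that an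
  element of \<open>I(R[t])\<close> has all its coefficients in \<open>I(R)\<close>, and \<open>I(R)\<close> lies in \<open>I(R[t])\<close>.

  Let \<open>h\<close> be an isomorphism from \<open>A[t]\<close> onto \<open>B[s]\<close>; these rings have no zero divisors.  If \<open>I(A)\<close> is
  not zero, then \<open>I(B)\<close> contains some \<open>b \<noteq> 0\<close>, and all coefficients of \<open>p = h\<inverse> b\<close> lie in \<open>I(A)\<close>.
  Suppose that every monomial \<open>x\<^sup>a\<close> of \<open>A\<close> divides a power of such a \<open>p\<close>.  Then \<open>h(x\<^sup>a)\<close> divides a power
  of \<open>b\<close>, so it has degree zero in \<open>s\<close>.  Hence \<open>h\<close> maps \<open>A\<close> into \<open>B\<close>, and as \<open>h(t)\<close> has
  positive degree, only the constants of \<open>A[t]\<close> can be mapped to constants, so \<open>h\<close> maps \<open>A\<close> onto \<open>B\<close>.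
  This is \<open>conductor_retraction\<close>.

  It remains to study \<open>I(A)\<close>.  Monomials satisfy \<open>x\<^sup>b x\<^sup>c = \<lambda> x\<^sup>c x\<^sup>b\<close> with \<open>\<lambda>\<close> a power of \<open>q\<close>.  For a fixed \<open>b\<close>
  the product of the operators \<open>u \<mapsto> x\<^sup>b u - q\<^sup>j u x\<^sup>b\<close> over \<open>0 < j < m\<close> kills exactly those monomials that do
  not commute with \<open>x\<^sup>b\<close>.  Composing these over the monomials \<open>x\<^sup>b\<close> of degree \<open>v\<close> gives an operator with
  central values that does not kill 1, so \<open>I(A) \<noteq> 0\<close> (\<open>central_conductor_nonzero\<close>).

  The hypothesis on \<open>n\<close>, \<open>m\<close>, \<open>v\<close> is used to show that each \<open>x\<^sub>i\<close> divides all monomials of an element of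
  \<open>I(A)\<close> (\<open>central_conductor_divisible\<close>).  It ensures that for every \<open>i\<close> some monomial \<open>x\<^sup>c\<close> of \<open>A\<close> that does not
  involve \<open>x\<^sub>i\<close> commutes with all monomials of \<open>A\<close> free of \<open>x\<^sub>i\<close>, but not with all of \<open>A\<close>
  (\<open>dual_exponent_exists\<close>).  Modulo \<open>x\<^sub>i\<close> one gets \<open>\<phi>(x\<^sup>c) = x\<^sup>c \<phi>(1)\<close>.  If \<open>\<phi>(1)\<close> and \<open>\<phi>(x\<^sup>c)\<close> are central and
  \<open>\<phi>(1)\<close> is not zero modulo \<open>x\<^sub>i\<close>, then \<open>x\<^sup>c\<close> would be central, a contradiction.  So a power of an
  element of \<open>I(A)\<close> is divisible by any given monomial.

  All computations take place in a twisted monoid algebra with basis the finite multisets over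
  \<open>{1..n}\<close>.  The quantum polynomial ring is identified with it by sorting words.
\<close>

section \<open>The multiplication algebra and the central conductor\<close>

definition centre :: "('a, 'r) ring_scheme \<Rightarrow> 'a set"
  where "centre R = {z \<in> carrier R. \<forall>y\<in>carrier R. y \<otimes>\<^bsub>R\<^esub> z = z \<otimes>\<^bsub>R\<^esub> y}"

lemma centre_closed: "z \<in> centre R \<Longrightarrow> z \<in> carrier R"
  unfolding centre_def by blast

lemma centre_commute: "z \<in> centre R \<Longrightarrow> y \<in> carrier R \<Longrightarrow> y \<otimes>\<^bsub>R\<^esub> z = z \<otimes>\<^bsub>R\<^esub> y"
  unfolding centre_def by blast

lemma centreI:
  "z \<in> carrier R \<Longrightarrow> (\<And>y. y \<in> carrier R \<Longrightarrow> y \<otimes>\<^bsub>R\<^esub> z = z \<otimes>\<^bsub>R\<^esub> y) \<Longrightarrow> z \<in> centre R"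
  unfolding centre_def by blast

text \<open>
  The image of \<open>R \<otimes> R\<^sup>o\<^sup>p\<close> in the additive maps of \<open>R\<close>.  The constructors are chosen so that membership
  can be transported constructor by constructor; the zero map is left multiplication by zero.
\<close>

inductive_set mult_algebra :: "('a, 'r) ring_scheme \<Rightarrow> ('a \<Rightarrow> 'a) set"
  for R (structure)
  where
    ident: "(\<lambda>u. u) \<in> mult_algebra R"
  | left: "y \<in> carrier R \<Longrightarrow> \<phi> \<in> mult_algebra R \<Longrightarrow> (\<lambda>u. y \<otimes> \<phi> u) \<in> mult_algebra R"
  | right: "y \<in> carrier R \<Longrightarrow> \<phi> \<in> mult_algebra R \<Longrightarrow> (\<lambda>u. \<phi> u \<otimes> y) \<in> mult_algebra R"
  | plus: "\<phi> \<in> mult_algebra R \<Longrightarrow> \<psi> \<in> mult_algebra R \<Longrightarrow> (\<lambda>u. \<phi> u \<oplus> \<psi> u) \<in> mult_algebra R"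

text \<open>
  For an Azumaya algebra this is the whole centre, as the multiplication algebra then contains a
  projection onto the centre.
\<close>

definition central_conductor :: "('a, 'r) ring_scheme \<Rightarrow> 'a set"
  where "central_conductor R =
    {\<phi> \<one>\<^bsub>R\<^esub> | \<phi>. \<phi> \<in> mult_algebra R \<and> (\<forall>u\<in>carrier R. \<phi> u \<in> centre R)}"

definition zero_divisor_free :: "('a, 'r) ring_scheme \<Rightarrow> bool"
  where "zero_divisor_free R \<longleftrightarrow>
    (\<forall>a\<in>carrier R. \<forall>b\<in>carrier R. a \<otimes>\<^bsub>R\<^esub> b = \<zero>\<^bsub>R\<^esub> \<longrightarrow> a = \<zero>\<^bsub>R\<^esub> \<or> b = \<zero>\<^bsub>R\<^esub>)"

lemma zero_divisor_freeD:
  "zero_divisor_free R \<Longrightarrow> a \<in> carrier R \<Longrightarrow> b \<in> carrier R \<Longrightarrow>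
    a \<otimes>\<^bsub>R\<^esub> b = \<zero>\<^bsub>R\<^esub> \<Longrightarrow> a = \<zero>\<^bsub>R\<^esub> \<or> b = \<zero>\<^bsub>R\<^esub>"
  unfolding zero_divisor_free_def by blast

definition up_const :: "('a, 'r) ring_scheme \<Rightarrow> 'a \<Rightarrow> nat \<Rightarrow> 'a"
  where "up_const R a = (\<lambda>n. if n = 0 then a else \<zero>\<^bsub>R\<^esub>)"

lemma (in ring) mult_algebra_closed:
  assumes "\<phi> \<in> mult_algebra R" "u \<in> carrier R"
  shows "\<phi> u \<in> carrier R"
  using assms by (induction rule: mult_algebra.induct) auto

lemma mult_algebra_transport:
  fixes R (structure) and S (structure)
  assumes R: "ring R" and h: "h \<in> ring_hom R S" and \<phi>: "\<phi> \<in> mult_algebra R"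
  shows "\<exists>\<psi>\<in>mult_algebra S. \<forall>u\<in>carrier R. h (\<phi> u) = \<psi> (h u)"
  using \<phi>
proof (induction rule: mult_algebra.induct)
  case ident
  then show ?case by (rule bexI[of _ "\<lambda>u. u"]) (auto intro: mult_algebra.ident)
next
  case (left y \<phi>)
  then obtain \<psi> where \<psi>: "\<psi> \<in> mult_algebra S" "\<forall>u\<in>carrier R. h (\<phi> u) = \<psi> (h u)" by blast
  have "(\<lambda>u. h y \<otimes>\<^bsub>S\<^esub> \<psi> u) \<in> mult_algebra S"
    using \<psi> left h by (auto intro: mult_algebra.left ring_hom_closed)
  then show ?case
    using left \<psi> ring.mult_algebra_closed[OF R, of \<phi>]
    by (intro bexI[of _ "\<lambda>u. h y \<otimes>\<^bsub>S\<^esub> \<psi> u"]) (simp_all add: ring_hom_mult[OF h])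
next
  case (right y \<phi>)
  then obtain \<psi> where \<psi>: "\<psi> \<in> mult_algebra S" "\<forall>u\<in>carrier R. h (\<phi> u) = \<psi> (h u)" by blast
  have "(\<lambda>u. \<psi> u \<otimes>\<^bsub>S\<^esub> h y) \<in> mult_algebra S"
    using \<psi> right h by (auto intro: mult_algebra.right ring_hom_closed)
  then show ?case
    using right \<psi> ring.mult_algebra_closed[OF R, of \<phi>]
    by (intro bexI[of _ "\<lambda>u. \<psi> u \<otimes>\<^bsub>S\<^esub> h y"]) (simp_all add: ring_hom_mult[OF h])
next
  case (plus \<phi>1 \<phi>2)
  then obtain \<psi>1 \<psi>2 where \<psi>: "\<psi>1 \<in> mult_algebra S" "\<forall>u\<in>carrier R. h (\<phi>1 u) = \<psi>1 (h u)"
    "\<psi>2 \<in> mult_algebra S" "\<forall>u\<in>carrier R. h (\<phi>2 u) = \<psi>2 (h u)" by blast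
  have "(\<lambda>u. \<psi>1 u \<oplus>\<^bsub>S\<^esub> \<psi>2 u) \<in> mult_algebra S"
    using \<psi> by (auto intro: mult_algebra.plus)
  then show ?case
    using plus \<psi> ring.mult_algebra_closed[OF R, of \<phi>1] ring.mult_algebra_closed[OF R, of \<phi>2]
    by (intro bexI[of _ "\<lambda>u. \<psi>1 u \<oplus>\<^bsub>S\<^esub> \<psi>2 u"]) (simp_all add: ring_hom_add[OF h])
qed

lemma centre_ring_iso:
  fixes R (structure) and S (structure)
  assumes h: "h \<in> ring_iso R S" and z: "z \<in> centre R"
  shows "h z \<in> centre S"
proof -
  have hom: "h \<in> ring_hom R S" and surj: "h ` carrier R = carrier S"
    using h unfolding ring_iso_def bij_betw_def by blast+
  have zc: "z \<in> carrier R" using z by (rule centre_closed)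
  have "y \<otimes>\<^bsub>S\<^esub> h z = h z \<otimes>\<^bsub>S\<^esub> y" if y: "y \<in> carrier S" for y
  proof -
    obtain x where x: "x \<in> carrier R" "y = h x" using y surj by blast
    have "h (x \<otimes> z) = h (z \<otimes> x)" using centre_commute[OF z x(1)] by simp
    then show ?thesis unfolding x(2) by (simp only: ring_hom_mult[OF hom] x(1) zc)
  qed
  then show ?thesis using zc ring_hom_closed[OF hom] by (intro centreI) blast+
qed

text \<open>
  Both ingredients of the conductor, multiplications and the centre, are defined by the ring
  structure alone.
\<close>

lemma central_conductor_ring_iso:
  fixes R (structure) and S (structure)
  assumes R: "ring R" and h: "h \<in> ring_iso R S" and z: "z \<in> central_conductor R"
  shows "h z \<in> central_conductor S"
proof -
  have hom: "h \<in> ring_hom R S" and surj: "h ` carrier R = carrier S"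
    using h unfolding ring_iso_def bij_betw_def by blast+
  obtain \<phi> where \<phi>: "\<phi> \<in> mult_algebra R" "\<forall>u\<in>carrier R. \<phi> u \<in> centre R" "z = \<phi> \<one>"
    using z by (auto simp: central_conductor_def)
  obtain \<psi> where \<psi>: "\<psi> \<in> mult_algebra S" "\<forall>u\<in>carrier R. h (\<phi> u) = \<psi> (h u)"
    using mult_algebra_transport[OF R hom \<phi>(1)] by blast
  have "h z = \<psi> (h \<one>)" using \<psi>(2) \<phi>(3) monoid.one_closed[OF ring.is_monoid[OF R]] by simp
  then have "h z = \<psi> \<one>\<^bsub>S\<^esub>" by (simp add: ring_hom_one[OF hom])
  moreover have "\<psi> v \<in> centre S" if v: "v \<in> carrier S" for v
  proof -
    obtain u where u: "u \<in> carrier R" "v = h u" using v surj by blast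
    have "\<phi> u \<in> centre R" using \<phi>(2) u(1) by simp
    from centre_ring_iso[OF h this] show ?thesis using \<psi>(2) u by simp
  qed
  ultimately show ?thesis
    unfolding central_conductor_def mem_Collect_eq using \<psi>(1) by (intro exI[of _ \<psi>]) simp
qed

section \<open>Conductors of polynomial rings\<close>

context ring
begin

lemma UP_carrier: "carrier (UP R) = up R"
  by (simp add: UP_def)

lemma UP_mult_coeff:
  "p \<in> up R \<Longrightarrow> q \<in> up R \<Longrightarrow> (p \<otimes>\<^bsub>UP R\<^esub> q) n = (\<Oplus>i\<in>{..n}. p i \<otimes> q (n - i))"
  by (simp add: UP_def)

lemma UP_add_coeff:
  "p \<in> up R \<Longrightarrow> q \<in> up R \<Longrightarrow> (p \<oplus>\<^bsub>UP R\<^esub> q) n = p n \<oplus> q n"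
  by (simp add: UP_def)

lemma UP_one_eq: "\<one>\<^bsub>UP R\<^esub> = up_const R \<one>"
  by (simp add: UP_def up_const_def)

lemma UP_zero_eq: "\<zero>\<^bsub>UP R\<^esub> = (\<lambda>n. \<zero>)"
  by (simp add: UP_def)

lemma ring_UP: "ring (UP R)"
  by (intro UP_ring.UP_ring UP_ring.intro ring_axioms)

lemma up_const_closed: "a \<in> carrier R \<Longrightarrow> up_const R a \<in> up R"
  by (auto simp: up_const_def intro!: mem_upI exI[of _ 0])

lemma UP_const_mult:
  assumes "a \<in> carrier R" "p \<in> up R"
  shows "(up_const R a \<otimes>\<^bsub>UP R\<^esub> p) n = a \<otimes> p n"
proof -
  have "(up_const R a \<otimes>\<^bsub>UP R\<^esub> p) n = (\<Oplus>i\<in>{..n}. if i = 0 then a \<otimes> p n else \<zero>)"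
    unfolding UP_mult_coeff[OF up_const_closed[OF assms(1)] assms(2)]
    by (rule finsum_cong') (use assms in \<open>auto simp: up_const_def mem_upD\<close>)
  also have "\<dots> = (\<Oplus>i\<in>{..n}. if 0 = i then a \<otimes> p n else \<zero>)"
    by (rule finsum_cong') (use assms in \<open>auto simp: mem_upD\<close>)
  also have "\<dots> = a \<otimes> p n"
    using assms by (subst finsum_singleton) (auto simp: mem_upD)
  finally show ?thesis .
qed

lemma UP_mult_const:
  assumes "a \<in> carrier R" "p \<in> up R"
  shows "(p \<otimes>\<^bsub>UP R\<^esub> up_const R a) n = p n \<otimes> a"
proof -
  have "(p \<otimes>\<^bsub>UP R\<^esub> up_const R a) n = (\<Oplus>i\<in>{..n}. if n = i then p n \<otimes> a else \<zero>)"
    unfolding UP_mult_coeff[OF assms(2) up_const_closed[OF assms(1)]]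
    by (rule finsum_cong') (use assms in \<open>auto simp: up_const_def mem_upD\<close>)
  also have "\<dots> = p n \<otimes> a"
    using assms by (subst finsum_singleton) (auto simp: mem_upD)
  finally show ?thesis .
qed

lemma up_const_mult:
  "a \<in> carrier R \<Longrightarrow> b \<in> carrier R \<Longrightarrow>
    up_const R a \<otimes>\<^bsub>UP R\<^esub> up_const R b = up_const R (a \<otimes> b)"
  by (rule ext) (simp add: UP_const_mult up_const_closed, simp add: up_const_def)

lemma up_const_add:
  "a \<in> carrier R \<Longrightarrow> b \<in> carrier R \<Longrightarrow>
    up_const R a \<oplus>\<^bsub>UP R\<^esub> up_const R b = up_const R (a \<oplus> b)"
  by (rule ext) (simp add: UP_add_coeff up_const_closed, simp add: up_const_def)

text \<open>
  Multiplication by a constant acts on each coefficient separately, so replacing every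
  factor of an operator by the corresponding constant polynomial extends it to \<open>R[t]\<close>.
\<close>

lemma mult_algebra_coefficientwise:
  assumes "\<phi> \<in> mult_algebra R"
  shows "\<exists>\<Phi>\<in>mult_algebra (UP R). \<forall>p\<in>up R. \<forall>n. \<Phi> p n = \<phi> (p n)"
  using assms
proof (induction rule: mult_algebra.induct)
  case ident
  then show ?case by (rule bexI[of _ "\<lambda>u. u"]) (auto intro: mult_algebra.ident)
next
  case (left y \<phi>)
  then obtain \<Phi> where \<Phi>: "\<Phi> \<in> mult_algebra (UP R)" "\<forall>p\<in>up R. \<forall>n. \<Phi> p n = \<phi> (p n)" by blast
  have "(\<lambda>u. up_const R y \<otimes>\<^bsub>UP R\<^esub> \<Phi> u) \<in> mult_algebra (UP R)"
    using \<Phi> left by (auto intro!: mult_algebra.left simp: UP_carrier up_const_closed)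
  then show ?case
    using left \<Phi> ring.mult_algebra_closed[OF ring_UP \<Phi>(1)]
    by (intro bexI[of _ "\<lambda>u. up_const R y \<otimes>\<^bsub>UP R\<^esub> \<Phi> u"]) (simp_all add: UP_const_mult UP_carrier)
next
  case (right y \<phi>)
  then obtain \<Phi> where \<Phi>: "\<Phi> \<in> mult_algebra (UP R)" "\<forall>p\<in>up R. \<forall>n. \<Phi> p n = \<phi> (p n)" by blast
  have "(\<lambda>u. \<Phi> u \<otimes>\<^bsub>UP R\<^esub> up_const R y) \<in> mult_algebra (UP R)"
    using \<Phi> right by (auto intro!: mult_algebra.right simp: UP_carrier up_const_closed)
  then show ?case
    using right \<Phi> ring.mult_algebra_closed[OF ring_UP \<Phi>(1)]
    by (intro bexI[of _ "\<lambda>u. \<Phi> u \<otimes>\<^bsub>UP R\<^esub> up_const R y"]) (simp_all add: UP_mult_const UP_carrier)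
next
  case (plus \<phi> \<psi>)
  then obtain \<Phi> \<Psi> where \<Phi>: "\<Phi> \<in> mult_algebra (UP R)" "\<forall>p\<in>up R. \<forall>n. \<Phi> p n = \<phi> (p n)"
    and \<Psi>: "\<Psi> \<in> mult_algebra (UP R)" "\<forall>p\<in>up R. \<forall>n. \<Psi> p n = \<psi> (p n)" by blast
  have "(\<lambda>u. \<Phi> u \<oplus>\<^bsub>UP R\<^esub> \<Psi> u) \<in> mult_algebra (UP R)"
    using \<Phi> \<Psi> by (auto intro!: mult_algebra.plus)
  then show ?case
    using \<Phi> \<Psi> ring.mult_algebra_closed[OF ring_UP \<Phi>(1)] ring.mult_algebra_closed[OF ring_UP \<Psi>(1)]
    by (intro bexI[of _ "\<lambda>u. \<Phi> u \<oplus>\<^bsub>UP R\<^esub> \<Psi> u"]) (simp_all add: UP_add_coeff UP_carrier)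
qed

lemma mult_algebra_sum:
  assumes "\<And>i. i \<in> A \<Longrightarrow> \<exists>\<phi>\<in>mult_algebra R. \<forall>u\<in>carrier R. f i u = \<phi> u" "finite A"
  shows "\<exists>\<phi>\<in>mult_algebra R. \<forall>u\<in>carrier R. (\<Oplus>i\<in>A. f i u) = \<phi> u"
  using assms(2,1)
proof (induction A)
  case empty
  have "(\<lambda>u. \<zero> \<otimes> u) \<in> mult_algebra R" by (intro mult_algebra.intros) auto
  then show ?case by (auto intro!: bexI[of _ "\<lambda>u. \<zero> \<otimes> u"])
next
  case (insert a A)
  then obtain \<phi> \<psi> where \<phi>: "\<phi> \<in> mult_algebra R" "\<forall>u\<in>carrier R. f a u = \<phi> u"
    and \<psi>: "\<psi> \<in> mult_algebra R" "\<forall>u\<in>carrier R. (\<Oplus>i\<in>A. f i u) = \<psi> u" by blast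
  have cl: "f i u \<in> carrier R" if "i \<in> insert a A" "u \<in> carrier R" for i u
    using insert(4)[OF that(1)] that(2) mult_algebra_closed by auto
  have "(\<Oplus>i\<in>insert a A. f i u) = \<phi> u \<oplus> \<psi> u" if "u \<in> carrier R" for u
    using insert(1,2) \<phi>(2) \<psi>(2) cl that mult_algebra_closed[OF \<phi>(1)]
    by (subst finsum_insert) auto
  then show ?case using mult_algebra.plus[OF \<phi>(1) \<psi>(1)] by auto
qed

text \<open>
  Restricted to constants, an operator \<open>u \<mapsto> y u y'\<close> with polynomials \<open>y\<close>, \<open>y'\<close> has as its \<open>k\<close>-th
  coefficient the sum of the operators \<open>u \<mapsto> y\<^sub>i u y'\<^sub>k\<^sub>-\<^sub>i\<close> of \<open>R\<close>.
\<close>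

lemma mult_algebra_coefficient:
  assumes "\<Phi> \<in> mult_algebra (UP R)"
  shows "\<exists>\<phi>\<in>mult_algebra R. \<forall>u\<in>carrier R. \<Phi> (up_const R u) k = \<phi> u"
  using assms
proof (induction arbitrary: k rule: mult_algebra.induct)
  case ident
  show ?case
  proof (cases "k = 0")
    case True
    then show ?thesis
      by (auto simp: up_const_def intro!: bexI[of _ "\<lambda>u. u"] mult_algebra.ident)
  next
    case False
    then show ?thesis
      by (auto simp: up_const_def intro!: bexI[of _ "\<lambda>u. \<zero> \<otimes> u"] mult_algebra.intros)
  qed
next
  case (left y \<Phi>)
  have y: "y \<in> up R" using left(1) by (simp add: UP_carrier)
  have "\<exists>\<phi>\<in>mult_algebra R. \<forall>u\<in>carrier R. (\<Oplus>i\<in>{..k}. y i \<otimes> \<Phi> (up_const R u) (k - i)) = \<phi> u"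
  proof (rule mult_algebra_sum)
    fix i
    obtain \<phi> where \<phi>: "\<phi>\<in>mult_algebra R" "\<forall>u\<in>carrier R. \<Phi> (up_const R u) (k - i) = \<phi> u"
      using left(3) by blast
    show "\<exists>\<phi>\<in>mult_algebra R. \<forall>u\<in>carrier R. y i \<otimes> \<Phi> (up_const R u) (k - i) = \<phi> u"
      using \<phi> mult_algebra.left[OF mem_upD[OF y, of i] \<phi>(1)] by auto
  qed auto
  moreover have "\<Phi> (up_const R u) \<in> up R" if "u \<in> carrier R" for u
    using ring.mult_algebra_closed[OF ring_UP left(2)] up_const_closed[OF that] by (simp add: UP_carrier)
  ultimately show ?case using y by (simp add: UP_mult_coeff)
next
  case (right y \<Phi>)
  have y: "y \<in> up R" using right(1) by (simp add: UP_carrier)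
  have "\<exists>\<phi>\<in>mult_algebra R. \<forall>u\<in>carrier R. (\<Oplus>i\<in>{..k}. \<Phi> (up_const R u) i \<otimes> y (k - i)) = \<phi> u"
  proof (rule mult_algebra_sum)
    fix i
    obtain \<phi> where \<phi>: "\<phi>\<in>mult_algebra R" "\<forall>u\<in>carrier R. \<Phi> (up_const R u) i = \<phi> u"
      using right(3) by blast
    show "\<exists>\<phi>\<in>mult_algebra R. \<forall>u\<in>carrier R. \<Phi> (up_const R u) i \<otimes> y (k - i) = \<phi> u"
      using \<phi> mult_algebra.right[OF mem_upD[OF y, of "k - i"] \<phi>(1)] by auto
  qed auto
  moreover have "\<Phi> (up_const R u) \<in> up R" if "u \<in> carrier R" for u
    using ring.mult_algebra_closed[OF ring_UP right(2)] up_const_closed[OF that] by (simp add: UP_carrier)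
  ultimately show ?case using y by (simp add: UP_mult_coeff)
next
  case (plus \<Phi> \<Psi>)
  obtain \<phi> \<psi> where \<phi>: "\<phi>\<in>mult_algebra R" "\<forall>u\<in>carrier R. \<Phi> (up_const R u) k = \<phi> u"
    and \<psi>: "\<psi>\<in>mult_algebra R" "\<forall>u\<in>carrier R. \<Psi> (up_const R u) k = \<psi> u"
    using plus(3,4) by blast
  have "\<Phi> (up_const R u) \<in> up R" "\<Psi> (up_const R u) \<in> up R" if "u \<in> carrier R" for u
    using ring.mult_algebra_closed[OF ring_UP plus(1)] ring.mult_algebra_closed[OF ring_UP plus(2)]
      up_const_closed[OF that] by (simp_all add: UP_carrier)
  then show ?case using \<phi> \<psi> mult_algebra.plus[OF \<phi>(1) \<psi>(1)] by (auto simp: UP_add_coeff)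
qed

lemma centre_UP_iff:
  assumes p: "p \<in> up R"
  shows "p \<in> centre (UP R) \<longleftrightarrow> (\<forall>n. p n \<in> centre R)"
proof
  assume c: "p \<in> centre (UP R)"
  have "y \<otimes> p n = p n \<otimes> y" if "y \<in> carrier R" for y n
    using centre_commute[OF c, of "up_const R y"] up_const_closed[OF that]
      UP_const_mult[OF that p, of n] UP_mult_const[OF that p, of n]
    by (simp add: UP_carrier)
  then show "\<forall>n. p n \<in> centre R" using p by (intro allI centreI) (auto simp: mem_upD)
next
  assume c: "\<forall>n. p n \<in> centre R"
  have "q \<otimes>\<^bsub>UP R\<^esub> p = p \<otimes>\<^bsub>UP R\<^esub> q" if q: "q \<in> up R" for q
  proof
    fix n
    have "(p \<otimes>\<^bsub>UP R\<^esub> q) n = (\<Oplus>i\<in>{..n}. p i \<otimes> q (n - i))"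
      using p q by (simp add: UP_mult_coeff)
    also have "\<dots> = (\<Oplus>i\<in>(\<lambda>i. n - i) ` {..n}. p i \<otimes> q (n - i))"
    proof (rule finsum_cong')
      show "{..n} = (\<lambda>i. n - i) ` {..n}"
      proof (intro equalityI subsetI)
        fix i assume "i \<in> {..n}"
        then have "i = n - (n - i)" "n - i \<in> {..n}" by auto
        then show "i \<in> (\<lambda>i. n - i) ` {..n}" by (rule image_eqI)
      qed auto
    qed (use p q in \<open>auto simp: mem_upD\<close>)
    also have "\<dots> = (\<Oplus>i\<in>{..n}. p (n - i) \<otimes> q (n - (n - i)))"
      by (rule finsum_reindex) (use p q in \<open>auto simp: mem_upD inj_on_def\<close>)
    also have "\<dots> = (\<Oplus>i\<in>{..n}. q i \<otimes> p (n - i))"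
    proof (rule finsum_cong')
      show "p (n - i) \<otimes> q (n - (n - i)) = q i \<otimes> p (n - i)" if "i \<in> {..n}" for i
        using that centre_commute[OF c[rule_format, of "n - i"], of "q i"] q by (simp add: mem_upD)
    qed (use p q in \<open>auto simp: mem_upD\<close>)
    also have "\<dots> = (q \<otimes>\<^bsub>UP R\<^esub> p) n" using p q by (simp add: UP_mult_coeff)
    finally show "(q \<otimes>\<^bsub>UP R\<^esub> p) n = (p \<otimes>\<^bsub>UP R\<^esub> q) n" by simp
  qed
  then show "p \<in> centre (UP R)" using p by (intro centreI) (simp_all add: UP_carrier)
qed

lemma central_conductor_const:
  assumes "z \<in> central_conductor R"
  shows "up_const R z \<in> central_conductor (UP R)"
proof -
  obtain \<phi> where \<phi>: "\<phi> \<in> mult_algebra R" "\<forall>u\<in>carrier R. \<phi> u \<in> centre R" "z = \<phi> \<one>"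
    using assms by (auto simp: central_conductor_def)
  obtain \<Phi> where \<Phi>: "\<Phi> \<in> mult_algebra (UP R)" "\<forall>p\<in>up R. \<forall>n. \<Phi> p n = \<phi> (p n)"
    using mult_algebra_coefficientwise[OF \<phi>(1)] by blast
  have \<Phi>c: "\<Phi> p \<in> up R" if "p \<in> up R" for p
    using ring.mult_algebra_closed[OF ring_UP \<Phi>(1)] that by (simp add: UP_carrier)
  have phi0: "\<phi> \<zero> = \<zero>"
    using \<phi>(1)
    by (induction rule: mult_algebra.induct) auto
  have "\<Phi> \<one>\<^bsub>UP R\<^esub> = up_const R z"
    unfolding UP_one_eq
    by (rule ext) (use \<Phi> up_const_closed[of \<one>] \<phi>(3) phi0 in \<open>auto simp: up_const_def\<close>)
  moreover have "\<Phi> p \<in> centre (UP R)" if "p \<in> up R" for p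
    using \<phi>(2) \<Phi>(2) that \<Phi>c[OF that] by (simp add: centre_UP_iff mem_upD)
  ultimately show ?thesis
    unfolding central_conductor_def mem_Collect_eq UP_carrier using \<Phi>(1)
    by (intro exI[of _ \<Phi>]) simp
qed

text \<open>
  Since a polynomial is central exactly if its coefficients are, the \<open>k\<close>-th coefficient of an
  operator with central values on \<open>R[t]\<close> has central values on \<open>R\<close>.
\<close>

lemma central_conductor_coeff:
  assumes "z \<in> central_conductor (UP R)"
  shows "z k \<in> central_conductor R"
proof -
  obtain \<Phi> where \<Phi>: "\<Phi> \<in> mult_algebra (UP R)" "\<forall>u\<in>up R. \<Phi> u \<in> centre (UP R)" "z = \<Phi> \<one>\<^bsub>UP R\<^esub>"
    using assms by (auto simp: central_conductor_def UP_carrier)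
  obtain \<phi> where \<phi>: "\<phi> \<in> mult_algebra R" "\<forall>u\<in>carrier R. \<Phi> (up_const R u) k = \<phi> u"
    using mult_algebra_coefficient[OF \<Phi>(1)] by blast
  have "\<phi> u \<in> centre R" if "u \<in> carrier R" for u
  proof -
    have "\<Phi> (up_const R u) \<in> centre (UP R)" using \<Phi>(2) up_const_closed[OF that] by blast
    moreover from this have "\<Phi> (up_const R u) \<in> up R" by (simp add: centre_closed flip: UP_carrier)
    ultimately show ?thesis using \<phi>(2) that by (metis centre_UP_iff)
  qed
  moreover have "z k = \<phi> \<one>" using \<phi>(2) \<Phi>(3) by (simp add: UP_one_eq)
  ultimately show ?thesis
    unfolding central_conductor_def mem_Collect_eq using \<phi>(1)
    by (intro exI[of _ \<phi>]) simp
qed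

lemma UP_nonzero_coeff: "p \<noteq> \<zero>\<^bsub>UP R\<^esub> \<Longrightarrow> \<exists>k. p k \<noteq> \<zero>"
  unfolding UP_zero_eq by (rule ccontr) auto

lemma up_top_coeff:
  assumes p: "p \<in> up R" and nz: "p k \<noteq> \<zero>"
  shows "\<exists>m. p m \<noteq> \<zero> \<and> (\<forall>i>m. p i = \<zero>)"
proof -
  obtain b where b: "bound \<zero> b p" using p by (auto simp: up_def)
  have bd: "\<forall>i. p i \<noteq> \<zero> \<longrightarrow> i < Suc b" using bound_below[OF b] by (simp add: less_Suc_eq_le)
  obtain m where m: "p m \<noteq> \<zero>" "\<forall>i. p i \<noteq> \<zero> \<longrightarrow> i \<le> m"
    using ex_has_greatest_nat[of "\<lambda>i. p i \<noteq> \<zero>" k "\<lambda>i. i", OF nz bd] by auto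
  have "\<forall>i>m. p i = \<zero>" using m(2) by (auto simp flip: not_le)
  then show ?thesis using m(1) by (intro exI[of _ m] conjI)
qed

lemma UP_mult_top:
  assumes p: "p \<in> up R" and q: "q \<in> up R"
    and pm: "\<forall>i>m. p i = \<zero>" and ql: "\<forall>i>l. q i = \<zero>"
  shows "(p \<otimes>\<^bsub>UP R\<^esub> q) (m + l) = p m \<otimes> q l"
proof -
  have "(p \<otimes>\<^bsub>UP R\<^esub> q) (m + l) = (\<Oplus>i\<in>{..m+l}. if m = i then p i \<otimes> q l else \<zero>)"
    unfolding UP_mult_coeff[OF p q]
  proof (rule finsum_cong')
    fix i assume "i \<in> {..m + l}"
    consider "i < m" | "i = m" | "m < i" by linarith
    then show "p i \<otimes> q (m + l - i) = (if m = i then p i \<otimes> q l else \<zero>)"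
      by cases (use p q pm ql in \<open>auto simp: mem_upD\<close>)
  qed (use p q in \<open>auto simp: mem_upD\<close>)
  also have "\<dots> = p m \<otimes> q l"
    using p q by (subst finsum_singleton) (auto simp: mem_upD)
  finally show ?thesis .
qed

lemma zero_divisor_free_UP:
  assumes "zero_divisor_free R"
  shows "zero_divisor_free (UP R)"
  unfolding zero_divisor_free_def UP_carrier
proof (intro ballI impI)
  fix p q assume p: "p \<in> up R" and q: "q \<in> up R" and pq: "p \<otimes>\<^bsub>UP R\<^esub> q = \<zero>\<^bsub>UP R\<^esub>"
  show "p = \<zero>\<^bsub>UP R\<^esub> \<or> q = \<zero>\<^bsub>UP R\<^esub>"
  proof (rule ccontr)
    assume "\<not> ?thesis"
    then have "p \<noteq> \<zero>\<^bsub>UP R\<^esub>" "q \<noteq> \<zero>\<^bsub>UP R\<^esub>" by simp_all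
    then obtain k l where k: "p k \<noteq> \<zero>" and l: "q l \<noteq> \<zero>"
      using UP_nonzero_coeff[of p] UP_nonzero_coeff[of q] by blast
    obtain m where m: "p m \<noteq> \<zero>" "\<forall>i>m. p i = \<zero>"
      using up_top_coeff[OF p k] by blast
    obtain m' where m': "q m' \<noteq> \<zero>" "\<forall>i>m'. q i = \<zero>"
      using up_top_coeff[OF q l] by blast
    have "p m \<otimes> q m' = \<zero>"
      using UP_mult_top[OF p q m(2) m'(2)] pq by (simp add: UP_zero_eq)
    from zero_divisor_freeD[OF assms mem_upD[OF p] mem_upD[OF q] this]
    show False using m(1) m'(1) by simp
  qed
qed

text \<open>
  Without zero divisors degrees add up, so the factors of a nonzero constant are constants.
\<close>

lemma up_constant_factor:
  assumes dom: "zero_divisor_free R"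
    and p: "p \<in> up R" and q: "q \<in> up R"
    and nz: "p \<otimes>\<^bsub>UP R\<^esub> q \<noteq> \<zero>\<^bsub>UP R\<^esub>"
    and c: "p \<otimes>\<^bsub>UP R\<^esub> q \<in> range (up_const R)"
  shows "p = up_const R (p 0)" "q = up_const R (q 0)"
proof -
  interpret UPR: ring "UP R" by (rule ring_UP)
  have "p \<noteq> \<zero>\<^bsub>UP R\<^esub>" "q \<noteq> \<zero>\<^bsub>UP R\<^esub>" using nz p q by (auto simp: UP_carrier)
  then obtain k l where k: "p k \<noteq> \<zero>" and l: "q l \<noteq> \<zero>"
    using UP_nonzero_coeff[of p] UP_nonzero_coeff[of q] by blast
  obtain m where m: "p m \<noteq> \<zero>" "\<forall>i>m. p i = \<zero>"
    using up_top_coeff[OF p k] by blast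
  obtain m' where m': "q m' \<noteq> \<zero>" "\<forall>i>m'. q i = \<zero>"
    using up_top_coeff[OF q l] by blast
  have "(p \<otimes>\<^bsub>UP R\<^esub> q) (m + m') \<noteq> \<zero>"
    unfolding UP_mult_top[OF p q m(2) m'(2)]
    using zero_divisor_freeD[OF dom mem_upD[OF p] mem_upD[OF q]] m(1) m'(1) by blast
  then have "m + m' = 0" using c by (auto simp: up_const_def split: if_splits)
  then show "p = up_const R (p 0)" "q = up_const R (q 0)" using m(2) m'(2)
    by (auto simp: up_const_def fun_eq_iff)
qed

lemma up_const_pow:
  "a \<in> carrier R \<Longrightarrow> up_const R a [^]\<^bsub>UP R\<^esub> (N::nat) = up_const R (a [^] N)"
  by (induction N) (simp_all add: UP_one_eq up_const_mult)

lemma zero_divisor_free_pow: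
  assumes "zero_divisor_free R" "a \<in> carrier R" "a \<noteq> \<zero>"
  shows "a [^] (N::nat) \<noteq> \<zero>"
proof (induction N)
  case 0
  have "\<one> \<noteq> \<zero>"
  proof
    assume "\<one> = \<zero>"
    then have "a = \<zero>" using assms(2) l_one[of a] by simp
    then show False using assms(3) by blast
  qed
  then show ?case by simp
next
  case (Suc N)
  have "a [^] N \<in> carrier R" using assms(2) by simp
  from zero_divisor_freeD[OF assms(1) this assms(2)] Suc assms(3) show ?case by auto
qed

end

section \<open>Cancellation through the central conductor\<close>

definition up_shift :: "(nat \<Rightarrow> 'a) \<Rightarrow> nat \<Rightarrow> 'a"
  where "up_shift p = (\<lambda>n. p (Suc n))"

definition up_var :: "('a, 'r) ring_scheme \<Rightarrow> nat \<Rightarrow> 'a"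
  where "up_var R = (\<lambda>n. if n = 1 then \<one>\<^bsub>R\<^esub> else \<zero>\<^bsub>R\<^esub>)"

context ring
begin

lemma up_shift_closed: "p \<in> up R \<Longrightarrow> up_shift p \<in> up R"
proof (rule mem_upI)
  assume p: "p \<in> up R"
  show "up_shift p n \<in> carrier R" for n using p by (auto simp: up_shift_def)
  obtain b where b: "bound \<zero> b p" using p by (auto simp: up_def)
  have "bound \<zero> b (up_shift p)" using bound.bound[OF b] by (intro bound.intro) (simp add: up_shift_def)
  then show "\<exists>n. bound \<zero> n (up_shift p)" by blast
qed

lemma up_var_closed: "up_var R \<in> up R"
  by (rule mem_upI) (auto simp: up_var_def intro!: exI[of _ 1])

lemma up_var_mult_Suc:
  assumes p: "p \<in> up R"
  shows "(up_var R \<otimes>\<^bsub>UP R\<^esub> p) (Suc n) = p n"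
proof -
  have "(up_var R \<otimes>\<^bsub>UP R\<^esub> p) (Suc n) = (\<Oplus>i\<in>{..Suc n}. if 1 = i then p n else \<zero>)"
    unfolding UP_mult_coeff[OF up_var_closed p]
    by (rule finsum_cong') (use p in \<open>auto simp: up_var_def mem_upD\<close>)
  also have "\<dots> = p n"
    using p by (subst finsum_singleton) (auto simp: mem_upD)
  finally show ?thesis .
qed

lemma up_var_mult_0:
  assumes p: "p \<in> up R"
  shows "(up_var R \<otimes>\<^bsub>UP R\<^esub> p) 0 = \<zero>"
  unfolding UP_mult_coeff[OF up_var_closed p]
  using p by (simp add: up_var_def mem_upD)

lemma up_horner:
  assumes p: "p \<in> up R"
  shows "p = up_const R (p 0) \<oplus>\<^bsub>UP R\<^esub> (up_var R \<otimes>\<^bsub>UP R\<^esub> up_shift p)"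
proof
  fix n
  interpret UPR: ring "UP R" by (rule ring_UP)
  have c: "up_var R \<otimes>\<^bsub>UP R\<^esub> up_shift p \<in> up R" "up_const R (p 0) \<in> up R"
    using UPR.m_closed[of "up_var R" "up_shift p"] up_var_closed up_shift_closed[OF p]
      up_const_closed[OF mem_upD[OF p]] by (simp_all add: UP_carrier)
  show "p n = (up_const R (p 0) \<oplus>\<^bsub>UP R\<^esub> (up_var R \<otimes>\<^bsub>UP R\<^esub> up_shift p)) n"
  proof (cases n)
    case 0
    then show ?thesis using p c
      by (simp add: UP_add_coeff up_var_mult_0 up_shift_closed mem_upD) (simp add: up_const_def mem_upD)
  next
    case (Suc k)
    then show ?thesis using p c
      by (simp add: UP_add_coeff up_var_mult_Suc up_shift_closed mem_upD)
        (simp add: up_const_def up_shift_def mem_upD)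
  qed
qed

lemma up_const_0: "p \<in> range (up_const R) \<longleftrightarrow> p = up_const R (p 0)"
proof
  assume "p \<in> range (up_const R)"
  then obtain a where "p = up_const R a" by blast
  then show "p = up_const R (p 0)" by (simp add: up_const_def)
qed blast

lemma up_induct_horner [consumes 1, case_names const step]:
  assumes p: "p \<in> up R"
    and const: "\<And>a. a \<in> carrier R \<Longrightarrow> P (up_const R a)"
    and step: "\<And>a p. a \<in> carrier R \<Longrightarrow> p \<in> up R \<Longrightarrow> P p \<Longrightarrow>
      P (up_const R a \<oplus>\<^bsub>UP R\<^esub> (up_var R \<otimes>\<^bsub>UP R\<^esub> p))"
  shows "P p"
proof -
  obtain b where b: "bound \<zero> b p" using p by (auto simp: up_def)
  have "\<forall>i\<ge>Suc b. p i = \<zero>" using bound.bound[OF b] by simp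
  then show ?thesis using p
  proof (induction "Suc b" arbitrary: b p)
    case (Suc b)
    show ?case
    proof (cases b)
      case 0
      then have "p = up_const R (p 0)" using Suc by (auto simp: up_const_def fun_eq_iff Suc_le_eq)
      then show ?thesis using const[OF mem_upD[OF Suc(3), of 0]] by simp
    next
      case (Suc c)
      have "P (up_shift p)"
        using Suc.hyps(1)[OF Suc, of "up_shift p"] Suc.prems Suc up_shift_closed
        by (auto simp: up_shift_def)
      then show ?thesis
        using step[OF mem_upD[OF Suc.prems(2), of 0] up_shift_closed[OF Suc.prems(2)]]
          up_horner[OF Suc.prems(2)] by simp
    qed
  qed
qed

end

text \<open>
  The cancellation criterion.  The conductor provides a nonzero constant of \<open>S[s]\<close> whose preimage \<open>p\<close>
  has coefficients in the conductor of \<open>R\<close>.  Each additive generator of \<open>R\<close> divides a power of \<open>p\<close>,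
  so its image divides a constant and is itself constant.
\<close>

lemma conductor_retraction:
  fixes R (structure) and S (structure)
  assumes R: "ring R" and S: "ring S" and h: "h \<in> ring_iso (UP R) (UP S)"
    and dom: "zero_divisor_free R"
    and nonzero: "z \<in> central_conductor R" "z \<noteq> \<zero>"
    and gen: "\<And>T. G \<subseteq> T \<Longrightarrow> (\<And>x y. x \<in> T \<Longrightarrow> y \<in> T \<Longrightarrow> x \<oplus> y \<in> T) \<Longrightarrow> carrier R \<subseteq> T"
    and G: "G \<subseteq> carrier R"
    and div: "\<And>p g. p \<in> up R \<Longrightarrow> p \<noteq> \<zero>\<^bsub>UP R\<^esub> \<Longrightarrow> (\<And>k. p k \<in> central_conductor R) \<Longrightarrow> g \<in> G \<Longrightarrow>
      g = \<zero> \<or> (\<exists>N::nat. \<exists>w\<in>up R. p [^]\<^bsub>UP R\<^esub> N = up_const R g \<otimes>\<^bsub>UP R\<^esub> w)"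
  shows "\<exists>f\<in>ring_iso R S. \<forall>r\<in>carrier R. h (up_const R r) = up_const S (f r)"
proof -
  interpret R: ring R by fact
  interpret S: ring S by fact
  interpret UPR: ring "UP R" by (rule R.ring_UP)
  interpret UPS: ring "UP S" by (rule S.ring_UP)
  have hom: "h \<in> ring_hom (UP R) (UP S)" and bij: "bij_betw h (up R) (up S)"
    using h unfolding ring_iso_def R.UP_carrier S.UP_carrier by blast+
  have inj: "inj_on h (up R)" and surj: "h ` up R = up S"
    using bij unfolding bij_betw_def by blast+
  have surjD: "\<exists>p. p \<in> up R \<and> h p = q" if "q \<in> up S" for q
    using that unfolding surj[symmetric] by auto
  interpret H: ring_hom_ring "UP R" "UP S" h
    by (rule ring_hom_ringI2) (use hom R.ring_UP S.ring_UP in blast)+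
  have hc: "h p \<in> up S" if "p \<in> up R" for p using H.hom_closed that by (simp add: R.UP_carrier S.UP_carrier)
  note [simp] = R.UP_carrier S.UP_carrier
  note [simp] = UPR.m_closed[unfolded R.UP_carrier] UPS.m_closed[unfolded S.UP_carrier]
    UPR.nat_pow_closed[unfolded R.UP_carrier] UPS.nat_pow_closed[unfolded S.UP_carrier]
    UPR.a_closed[unfolded R.UP_carrier] UPS.a_closed[unfolded S.UP_carrier]
  have h0: "h p = \<zero>\<^bsub>UP S\<^esub> \<longleftrightarrow> p = \<zero>\<^bsub>UP R\<^esub>" if "p \<in> up R" for p
    using inj_onD[OF inj, of p "\<zero>\<^bsub>UP R\<^esub>"] that UPR.zero_closed by auto
  have domUP: "zero_divisor_free (UP R)" by (rule R.zero_divisor_free_UP[OF dom])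
  \<comment> \<open>The absence of zero divisors passes along \<open>R\<close>, \<open>R[t]\<close>, \<open>S[s]\<close>, \<open>S\<close>.\<close>
  have domUPS: "zero_divisor_free (UP S)"
    unfolding zero_divisor_free_def
  proof (intro ballI impI)
    fix p q assume p: "p \<in> carrier (UP S)" and q: "q \<in> carrier (UP S)" and pq: "p \<otimes>\<^bsub>UP S\<^esub> q = \<zero>\<^bsub>UP S\<^esub>"
    obtain p' where p': "p' \<in> up R" "p = h p'" using surjD[of p] p by auto
    obtain q' where q': "q' \<in> up R" "q = h q'" using surjD[of q] q by auto
    have "h (p' \<otimes>\<^bsub>UP R\<^esub> q') = \<zero>\<^bsub>UP S\<^esub>" using pq p' q' by simp
    moreover have "p' \<otimes>\<^bsub>UP R\<^esub> q' \<in> up R" using UPR.m_closed[of p' q'] p'(1) q'(1) by simp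
    ultimately have "p' \<otimes>\<^bsub>UP R\<^esub> q' = \<zero>\<^bsub>UP R\<^esub>" using h0 by blast
    then have "p' = \<zero>\<^bsub>UP R\<^esub> \<or> q' = \<zero>\<^bsub>UP R\<^esub>"
      using zero_divisor_freeD[OF domUP, of p' q'] p' q' by simp
    then show "p = \<zero>\<^bsub>UP S\<^esub> \<or> q = \<zero>\<^bsub>UP S\<^esub>" using p' q' by auto
  qed
  have domS: "zero_divisor_free S"
    unfolding zero_divisor_free_def
  proof (intro ballI impI)
    fix a b assume a: "a \<in> carrier S" and b: "b \<in> carrier S" and ab: "a \<otimes>\<^bsub>S\<^esub> b = \<zero>\<^bsub>S\<^esub>"
    have "up_const S a \<otimes>\<^bsub>UP S\<^esub> up_const S b = \<zero>\<^bsub>UP S\<^esub>"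
      using ab a b by (simp add: S.up_const_mult S.UP_zero_eq) (simp add: up_const_def)
    then have "up_const S a = \<zero>\<^bsub>UP S\<^esub> \<or> up_const S b = \<zero>\<^bsub>UP S\<^esub>"
      using zero_divisor_freeD[OF domUPS, of "up_const S a" "up_const S b"] a b
      by (simp add: S.up_const_closed)
    then have "up_const S a 0 = \<zero>\<^bsub>S\<^esub> \<or> up_const S b 0 = \<zero>\<^bsub>S\<^esub>"
      unfolding S.UP_zero_eq by (elim disjE) (simp_all only: simp_thms)
    then show "a = \<zero>\<^bsub>S\<^esub> \<or> b = \<zero>\<^bsub>S\<^esub>" by (simp add: up_const_def)
  qed

  have zc: "up_const R z \<in> central_conductor (UP R)" by (rule R.central_conductor_const[OF nonzero(1)])
  have zR: "z \<in> carrier R"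
    using nonzero(1) unfolding central_conductor_def by (auto intro: R.mult_algebra_closed)
  have "up_const R z \<noteq> \<zero>\<^bsub>UP R\<^esub>"
    using nonzero(2) unfolding R.UP_zero_eq up_const_def fun_eq_iff by (auto intro!: exI[of _ 0])
  then have "h (up_const R z) \<noteq> \<zero>\<^bsub>UP S\<^esub>" using h0 R.up_const_closed[OF zR] by simp
  then obtain k where k: "h (up_const R z) k \<noteq> \<zero>\<^bsub>S\<^esub>" using S.UP_nonzero_coeff by blast
  \<comment> \<open>Some coefficient of the image of a conductor element is a nonzero conductor element of \<open>S\<close>.\<close>
  define b where "b = h (up_const R z) k"
  have b: "b \<in> central_conductor S" "b \<noteq> \<zero>\<^bsub>S\<^esub>"
    using S.central_conductor_coeff[OF central_conductor_ring_iso[OF R.ring_UP h zc]] k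
    by (simp_all add: b_def)
  have bS: "b \<in> carrier S" unfolding b_def by (rule mem_upD[OF hc[OF R.up_const_closed[OF zR]]])
  obtain p where p: "p \<in> up R" "h p = up_const S b"
    using surjD[OF S.up_const_closed[OF bS]] by blast
  define h' where "h' = inv_into (up R) h"
  have h': "h' \<in> ring_iso (UP S) (UP R)"
    using ring_iso_set_sym[OF R.ring_UP h] by (simp add: h'_def)
  have "h' (up_const S b) = p" using p inj by (simp add: h'_def flip: p(2))
  then have pc: "p \<in> central_conductor (UP R)"
    using central_conductor_ring_iso[OF S.ring_UP h' S.central_conductor_const[OF b(1)]] by simp
  have bne: "up_const S b \<noteq> \<zero>\<^bsub>UP S\<^esub>"
    using b(2) unfolding S.UP_zero_eq up_const_def fun_eq_iff by (auto intro!: exI[of _ 0])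
  have pne: "p \<noteq> \<zero>\<^bsub>UP R\<^esub>" using bne p by auto

  define T where "T = {r \<in> carrier R. h (up_const R r) \<in> range (up_const S)}"
  have "g \<in> T" if g: "g \<in> G" for g
  proof (cases "g = \<zero>")
    case True
    have "up_const R \<zero> = \<zero>\<^bsub>UP R\<^esub>" by (simp add: up_const_def R.UP_zero_eq fun_eq_iff)
    moreover have "\<zero>\<^bsub>UP S\<^esub> = up_const S \<zero>\<^bsub>S\<^esub>" by (simp add: up_const_def S.UP_zero_eq fun_eq_iff)
    ultimately show ?thesis using True by (simp add: T_def)
  next
    case False
    have gR: "g \<in> carrier R" using g G by blast
    obtain N :: nat and w where w: "w \<in> up R" and N: "p [^]\<^bsub>UP R\<^esub> N = up_const R g \<otimes>\<^bsub>UP R\<^esub> w"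
      using div[OF p(1) pne R.central_conductor_coeff[OF pc] g] False by blast
    have "h (up_const R g) \<otimes>\<^bsub>UP S\<^esub> h w = h (p [^]\<^bsub>UP R\<^esub> N)"
      using w gR by (simp add: N R.up_const_closed)
    also have "\<dots> = up_const S b [^]\<^bsub>UP S\<^esub> N"
      using p by (induction N) simp_all
    finally have e: "h (up_const R g) \<otimes>\<^bsub>UP S\<^esub> h w = up_const S b [^]\<^bsub>UP S\<^esub> N" .
    have "h (up_const R g) = up_const S (h (up_const R g) 0)"
    proof (rule S.up_constant_factor(1)[OF domS hc hc])
      show "h (up_const R g) \<otimes>\<^bsub>UP S\<^esub> h w \<noteq> \<zero>\<^bsub>UP S\<^esub>"
        unfolding e by (rule UPS.zero_divisor_free_pow[OF domUPS _ bne]) (simp add: S.up_const_closed bS)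
    qed (use w gR e in \<open>simp_all add: R.up_const_closed S.up_const_pow bS\<close>)
    then show ?thesis using gR unfolding T_def by blast
  qed
  then have "carrier R \<subseteq> T"
  proof (intro gen subsetI)
    fix x y assume "x \<in> T" "y \<in> T"
    then obtain a b where x: "x \<in> carrier R" "h (up_const R x) = up_const S a"
      and y: "y \<in> carrier R" "h (up_const R y) = up_const S b"
      unfolding T_def by blast
    have a: "a \<in> carrier S" "b \<in> carrier S"
      using mem_upD[OF hc[OF R.up_const_closed[OF x(1)]], of 0] mem_upD[OF hc[OF R.up_const_closed[OF y(1)]], of 0]
      by (simp_all add: x y, simp_all add: up_const_def)
    have "h (up_const R (x \<oplus> y)) = up_const S (a \<oplus>\<^bsub>S\<^esub> b)"
      using x y a by (simp add: R.up_const_closed flip: R.up_const_add S.up_const_add)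
    then show "x \<oplus> y \<in> T" unfolding T_def using x(1) y(1) by blast
  qed
  then have is_const: "h (up_const R r) = up_const S (h (up_const R r) 0)" if "r \<in> carrier R" for r
    using that unfolding T_def S.up_const_0[symmetric] by blast

  \<comment> \<open>If \<open>h\<close> mapped the variable to a constant, all values of \<open>h\<close> would be constant.\<close>
  have tn: "h (up_var R) \<noteq> up_const S (h (up_var R) 0)"
  proof
    assume t: "h (up_var R) = up_const S (h (up_var R) 0)"
    have all: "h q \<in> range (up_const S)" if "q \<in> up R" for q
      using that
    proof (induction rule: R.up_induct_horner)
      case (const a)
      then show ?case using is_const[of a] by blast
    next
      case (step a q)
      obtain c where c: "h q = up_const S c" using step by blast
      have cS: "c \<in> carrier S"
        using mem_upD[OF hc[OF step(2)], of 0] by (simp add: c) (simp add: up_const_def)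
      have tS: "h (up_var R) 0 \<in> carrier S" by (rule mem_upD[OF hc[OF R.up_var_closed]])
      have aS: "h (up_const R a) 0 \<in> carrier S" by (rule mem_upD[OF hc[OF R.up_const_closed[OF step(1)]]])
      have "h (up_const R a \<oplus>\<^bsub>UP R\<^esub> (up_var R \<otimes>\<^bsub>UP R\<^esub> q))
        = h (up_const R a) \<oplus>\<^bsub>UP S\<^esub> (h (up_var R) \<otimes>\<^bsub>UP S\<^esub> h q)"
        using step by (simp add: R.up_const_closed R.up_var_closed)
      also have "\<dots> = up_const S (h (up_const R a) 0) \<oplus>\<^bsub>UP S\<^esub> (up_const S (h (up_var R) 0) \<otimes>\<^bsub>UP S\<^esub> up_const S c)"
        unfolding c using is_const[OF step(1)] t by simp
      also have "\<dots> = up_const S (h (up_const R a) 0 \<oplus>\<^bsub>S\<^esub> (h (up_var R) 0 \<otimes>\<^bsub>S\<^esub> c))"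
        by (simp only: S.up_const_mult[OF tS cS] S.up_const_add[OF aS S.m_closed[OF tS cS]])
      finally show ?case by blast
    qed
    obtain q where q: "q \<in> up R" "h q = up_var S" using surjD[OF S.up_var_closed] by blast
    obtain c where "up_var S = up_const S c" using all[OF q(1)] q(2) by auto
    then have "up_var S 1 = up_const S c 1" by simp
    then have one: "\<one>\<^bsub>S\<^esub> = \<zero>\<^bsub>S\<^esub>" by (simp add: up_var_def up_const_def)
    have "b = \<one>\<^bsub>S\<^esub> \<otimes>\<^bsub>S\<^esub> b" using bS by simp
    then have "b = \<zero>\<^bsub>S\<^esub>" unfolding one using bS by simp
    then show False using b(2) by blast
  qed

  define f where "f r = h (up_const R r) 0" for r
  have f: "h (up_const R r) = up_const S (f r)" if "r \<in> carrier R" for r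
    using is_const[OF that] by (simp add: f_def)
  have fc: "f r \<in> carrier S" if "r \<in> carrier R" for r
    unfolding f_def by (rule mem_upD[OF hc[OF R.up_const_closed[OF that]]])
  have cinj: "a = a'" if "up_const S a = up_const S a'" for a a'
    using fun_cong[OF that, of 0] by (simp add: up_const_def)
  have cinjR: "a = a'" if "up_const R a = up_const R a'" for a a'
    using fun_cong[OF that, of 0] by (simp add: up_const_def)
  have "f \<in> ring_hom R S"
  proof (rule ring_hom_memI)
    fix x y assume x: "x \<in> carrier R" and y: "y \<in> carrier R"
    show "f x \<in> carrier S" by (rule fc[OF x])
    show "f (x \<otimes> y) = f x \<otimes>\<^bsub>S\<^esub> f y"
      by (rule cinj) (use x y fc in \<open>simp add: R.up_const_closed flip: f S.up_const_mult R.up_const_mult\<close>)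
    show "f (x \<oplus> y) = f x \<oplus>\<^bsub>S\<^esub> f y"
      by (rule cinj) (use x y fc in \<open>simp add: R.up_const_closed flip: f S.up_const_add R.up_const_add\<close>)
  next
    show "f \<one> = \<one>\<^bsub>S\<^esub>"
      by (rule cinj) (simp flip: f R.UP_one_eq S.UP_one_eq)
  qed
  moreover have "inj_on f (carrier R)"
  proof (rule inj_onI)
    fix x y assume x: "x \<in> carrier R" and y: "y \<in> carrier R" and xy: "f x = f y"
    have "h (up_const R x) = h (up_const R y)" using f x y xy by simp
    then show "x = y" using inj_onD[OF inj] R.up_const_closed x y cinjR by blast
  qed
  moreover have "carrier S \<subseteq> f ` carrier R"
  proof
    fix s assume s: "s \<in> carrier S"
    obtain q where q: "q \<in> up R" "h q = up_const S s" using surjD[OF S.up_const_closed[OF s]] by blast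
    have q0: "q 0 \<in> carrier R" by (rule mem_upD[OF q(1)])
    have sh: "up_shift q \<in> up R" by (rule R.up_shift_closed[OF q(1)])
    \<comment> \<open>Write \<open>q = q\<^sub>0 + t q'\<close>.  As \<open>h q\<close> and \<open>h q\<^sub>0\<close> are constant, so is \<open>h t h q'\<close>, and \<open>h t\<close> is not;
      hence \<open>q' = 0\<close>.\<close>
    have "h q = h (up_const R (q 0) \<oplus>\<^bsub>UP R\<^esub> (up_var R \<otimes>\<^bsub>UP R\<^esub> up_shift q))"
      using R.up_horner[OF q(1)] by simp
    also have "\<dots> = up_const S (f (q 0)) \<oplus>\<^bsub>UP S\<^esub> (h (up_var R) \<otimes>\<^bsub>UP S\<^esub> h (up_shift q))"
      using q0 sh by (simp add: f R.up_const_closed R.up_var_closed)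
    finally have e: "up_const S s = up_const S (f (q 0)) \<oplus>\<^bsub>UP S\<^esub> (h (up_var R) \<otimes>\<^bsub>UP S\<^esub> h (up_shift q))"
      using q(2) by simp
    have prod: "h (up_var R) \<otimes>\<^bsub>UP S\<^esub> h (up_shift q) \<in> up S"
      using UPS.m_closed[of "h (up_var R)" "h (up_shift q)"] hc[OF sh] hc[OF R.up_var_closed] by simp
    have pc: "(h (up_var R) \<otimes>\<^bsub>UP S\<^esub> h (up_shift q)) n = \<zero>\<^bsub>S\<^esub>" if n: "n \<noteq> 0" for n
    proof -
      have "up_const S s n = up_const S (f (q 0)) n \<oplus>\<^bsub>S\<^esub> (h (up_var R) \<otimes>\<^bsub>UP S\<^esub> h (up_shift q)) n"
        by (subst e) (simp add: S.UP_add_coeff[OF S.up_const_closed[OF fc[OF q0]] prod])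
      then show ?thesis using n mem_upD[OF prod, of n] by (simp add: up_const_def)
    qed
    have "up_shift q = \<zero>\<^bsub>UP R\<^esub>"
    proof (rule ccontr)
      assume "up_shift q \<noteq> \<zero>\<^bsub>UP R\<^esub>"
      then have n1: "h (up_shift q) \<noteq> \<zero>\<^bsub>UP S\<^esub>" using h0[OF sh] by simp
      have n2: "h (up_var R) \<noteq> \<zero>\<^bsub>UP S\<^esub>"
        using tn by (auto simp: S.UP_zero_eq up_const_def)
      have "h (up_var R) \<otimes>\<^bsub>UP S\<^esub> h (up_shift q) \<noteq> \<zero>\<^bsub>UP S\<^esub>"
        using zero_divisor_freeD[OF domUPS, of "h (up_var R)" "h (up_shift q)"] n1 n2 hc[OF sh] hc[OF R.up_var_closed]
        by auto
      moreover have "h (up_var R) \<otimes>\<^bsub>UP S\<^esub> h (up_shift q) = up_const S ((h (up_var R) \<otimes>\<^bsub>UP S\<^esub> h (up_shift q)) 0)"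
        by (rule ext) (simp add: up_const_def pc)
      ultimately have "h (up_var R) = up_const S (h (up_var R) 0)"
        by (intro S.up_constant_factor(1)[OF domS hc[OF R.up_var_closed] hc[OF sh]]) blast+
      then show False using tn by blast
    qed
    then have "h (up_shift q) = \<zero>\<^bsub>UP S\<^esub>" by simp
    then have "up_const S s = up_const S (f (q 0))"
      using e fc[OF q0] hc[OF R.up_var_closed] by (simp add: S.up_const_closed)
    then show "s \<in> f ` carrier R" using cinj q0 by blast
  qed
  ultimately have "f \<in> ring_iso R S" using fc unfolding ring_iso_def bij_betw_def by blast
  then show ?thesis using f by blast
qed

section \<open>Twisted monoid algebras\<close>

lemma (in abelian_monoid) finsum_Sigma:
  assumes "finite I" "\<And>i. i \<in> I \<Longrightarrow> finite (J i)"
    and "\<And>i j. i \<in> I \<Longrightarrow> j \<in> J i \<Longrightarrow> F i j \<in> carrier G"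
  shows "(\<Oplus>i\<in>I. \<Oplus>j\<in>J i. F i j) = (\<Oplus>p\<in>Sigma I J. F (fst p) (snd p))"
  using assms
proof (induction I)
  case empty
  then show ?case by simp
next
  case (insert i I)
  have split: "Sigma (insert i I) J = Pair i ` J i \<union> Sigma I J" by auto
  have "(\<Oplus>p\<in>Pair i ` J i. F (fst p) (snd p)) = (\<Oplus>j\<in>J i. F i j)"
    using insert by (subst finsum_reindex) (auto simp: inj_on_def)
  moreover have "(\<Oplus>p\<in>Sigma (insert i I) J. F (fst p) (snd p))
    = (\<Oplus>p\<in>Pair i ` J i. F (fst p) (snd p)) \<oplus> (\<Oplus>p\<in>Sigma I J. F (fst p) (snd p))"
    unfolding split using insert by (intro finsum_Un_disjoint) auto
  moreover have "(\<Oplus>i\<in>insert i I. \<Oplus>j\<in>J i. F i j) = (\<Oplus>j\<in>J i. F i j) \<oplus> (\<Oplus>i\<in>I. \<Oplus>j\<in>J i. F i j)"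
    using insert by (intro finsum_insert) (auto intro!: finsum_closed)
  ultimately show ?case using insert by simp
qed

text \<open>
  The algebra with basis \<open>X\<^sup>a\<close> for \<open>a \<in> P\<close> and products \<open>X\<^sup>a X\<^sup>b = \<sigma> a b X\<^sup>a\<^sup>b\<close>, realised by finitely supported
  functions.  Words with trivial \<open>\<sigma>\<close> give the free algebra; multisets of variables with \<open>\<sigma>\<close> a power
  of \<open>q\<close> give the quantum polynomial ring, and restricting \<open>P\<close> gives its Veronese subrings.
\<close>

definition twisted_algebra ::
  "('k, 'm) ring_scheme \<Rightarrow> ('e \<Rightarrow> 'e \<Rightarrow> 'e) \<Rightarrow> 'e \<Rightarrow> ('e \<Rightarrow> 'e \<Rightarrow> 'k) \<Rightarrow> 'e set \<Rightarrow> ('k, 'e \<Rightarrow> 'k) module"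
  where "twisted_algebra K pl e \<sigma> P =
    \<lparr>carrier = {f \<in> UNIV \<rightarrow> carrier K. finite {a. f a \<noteq> \<zero>\<^bsub>K\<^esub>} \<and> {a. f a \<noteq> \<zero>\<^bsub>K\<^esub>} \<subseteq> P},
     monoid.mult = (\<lambda>f g c. \<Oplus>\<^bsub>K\<^esub>p \<in> {p. pl (fst p) (snd p) = c}.
       \<sigma> (fst p) (snd p) \<otimes>\<^bsub>K\<^esub> (f (fst p) \<otimes>\<^bsub>K\<^esub> g (snd p))),
     one = (\<lambda>a. if a = e then \<one>\<^bsub>K\<^esub> else \<zero>\<^bsub>K\<^esub>),
     zero = (\<lambda>a. \<zero>\<^bsub>K\<^esub>),
     add = (\<lambda>f g a. f a \<oplus>\<^bsub>K\<^esub> g a),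
     smult = (\<lambda>c f a. c \<otimes>\<^bsub>K\<^esub> f a)\<rparr>"

definition single :: "('k, 'm) ring_scheme \<Rightarrow> 'e \<Rightarrow> 'k \<Rightarrow> 'e \<Rightarrow> 'k"
  where "single K a c = (\<lambda>x. if x = a then c else \<zero>\<^bsub>K\<^esub>)"

locale twisted_monoid = K?: field K
  for K :: "('k, 'm) ring_scheme" (structure)
    and pl :: "'e \<Rightarrow> 'e \<Rightarrow> 'e" and e :: 'e and \<sigma> :: "'e \<Rightarrow> 'e \<Rightarrow> 'k" and P :: "'e set" +
  assumes pl_assoc: "pl (pl a b) c = pl a (pl b c)"
    and pl_e: "pl e a = a" "pl a e = a"
    and finite_factorizations: "finite {p. pl (fst p) (snd p) = c}"
    and P_e: "e \<in> P"
    and P_pl: "a \<in> P \<Longrightarrow> b \<in> P \<Longrightarrow> pl a b \<in> P"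
    and cocycle_unit: "\<sigma> a b \<in> carrier K" "\<sigma> a b \<noteq> \<zero>"
    and cocycle: "\<sigma> a b \<otimes> \<sigma> (pl a b) c = \<sigma> b c \<otimes> \<sigma> a (pl b c)"
    and cocycle_e: "\<sigma> e a = \<one>" "\<sigma> a e = \<one>"
begin

abbreviation TA where "TA \<equiv> twisted_algebra K pl e \<sigma> P"

lemma TA_simps [simp]:
  "\<one>\<^bsub>TA\<^esub> = single K e \<one>" "\<zero>\<^bsub>TA\<^esub> = (\<lambda>a. \<zero>)" "f \<oplus>\<^bsub>TA\<^esub> g = (\<lambda>a. f a \<oplus> g a)"
  "c \<odot>\<^bsub>TA\<^esub> f = (\<lambda>a. c \<otimes> f a)"
  by (simp_all add: twisted_algebra_def single_def)

lemma TA_carrier_iff: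
  "f \<in> carrier TA \<longleftrightarrow> (\<forall>a. f a \<in> carrier K) \<and> finite {a. f a \<noteq> \<zero>} \<and> (\<forall>a. f a \<noteq> \<zero> \<longrightarrow> a \<in> P)"
  unfolding twisted_algebra_def by auto

lemma TA_coeff [simp, intro]: "f \<in> carrier TA \<Longrightarrow> f a \<in> carrier K"
  unfolding TA_carrier_iff by blast

lemma TA_mult_coeff:
  "(f \<otimes>\<^bsub>TA\<^esub> g) c = (\<Oplus>p \<in> {p. pl (fst p) (snd p) = c}. \<sigma> (fst p) (snd p) \<otimes> (f (fst p) \<otimes> g (snd p)))"
  by (simp add: twisted_algebra_def)

lemma single_closed: "a \<in> P \<Longrightarrow> c \<in> carrier K \<Longrightarrow> single K a c \<in> carrier TA"
  unfolding TA_carrier_iff by (auto simp: single_def)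

lemma TA_mult_coeff_closed [simp]:
  "\<lbrakk>\<And>a. f a \<in> carrier K; \<And>a. g a \<in> carrier K\<rbrakk> \<Longrightarrow> (f \<otimes>\<^bsub>TA\<^esub> g) c \<in> carrier K"
  unfolding TA_mult_coeff by (auto intro!: finsum_closed simp: cocycle_unit)

lemma TA_mult_coeff_zero:
  assumes "\<And>a. f a \<in> carrier K" "\<And>a. g a \<in> carrier K"
    and "\<And>a b. pl a b = c \<Longrightarrow> f a = \<zero> \<or> g b = \<zero>"
  shows "(f \<otimes>\<^bsub>TA\<^esub> g) c = \<zero>"
proof -
  have "(f \<otimes>\<^bsub>TA\<^esub> g) c = (\<Oplus>p \<in> {p. pl (fst p) (snd p) = c}. \<zero>)"
    unfolding TA_mult_coeff
  proof (rule finsum_cong')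
    fix p assume "p \<in> {p. pl (fst p) (snd p) = c}"
    then have "f (fst p) = \<zero> \<or> g (snd p) = \<zero>" using assms(3)[of "fst p" "snd p"] by simp
    then show "\<sigma> (fst p) (snd p) \<otimes> (f (fst p) \<otimes> g (snd p)) = \<zero>"
      using assms(1)[of "fst p"] assms(2)[of "snd p"] by (elim disjE) (simp_all add: cocycle_unit)
  qed auto
  then show ?thesis by simp
qed

text \<open>
  A coefficient of a product in which only one factorization contributes; this covers
  products with monomials and products of leading terms.
\<close>

lemma TA_mult_coeff_unique:
  assumes f: "\<And>a. f a \<in> carrier K" and g: "\<And>a. g a \<in> carrier K"
    and u: "\<And>a b. pl a b = pl a0 b0 \<Longrightarrow> (a, b) \<noteq> (a0, b0) \<Longrightarrow> f a = \<zero> \<or> g b = \<zero>"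
  shows "(f \<otimes>\<^bsub>TA\<^esub> g) (pl a0 b0) = \<sigma> a0 b0 \<otimes> (f a0 \<otimes> g b0)"
proof -
  let ?F = "\<lambda>p. \<sigma> (fst p) (snd p) \<otimes> (f (fst p) \<otimes> g (snd p))"
  have "(f \<otimes>\<^bsub>TA\<^esub> g) (pl a0 b0)
    = (\<Oplus>p \<in> {p. pl (fst p) (snd p) = pl a0 b0}. if (a0, b0) = p then ?F p else \<zero>)"
    unfolding TA_mult_coeff
  proof (rule finsum_cong')
    fix p assume p: "p \<in> {p. pl (fst p) (snd p) = pl a0 b0}"
    show "?F p = (if (a0, b0) = p then ?F p else \<zero>)"
    proof (cases "(a0, b0) = p")
      case False
      then have "f (fst p) = \<zero> \<or> g (snd p) = \<zero>" using u[of "fst p" "snd p"] p by auto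
      then show ?thesis
        using f[of "fst p"] g[of "snd p"] False by (elim disjE) (simp_all add: cocycle_unit)
    qed simp
  qed (use f g in \<open>auto simp: cocycle_unit\<close>)
  also have "\<dots> = ?F (a0, b0)"
    by (rule finsum_singleton) (use f g finite_factorizations in \<open>auto simp: cocycle_unit\<close>)
  finally show ?thesis by simp
qed

lemma single_mult_single:
  assumes "c \<in> carrier K" "d \<in> carrier K"
  shows "single K a c \<otimes>\<^bsub>TA\<^esub> single K b d = single K (pl a b) (\<sigma> a b \<otimes> (c \<otimes> d))"
proof
  fix x
  show "(single K a c \<otimes>\<^bsub>TA\<^esub> single K b d) x = single K (pl a b) (\<sigma> a b \<otimes> (c \<otimes> d)) x"
  proof (cases "x = pl a b")
    case True
    have "(single K a c \<otimes>\<^bsub>TA\<^esub> single K b d) (pl a b) = \<sigma> a b \<otimes> (single K a c a \<otimes> single K b d b)"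
      by (rule TA_mult_coeff_unique) (use assms in \<open>auto simp: single_def\<close>)
    then show ?thesis using True by (simp add: single_def)
  next
    case False
    have "(single K a c \<otimes>\<^bsub>TA\<^esub> single K b d) x = \<zero>"
      by (rule TA_mult_coeff_zero) (use assms False in \<open>auto simp: single_def\<close>)
    then show ?thesis using False by (simp add: single_def)
  qed
qed

lemma TA_mult_closed:
  assumes f: "f \<in> carrier TA" and g: "g \<in> carrier TA"
  shows "f \<otimes>\<^bsub>TA\<^esub> g \<in> carrier TA"
  unfolding TA_carrier_iff
proof (intro conjI allI impI)
  fix c
  show "(f \<otimes>\<^bsub>TA\<^esub> g) c \<in> carrier K" using f g by simp
  have supp: "\<exists>a b. c = pl a b \<and> f a \<noteq> \<zero> \<and> g b \<noteq> \<zero>" if "(f \<otimes>\<^bsub>TA\<^esub> g) c \<noteq> \<zero>" for c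
    using TA_mult_coeff_zero[of f g c] that f g by auto
  have "{c. (f \<otimes>\<^bsub>TA\<^esub> g) c \<noteq> \<zero>} \<subseteq> (\<lambda>p. pl (fst p) (snd p)) ` ({a. f a \<noteq> \<zero>} \<times> {b. g b \<noteq> \<zero>})"
    using supp by force
  then show "finite {c. (f \<otimes>\<^bsub>TA\<^esub> g) c \<noteq> \<zero>}"
    by (rule finite_subset) (use f g in \<open>auto simp: TA_carrier_iff\<close>)
  assume "(f \<otimes>\<^bsub>TA\<^esub> g) c \<noteq> \<zero>"
  then show "c \<in> P" using supp[of c] P_pl f g unfolding TA_carrier_iff by blast
qed

lemma TA_add_closed:
  assumes f: "f \<in> carrier TA" and g: "g \<in> carrier TA"
  shows "(\<lambda>a. f a \<oplus> g a) \<in> carrier TA"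
  unfolding TA_carrier_iff
proof (intro conjI allI impI)
  have supp: "f a \<noteq> \<zero> \<or> g a \<noteq> \<zero>" if "f a \<oplus> g a \<noteq> \<zero>" for a using that by auto
  then have "{c. f c \<oplus> g c \<noteq> \<zero>} \<subseteq> {a. f a \<noteq> \<zero>} \<union> {b. g b \<noteq> \<zero>}" by blast
  then show "finite {c. f c \<oplus> g c \<noteq> \<zero>}"
    by (rule finite_subset) (use f g in \<open>auto simp: TA_carrier_iff\<close>)
  fix c
  show "f c \<oplus> g c \<in> carrier K" using f g by simp
  assume "f c \<oplus> g c \<noteq> \<zero>"
  then show "c \<in> P" using supp[of c] f g unfolding TA_carrier_iff by blast
qed

lemma TA_smult_closed:
  assumes c: "c \<in> carrier K" and f: "f \<in> carrier TA"
  shows "(\<lambda>a. c \<otimes> f a) \<in> carrier TA"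
  unfolding TA_carrier_iff
proof (intro conjI allI impI)
  have supp: "f a \<noteq> \<zero>" if "c \<otimes> f a \<noteq> \<zero>" for a using that c by auto
  then have "{a. c \<otimes> f a \<noteq> \<zero>} \<subseteq> {a. f a \<noteq> \<zero>}" by blast
  then show "finite {a. c \<otimes> f a \<noteq> \<zero>}"
    by (rule finite_subset) (use f in \<open>auto simp: TA_carrier_iff\<close>)
  fix a
  show "c \<otimes> f a \<in> carrier K" using f c by simp
  assume "c \<otimes> f a \<noteq> \<zero>"
  then show "a \<in> P" using supp[of a] f unfolding TA_carrier_iff by blast
qed

lemma TA_mult_assoc:
  assumes f: "f \<in> carrier TA" and g: "g \<in> carrier TA" and h: "h \<in> carrier TA"
  shows "(f \<otimes>\<^bsub>TA\<^esub> g) \<otimes>\<^bsub>TA\<^esub> h = f \<otimes>\<^bsub>TA\<^esub> (g \<otimes>\<^bsub>TA\<^esub> h)"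
proof
  fix x
  let ?D = "\<lambda>c. {p. pl (fst p) (snd p) = c}"
  let ?L = "\<lambda>p r. \<sigma> (fst p) (snd p) \<otimes> ((\<sigma> (fst r) (snd r) \<otimes> (f (fst r) \<otimes> g (snd r))) \<otimes> h (snd p))"
  let ?R = "\<lambda>p r. \<sigma> (fst p) (snd p) \<otimes> (f (fst p) \<otimes> (\<sigma> (fst r) (snd r) \<otimes> (g (fst r) \<otimes> h (snd r))))"
  \<comment> \<open>Both bracketings are sums over the factorizations of \<open>x\<close> into three parts; \<open>?t\<close> turns
    \<open>((ab, c), (a, b))\<close> into \<open>((a, bc), (b, c))\<close>, and the cocycle condition matches the summands.\<close>
  let ?t = "\<lambda>pr. ((fst (snd pr), pl (snd (snd pr)) (snd (fst pr))), (snd (snd pr), snd (fst pr)))"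
  have [simp]: "f a \<in> carrier K" "g a \<in> carrier K" "h a \<in> carrier K" for a using f g h by auto
  note [simp] = cocycle_unit
  have "((f \<otimes>\<^bsub>TA\<^esub> g) \<otimes>\<^bsub>TA\<^esub> h) x = (\<Oplus>p\<in>?D x. \<Oplus>r\<in>?D (fst p). ?L p r)"
    unfolding TA_mult_coeff[of "f \<otimes>\<^bsub>TA\<^esub> g"]
  proof (rule finsum_cong')
    fix p
    show "\<sigma> (fst p) (snd p) \<otimes> ((f \<otimes>\<^bsub>TA\<^esub> g) (fst p) \<otimes> h (snd p)) = (\<Oplus>r\<in>?D (fst p). ?L p r)"
      unfolding TA_mult_coeff[of f g]
      by (subst finsum_ldistr, simp add: finite_factorizations, simp, simp add: Pi_def,
          subst finsum_rdistr) (simp_all add: finite_factorizations Pi_def)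
  qed (auto intro!: finsum_closed)
  also have "\<dots> = (\<Oplus>pr\<in>Sigma (?D x) (\<lambda>p. ?D (fst p)). ?L (fst pr) (snd pr))"
    by (rule finsum_Sigma) (auto simp: finite_factorizations)
  also have "\<dots> = (\<Oplus>pr\<in>Sigma (?D x) (\<lambda>p. ?D (fst p)). ?R (fst (?t pr)) (snd (?t pr)))"
  proof (rule finsum_cong')
    fix pr assume pr: "pr \<in> Sigma (?D x) (\<lambda>p. ?D (fst p))"
    obtain d c a b where [simp]: "pr = ((d, c), (a, b))" by (metis surj_pair)
    have d: "pl a b = d" using pr by simp
    have co: "\<sigma> a b \<otimes> \<sigma> d c = \<sigma> b c \<otimes> \<sigma> a (pl b c)" using cocycle[of a b c] by (simp add: d)
    have "?L (fst pr) (snd pr) = (\<sigma> a b \<otimes> \<sigma> d c) \<otimes> (f a \<otimes> g b \<otimes> h c)"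
      by (simp add: m_ac)
    also have "\<dots> = ?R (fst (?t pr)) (snd (?t pr))"
      unfolding co by (simp add: m_ac)
    finally show "?L (fst pr) (snd pr) = ?R (fst (?t pr)) (snd (?t pr))" .
  qed auto
  also have "\<dots> = (\<Oplus>pr\<in>?t ` Sigma (?D x) (\<lambda>p. ?D (fst p)). ?R (fst pr) (snd pr))"
  proof (rule finsum_reindex[symmetric])
    show "inj_on ?t (Sigma (?D x) (\<lambda>p. ?D (fst p)))" by (rule inj_onI) auto
  qed auto
  also have "?t ` Sigma (?D x) (\<lambda>p. ?D (fst p)) = Sigma (?D x) (\<lambda>p. ?D (snd p))"
  proof (intro equalityI subsetI)
    fix pr assume "pr \<in> Sigma (?D x) (\<lambda>p. ?D (snd p))"
    moreover obtain a d b c where "pr = ((a, d), (b, c))" by (metis surj_pair)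
    ultimately show "pr \<in> ?t ` Sigma (?D x) (\<lambda>p. ?D (fst p))"
      by (intro image_eqI[of _ _ "((pl a b, c), (a, b))"]) (auto simp: pl_assoc)
  qed (auto simp: pl_assoc)
  also have "(\<Oplus>pr\<in>Sigma (?D x) (\<lambda>p. ?D (snd p)). ?R (fst pr) (snd pr)) = (\<Oplus>p\<in>?D x. \<Oplus>r\<in>?D (snd p). ?R p r)"
    by (rule finsum_Sigma[symmetric]) (auto simp: finite_factorizations)
  also have "\<dots> = (f \<otimes>\<^bsub>TA\<^esub> (g \<otimes>\<^bsub>TA\<^esub> h)) x"
    unfolding TA_mult_coeff[of f "g \<otimes>\<^bsub>TA\<^esub> h"]
  proof (rule finsum_cong')
    fix p
    show "(\<Oplus>r\<in>?D (snd p). ?R p r) = \<sigma> (fst p) (snd p) \<otimes> (f (fst p) \<otimes> (g \<otimes>\<^bsub>TA\<^esub> h) (snd p))"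
      unfolding TA_mult_coeff[of g h]
      by (subst finsum_rdistr[symmetric], simp add: finite_factorizations, simp, simp add: Pi_def,
          subst finsum_rdistr[symmetric]) (simp_all add: finite_factorizations Pi_def)
  qed auto
  finally show "((f \<otimes>\<^bsub>TA\<^esub> g) \<otimes>\<^bsub>TA\<^esub> h) x = (f \<otimes>\<^bsub>TA\<^esub> (g \<otimes>\<^bsub>TA\<^esub> h)) x" .
qed

lemma TA_one_mult:
  assumes f: "f \<in> carrier TA"
  shows "single K e \<one> \<otimes>\<^bsub>TA\<^esub> f = f" "f \<otimes>\<^bsub>TA\<^esub> single K e \<one> = f"
proof -
  show "single K e \<one> \<otimes>\<^bsub>TA\<^esub> f = f"
  proof
    fix x
    have "(single K e \<one> \<otimes>\<^bsub>TA\<^esub> f) (pl e x) = \<sigma> e x \<otimes> (single K e \<one> e \<otimes> f x)"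
      by (rule TA_mult_coeff_unique) (use f in \<open>auto simp: single_def pl_e\<close>)
    then show "(single K e \<one> \<otimes>\<^bsub>TA\<^esub> f) x = f x" using f by (simp add: pl_e cocycle_e single_def)
  qed
  show "f \<otimes>\<^bsub>TA\<^esub> single K e \<one> = f"
  proof
    fix x
    have "(f \<otimes>\<^bsub>TA\<^esub> single K e \<one>) (pl x e) = \<sigma> x e \<otimes> (f x \<otimes> single K e \<one> e)"
      by (rule TA_mult_coeff_unique) (use f in \<open>auto simp: single_def pl_e\<close>)
    then show "(f \<otimes>\<^bsub>TA\<^esub> single K e \<one>) x = f x" using f by (simp add: pl_e cocycle_e single_def)
  qed
qed

lemma
  assumes "f \<in> carrier TA" "g \<in> carrier TA" "h \<in> carrier TA" "c \<in> carrier K"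
  shows TA_l_distr: "(\<lambda>a. f a \<oplus> g a) \<otimes>\<^bsub>TA\<^esub> h = (\<lambda>a. (f \<otimes>\<^bsub>TA\<^esub> h) a \<oplus> (g \<otimes>\<^bsub>TA\<^esub> h) a)"
    and TA_r_distr: "h \<otimes>\<^bsub>TA\<^esub> (\<lambda>a. f a \<oplus> g a) = (\<lambda>a. (h \<otimes>\<^bsub>TA\<^esub> f) a \<oplus> (h \<otimes>\<^bsub>TA\<^esub> g) a)"
    and TA_smult_left: "(\<lambda>a. c \<otimes> f a) \<otimes>\<^bsub>TA\<^esub> g = (\<lambda>a. c \<otimes> (f \<otimes>\<^bsub>TA\<^esub> g) a)"
    and TA_smult_right: "f \<otimes>\<^bsub>TA\<^esub> (\<lambda>a. c \<otimes> g a) = (\<lambda>a. c \<otimes> (f \<otimes>\<^bsub>TA\<^esub> g) a)"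
proof -
  have [simp]: "f a \<in> carrier K" "g a \<in> carrier K" "h a \<in> carrier K" for a using assms by auto
  note [simp] = cocycle_unit assms(4)
  show "(\<lambda>a. f a \<oplus> g a) \<otimes>\<^bsub>TA\<^esub> h = (\<lambda>a. (f \<otimes>\<^bsub>TA\<^esub> h) a \<oplus> (g \<otimes>\<^bsub>TA\<^esub> h) a)"
    unfolding TA_mult_coeff fun_eq_iff
    by (subst finsum_addf[symmetric]) (auto intro!: finsum_cong' simp: l_distr r_distr)
  show "h \<otimes>\<^bsub>TA\<^esub> (\<lambda>a. f a \<oplus> g a) = (\<lambda>a. (h \<otimes>\<^bsub>TA\<^esub> f) a \<oplus> (h \<otimes>\<^bsub>TA\<^esub> g) a)"
    unfolding TA_mult_coeff fun_eq_iff
    by (subst finsum_addf[symmetric]) (auto intro!: finsum_cong' simp: l_distr r_distr)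
  show "(\<lambda>a. c \<otimes> f a) \<otimes>\<^bsub>TA\<^esub> g = (\<lambda>a. c \<otimes> (f \<otimes>\<^bsub>TA\<^esub> g) a)"
    unfolding TA_mult_coeff fun_eq_iff
    by (subst finsum_rdistr) (auto intro!: finsum_cong' simp: finite_factorizations m_ac)
  show "f \<otimes>\<^bsub>TA\<^esub> (\<lambda>a. c \<otimes> g a) = (\<lambda>a. c \<otimes> (f \<otimes>\<^bsub>TA\<^esub> g) a)"
    unfolding TA_mult_coeff fun_eq_iff
    by (subst finsum_rdistr) (auto intro!: finsum_cong' simp: finite_factorizations m_ac)
qed

lemma abelian_group_TA: "abelian_group TA"
proof (rule abelian_groupI)
  fix f g h assume f: "f \<in> carrier TA" and g: "g \<in> carrier TA" and h: "h \<in> carrier TA"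
  show "f \<oplus>\<^bsub>TA\<^esub> g \<in> carrier TA" using TA_add_closed[OF f g] by simp
  show "f \<oplus>\<^bsub>TA\<^esub> g \<oplus>\<^bsub>TA\<^esub> h = f \<oplus>\<^bsub>TA\<^esub> (g \<oplus>\<^bsub>TA\<^esub> h)" using f g h by (simp add: a_assoc)
  show "f \<oplus>\<^bsub>TA\<^esub> g = g \<oplus>\<^bsub>TA\<^esub> f" using f g by (simp add: a_comm)
next
  show "\<zero>\<^bsub>TA\<^esub> \<in> carrier TA" unfolding TA_carrier_iff by simp
next
  fix f assume f: "f \<in> carrier TA"
  show "\<zero>\<^bsub>TA\<^esub> \<oplus>\<^bsub>TA\<^esub> f = f" using f by simp
  show "\<exists>g\<in>carrier TA. g \<oplus>\<^bsub>TA\<^esub> f = \<zero>\<^bsub>TA\<^esub>"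
  proof (rule bexI[of _ "\<lambda>a. \<ominus> \<one> \<otimes> f a"])
    show "(\<lambda>a. \<ominus> \<one> \<otimes> f a) \<oplus>\<^bsub>TA\<^esub> f = \<zero>\<^bsub>TA\<^esub>" using f by (simp add: l_minus l_neg)
  qed (rule TA_smult_closed, use f in auto)
qed

lemma ring_TA: "ring TA"
proof (rule ringI)
  show "abelian_group TA" by (rule abelian_group_TA)
  show "monoid TA"
    by (rule monoidI) (simp_all add: TA_mult_closed single_closed P_e TA_mult_assoc TA_one_mult)
qed (simp_all add: TA_l_distr[OF _ _ _ K.zero_closed] TA_r_distr[OF _ _ _ K.zero_closed])

lemma assoc_algebra_TA: "assoc_algebra K TA"
proof (rule assoc_algebra.intro)
  show "module K TA"
    by (rule moduleI)
      (simp_all add: K.is_cring abelian_group_TA TA_smult_closed l_distr r_distr m_assoc)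
  show "ring TA" by (rule ring_TA)
  show "assoc_algebra_axioms K TA"
    by (rule assoc_algebra_axioms.intro) (simp_all add: TA_smult_left TA_smult_right)
qed

text \<open>
  Additive induction over the support, used below for all statements that are additive in
  one argument.
\<close>

lemma TA_generated:
  assumes single: "\<And>a c. a \<in> P \<Longrightarrow> c \<in> carrier K \<Longrightarrow> single K a c \<in> T"
    and add: "\<And>f g. f \<in> T \<Longrightarrow> g \<in> T \<Longrightarrow> f \<oplus>\<^bsub>TA\<^esub> g \<in> T"
  shows "carrier TA \<subseteq> T"
proof
  fix f assume f: "f \<in> carrier TA"
  have "finite {a. f a \<noteq> \<zero>}" using f by (simp add: TA_carrier_iff)
  then show "f \<in> T" using f
  proof (induction "{a. f a \<noteq> \<zero>}" arbitrary: f rule: finite_induct)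
    case empty
    then have "f = single K e \<zero>" by (auto simp: single_def fun_eq_iff)
    then show ?case using single[OF P_e] by simp
  next
    case (insert x F)
    define g where "g = (\<lambda>a. if a = x then \<zero> else f a)"
    have supp: "{a. g a \<noteq> \<zero>} = F" using insert(2,4) by (auto simp: g_def)
    have "g \<in> carrier TA"
      using insert(1,5) supp unfolding TA_carrier_iff by (auto simp: g_def)
    then have "g \<in> T" using insert(3) supp by simp
    moreover have "single K x (f x) \<in> T"
      using insert(4,5) by (intro single) (auto simp: TA_carrier_iff)
    moreover have "f = single K x (f x) \<oplus>\<^bsub>TA\<^esub> g"
      using insert(5) by (auto simp: single_def g_def fun_eq_iff)
    ultimately show ?case using add by metis
  qed
qed

end

section \<open>Commutation exponents\<close>

text \<open>
  The number of transpositions \<open>x\<^sub>j x\<^sub>i = q x\<^sub>i x\<^sub>j\<close> with \<open>i < j\<close> that bring the product of the sorted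
  monomials \<open>M\<close> and \<open>N\<close> into sorted order.
\<close>

definition reorder_exponent :: "nat multiset \<Rightarrow> nat multiset \<Rightarrow> nat"
  where "reorder_exponent M N = (\<Sum>j\<in>#M. size {#i \<in># N. i < j#})"

lemma reorder_exponent_simps [simp]:
  "reorder_exponent {#} N = 0" "reorder_exponent M {#} = 0"
  "reorder_exponent (M + M') N = reorder_exponent M N + reorder_exponent M' N"
  "reorder_exponent M (N + N') = reorder_exponent M N + reorder_exponent M N'"
  by (simp_all add: reorder_exponent_def sum_mset.distrib)

lemma reorder_exponent_swap:
  "reorder_exponent M N = (\<Sum>i\<in>#N. size {#j \<in># M. i < j#})"
proof (induction N)
  case (add x N)
  have "reorder_exponent M {#x#} = size {#j \<in># M. x < j#}"
    by (induction M) (simp_all add: reorder_exponent_def)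
  then show ?case
    using add reorder_exponent_simps(4)[of M "{#x#}" N] by simp
qed simp

lemma reorder_exponent_repeat:
  "reorder_exponent (repeat_mset k M) N = k * reorder_exponent M N"
  "reorder_exponent M (repeat_mset k N) = k * reorder_exponent M N"
  by (induction k; simp)+

lemma size_filter_sum:
  assumes "set_mset M \<subseteq> A" "finite A"
  shows "size (filter_mset Q M) = (\<Sum>j\<in>{j\<in>A. Q j}. count M j)"
proof -
  have "size (filter_mset Q M) = (\<Sum>j\<in>set_mset (filter_mset Q M). count (filter_mset Q M) j)"
    by (rule size_multiset_overloaded_eq)
  also have "\<dots> = (\<Sum>j\<in>{j\<in>A. Q j}. count (filter_mset Q M) j)"
    by (rule sum.mono_neutral_left) (use assms in \<open>auto simp: count_eq_zero_iff\<close>)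
  also have "\<dots> = (\<Sum>j\<in>{j\<in>A. Q j}. count M j)" by (rule sum.cong) auto
  finally show ?thesis .
qed

text \<open>
  The alternating signs \<open>(-1)\<^sup>j\<close>, flipped after position \<open>i\<close> and set to zero there.  The point of this
  vector is \<open>dual_sign_balance\<close>: the difference between the sum of its entries above and the sum
  of its entries below a position \<open>y\<close> is the same for all \<open>y \<noteq> i\<close>, and differs from that by \<open>\<plusminus>1\<close> at \<open>y = i\<close>.
  For even \<open>n\<close> the vector is, up to sign, dual to the \<open>i\<close>-th unit vector for the commutation form.
\<close>

definition dual_sign :: "nat \<Rightarrow> nat \<Rightarrow> int"
  where "dual_sign i j = (if j = i then 0 else if j < i then (-1) ^ j else - ((-1) ^ j))"

lemma sum_dual_sign:
  assumes "i \<ge> 1"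
  shows "(\<Sum>j=1..y. dual_sign i j) = (if y < i then - of_bool (odd y) else - of_bool (even y))"
proof (induction y)
  case 0
  then show ?case using assms by simp
next
  case (Suc y)
  consider "Suc y < i" | "Suc y = i" | "Suc y > i" by linarith
  then show ?case
    using Suc by cases (auto simp: dual_sign_def)
qed

lemma dual_sign_balance:
  assumes y: "1 \<le> y" "y \<le> n" and i: "1 \<le> i" "i \<le> n"
  shows "(\<Sum>j=y+1..n. dual_sign i j) - (\<Sum>j=1..y-1. dual_sign i j)
    = of_bool (odd n) + (if y = i then (if even i then 1 else -1) else 0)"
proof -
  have "(\<Sum>j=1..n. dual_sign i j) = (\<Sum>j=1..y. dual_sign i j) + (\<Sum>j=y+1..n. dual_sign i j)"
    using sum.ub_add_nat[of 1 y "dual_sign i" "n - y"] y by simp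
  then have "(\<Sum>j=y+1..n. dual_sign i j) = (\<Sum>j=1..n. dual_sign i j) - (\<Sum>j=1..y. dual_sign i j)" by simp
  then have "(\<Sum>j=y+1..n. dual_sign i j) - (\<Sum>j=1..y-1. dual_sign i j)
    = (- of_bool (even n)) - (if y < i then - of_bool (odd y) else - of_bool (even y))
      - (if y - 1 < i then - of_bool (odd (y - 1)) else - of_bool (even (y - 1)))"
    using i(2) by (simp only: sum_dual_sign[OF i(1)] if_not_P not_less)
  moreover have "even (y - 1) \<longleftrightarrow> odd y" using y(1) by simp
  moreover have "y < i \<longleftrightarrow> y - 1 < i \<and> y \<noteq> i" using y(1) by linarith
  moreover have "y = i \<Longrightarrow> y - 1 < i" using y(1) by linarith
  ultimately show ?thesis by (cases "y = i"; cases "y - 1 < i") (simp_all only: if_True if_False simp_thms, auto)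
qed

definition veronese_exponents :: "nat \<Rightarrow> nat \<Rightarrow> nat multiset set"
  where "veronese_exponents n v = {M. set_mset M \<subseteq> {1..n} \<and> v dvd size M}"

text \<open>
  The arithmetic core.  An exponent vector congruent to \<open>k\<close> times \<open>dual_sign i\<close> commutes with \<open>b\<close> up
  to \<open>q\<close> to the power \<open>k (\<epsilon> |b| \<plusminus> b\<^sub>i)\<close>, where \<open>\<epsilon>\<close> is 0 for even and 1 for odd \<open>n\<close>.  With \<open>k = v\<close> for even \<open>n\<close>
  and \<open>k = m / gcd m v\<close> for odd \<open>n\<close> the term with \<open>|b|\<close> vanishes modulo \<open>m\<close> for \<open>|b|\<close> divisible by \<open>v\<close>,
  while \<open>k\<close> itself is not divisible by \<open>m\<close>: this is the hypothesis.
\<close>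

lemma dual_exponent_exists:
  fixes n m v i :: nat
  assumes n: "n \<ge> 2" and m: "m > 0" and v: "v > 0"
    and cond: "(even n \<and> \<not> m dvd v) \<or> (odd n \<and> gcd m v \<noteq> 1)"
    and i: "i \<in> {1..n}"
  obtains c where "c \<in> veronese_exponents n v" "i \<notin># c"
    "\<And>b. b \<in> veronese_exponents n v \<Longrightarrow> i \<notin># b \<Longrightarrow>
       [reorder_exponent b c = reorder_exponent c b] (mod m)"
    "\<exists>b\<in>veronese_exponents n v. \<not> [reorder_exponent b c = reorder_exponent c b] (mod m)"
proof -
  define k where "k = (if even n then v else m div gcd m v)"
  have k: "\<not> m dvd k"
  proof (cases "even n")
    case False
    then have "gcd m v > 1" using cond m by (simp add: nat_neq_iff)
    then have "k < m" "k > 0" using False m by (simp_all add: k_def div_greater_zero_iff)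
    then show ?thesis by (auto dest: dvd_imp_le)
  qed (use cond in \<open>simp add: k_def\<close>)
  have kv: "int m dvd int k * of_bool (odd n) * int v"
  proof (cases "even n")
    case False
    have "m dvd k * v"
    proof -
      obtain v' where v': "v = gcd m v * v'" using gcd_dvd2[of m v] by (elim dvdE)
      have "k * v = (m div gcd m v) * (gcd m v * v')" using False v' by (simp add: k_def)
      also have "\<dots> = (m div gcd m v * gcd m v) * v'" by (simp only: mult.assoc)
      also have "\<dots> = m * v'" by (simp only: dvd_div_mult_self[OF gcd_dvd1])
      finally show ?thesis by simp
    qed
    then show ?thesis using False by (simp flip: of_nat_mult)
  qed simp
  \<comment> \<open>Negative entries are replaced by representatives modulo \<open>m v\<close>, which changes neither the
    commutation exponents modulo \<open>m\<close> nor the divisibility of the degree by \<open>v\<close>.\<close>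
  define \<gamma> where "\<gamma> j = (if j = i then 0 else if even j \<longleftrightarrow> j < i then k else (m * v - 1) * k)" for j
  have mv: "m * v \<ge> 1" using m v by (simp add: Suc_le_eq)
  have \<gamma>: "[int (\<gamma> j) = int k * dual_sign i j] (mod int (m * v))" for j
  proof -
    have "int ((m * v - 1) * k) = int (m * v) * int k - int k"
      using mv by (simp add: of_nat_diff algebra_simps)
    then have "[int ((m * v - 1) * k) = - int k] (mod int (m * v))"
      by (simp add: cong_iff_dvd_diff)
    moreover have "\<gamma> j = (if dual_sign i j = 0 then 0 else if dual_sign i j = 1 then k else (m * v - 1) * k)"
      "dual_sign i j \<in> {0, 1, -1}"
      by (cases "even j"; simp add: \<gamma>_def dual_sign_def)+
    ultimately show ?thesis by auto
  qed
  define c where "c = (\<Sum>j\<in>{1..n}. replicate_mset (\<gamma> j) j)"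
  have cc: "count c j = (if j \<in> {1..n} then \<gamma> j else 0)" for j
    by (simp add: c_def count_sum)
  have cs: "set_mset c \<subseteq> {1..n}"
  proof
    fix x assume "x \<in># c"
    then have "count c x \<noteq> 0" by simp
    then show "x \<in> {1..n}" using cc[of x] by (simp split: if_splits)
  qed
  have fil: "[int (size (filter_mset Q c)) = int k * (\<Sum>j\<in>{j\<in>{1..n}. Q j}. dual_sign i j)] (mod int (m * v))" for Q
  proof -
    have "int (size (filter_mset Q c)) = (\<Sum>j\<in>{j\<in>{1..n}. Q j}. int (\<gamma> j))"
      unfolding size_filter_sum[OF cs finite_atLeastAtMost] by (simp add: cc)
    also have "[\<dots> = (\<Sum>j\<in>{j\<in>{1..n}. Q j}. int k * dual_sign i j)] (mod int (m * v))"
      by (rule cong_sum) (rule \<gamma>)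
    finally show ?thesis by (simp add: sum_distrib_left)
  qed
  let ?\<eta> = "if even i then 1 else -1 :: int"
  have bal: "[int (size {#x \<in># c. y < x#}) - int (size {#x \<in># c. x < y#})
    = int k * (of_bool (odd n) + (if y = i then ?\<eta> else 0))] (mod int m)" if y: "y \<in> {1..n}" for y
  proof -
    have s: "{j\<in>{1..n}. y < j} = {y+1..n}" "{j\<in>{1..n}. j < y} = {1..y-1}" using y by auto
    have "[int (size {#x \<in># c. y < x#}) - int (size {#x \<in># c. x < y#})
      = int k * (\<Sum>j=y+1..n. dual_sign i j) - int k * (\<Sum>j=1..y-1. dual_sign i j)] (mod int (m * v))"
      using cong_diff[OF fil[of "\<lambda>x. y < x"] fil[of "\<lambda>x. x < y"]] unfolding s .
    also have "int k * (\<Sum>j=y+1..n. dual_sign i j) - int k * (\<Sum>j=1..y-1. dual_sign i j)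
      = int k * (of_bool (odd n) + (if y = i then ?\<eta> else 0))"
      using dual_sign_balance[of y n i] y i by (simp flip: right_diff_distrib)
    finally show ?thesis by (rule cong_dvd_modulus) simp
  qed
  have comm: "[int (reorder_exponent c b) - int (reorder_exponent b c) = int k * ?\<eta> * int (count b i)] (mod int m)"
    if b: "b \<in> veronese_exponents n v" for b
  proof -
    have bs: "set_mset b \<subseteq> {1..n}" using b by (simp add: veronese_exponents_def)
    have "[int (reorder_exponent c b) - int (reorder_exponent b c)
      = int k * (of_bool (odd n) * int (size b) + ?\<eta> * int (count b i))] (mod int m)"
      unfolding reorder_exponent_swap[of c b] reorder_exponent_def[of b c]
      using bs
    proof (induction b)
      case empty
      then show ?case by simp
    next
      case (add y b)
      have "[(int (size {#x \<in># c. y < x#}) - int (size {#x \<in># c. x < y#}))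
         + (int (\<Sum>i\<in>#b. size {#j \<in># c. i < j#}) - int (\<Sum>j\<in>#b. size {#i \<in># c. i < j#}))
        = int k * (of_bool (odd n) + (if y = i then ?\<eta> else 0))
         + int k * (of_bool (odd n) * int (size b) + ?\<eta> * int (count b i))] (mod int m)"
        by (rule cong_add[OF bal]) (use add in auto)
      then show ?case by (auto simp: algebra_simps)
    qed
    moreover have "[int k * (of_bool (odd n) * int (size b) + ?\<eta> * int (count b i)) = int k * ?\<eta> * int (count b i)] (mod int m)"
    proof -
      obtain t where "size b = v * t" using b by (auto simp: veronese_exponents_def)
      then have "int k * (of_bool (odd n) * int (size b)) = (int k * of_bool (odd n) * int v) * int t" by simp
      then have "int m dvd int k * (of_bool (odd n) * int (size b))" using kv by (simp only: dvd_mult2)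
      then show ?thesis by (simp add: cong_iff_dvd_diff algebra_simps)
    qed
    ultimately show ?thesis by (rule cong_trans)
  qed
  have comm_iff: "[reorder_exponent b c = reorder_exponent c b] (mod m) \<longleftrightarrow> m dvd k * count b i"
    if b: "b \<in> veronese_exponents n v" for b
  proof -
    have "[reorder_exponent b c = reorder_exponent c b] (mod m)
      \<longleftrightarrow> int m dvd int (reorder_exponent c b) - int (reorder_exponent b c)"
      unfolding cong_iff_dvd_diff[symmetric] cong_int_iff by (rule cong_sym_eq)
    also have "\<dots> \<longleftrightarrow> int m dvd int k * ?\<eta> * int (count b i)"
      using comm[OF b] by (rule cong_dvd_iff)
    also have "\<dots> \<longleftrightarrow> int m dvd int (k * count b i)" by (cases "even i") simp_all
    finally show ?thesis by (simp only: int_dvd_int_iff)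
  qed
  show thesis
  proof (rule that)
    have "int v dvd int k * (\<Sum>j=1..n. dual_sign i j)"
      using sum_dual_sign[of i n] i by (auto simp: k_def)
    moreover have "[int (size c) = int k * (\<Sum>j=1..n. dual_sign i j)] (mod int v)"
    proof -
      have "{j\<in>{1..n}. True} = {1..n}" by auto
      from fil[of "\<lambda>_. True", unfolded this filter_mset_True] show ?thesis
        by (rule cong_dvd_modulus) simp
    qed
    ultimately have "int v dvd int (size c)" using cong_dvd_iff by blast
    then show "c \<in> veronese_exponents n v" using cs by (simp add: veronese_exponents_def)
    show "i \<notin># c" using cc[of i] by (simp add: \<gamma>_def not_in_iff)
    show "[reorder_exponent b c = reorder_exponent c b] (mod m)"
      if "b \<in> veronese_exponents n v" "i \<notin># b" for b
      using comm_iff[OF that(1)] that(2) by (simp add: not_in_iff)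
    obtain j where j: "j \<in> {1..n}" "j \<noteq> i"
      by (rule that[of "if i = 1 then 2 else 1"]) (use n i in auto)
    \<comment> \<open>A monomial of degree \<open>v\<close> in which \<open>x\<^sub>i\<close> occurs exactly once.\<close>
    let ?b = "add_mset i (replicate_mset (v - 1) j)"
    have "?b \<in> veronese_exponents n v"
      using i j v by (auto simp: veronese_exponents_def)
    moreover have "count ?b i = 1" using j by simp
    ultimately show "\<exists>b\<in>veronese_exponents n v. \<not> [reorder_exponent b c = reorder_exponent c b] (mod m)"
      using comm_iff[of ?b] k by (intro bexI[of _ ?b]) auto
  qed
qed

section \<open>The algebra of quantum monomials\<close>

lemma (in ring) mult_algebra_add:
  assumes "\<phi> \<in> mult_algebra R" "u \<in> carrier R" "w \<in> carrier R"
  shows "\<phi> (u \<oplus> w) = \<phi> u \<oplus> \<phi> w"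
  using assms(1)
proof (induction rule: mult_algebra.induct)
  case (plus \<phi> \<psi>)
  have "\<phi> u \<in> carrier R" "\<psi> u \<in> carrier R" "\<phi> w \<in> carrier R" "\<psi> w \<in> carrier R"
    using plus assms mult_algebra_closed by blast+
  then show ?case unfolding plus(3,4) by algebra
next
  case (left y \<phi>)
  have "\<phi> u \<in> carrier R" "\<phi> w \<in> carrier R"
    using left assms mult_algebra_closed by blast+
  then show ?case unfolding left(3) using left(1) by (rule r_distr)
next
  case (right y \<phi>)
  have "\<phi> u \<in> carrier R" "\<phi> w \<in> carrier R"
    using right assms mult_algebra_closed by blast+
  then show ?case unfolding right(3) using right(1) by (rule l_distr)
qed simp

lemma (in abelian_monoid) finsum_in_submonoid:
  assumes "T \<subseteq> carrier G" "\<zero> \<in> T" "\<And>x y. x \<in> T \<Longrightarrow> y \<in> T \<Longrightarrow> x \<oplus> y \<in> T"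
    and "\<And>i. i \<in> A \<Longrightarrow> f i \<in> T"
  shows "finsum G f A \<in> T"
proof (cases "finite A")
  case True
  then show ?thesis using assms(4)
  proof (induction A)
    case (insert x A)
    have "finsum G f (insert x A) = f x \<oplus> finsum G f A"
      using insert assms(1) by (intro finsum_insert) blast+
    then show ?case using insert assms(3) by simp
  qed (use assms(2) in simp)
qed (use assms(2) in \<open>simp add: finsum_infinite\<close>)

lemma finite_multisets_bounded:
  assumes "finite A"
  shows "finite {M. set_mset M \<subseteq> A \<and> size M \<le> k}"
proof (rule finite_subset)
  show "{M. set_mset M \<subseteq> A \<and> size M \<le> k} \<subseteq> mset ` {xs. set xs \<subseteq> A \<and> length xs \<le> k}"
  proof
    fix M assume M: "M \<in> {M. set_mset M \<subseteq> A \<and> size M \<le> k}"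
    obtain xs where "M = mset xs" using ex_mset by metis
    then show "M \<in> mset ` {xs. set xs \<subseteq> A \<and> length xs \<le> k}" using M by auto
  qed
qed (intro finite_imageI finite_lists_length_le assms)

lemma finite_multiset_factorizations: "finite {p. fst p + snd p = (C :: 'a multiset)}"
proof (rule finite_subset)
  let ?B = "{M. set_mset M \<subseteq> set_mset C \<and> size M \<le> size C}"
  show "{p. fst p + snd p = C} \<subseteq> ?B \<times> ?B" by auto
  show "finite (?B \<times> ?B)" by (intro finite_cartesian_product finite_multisets_bounded) auto
qed

text \<open>
  The model of the \<open>v\<close>-th Veronese subring: exponents are multisets of variables, and \<open>v = 1\<close> gives
  the quantum polynomial ring itself.
\<close>

locale quantum_exponents = K?: field K
  for K :: "('k, 'm) ring_scheme" (structure) and q :: 'k and n v :: nat +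
  assumes q: "q \<in> carrier K" "q \<noteq> \<zero>"
begin

abbreviation \<sigma> where "\<sigma> \<equiv> \<lambda>M N. q [^] reorder_exponent M N"

lemma q_pow [simp]: "q [^] (a::nat) \<in> carrier K" "q [^] (a::nat) \<noteq> \<zero>"
proof -
  show "q [^] a \<in> carrier K" using q by simp
  show "q [^] a \<noteq> \<zero>" using q by (induction a) (simp_all add: integral_iff)
qed

sublocale twisted_monoid K "(+)" "{#}" \<sigma> "veronese_exponents n v"
proof
  fix a b c :: "nat multiset"
  show "q [^] reorder_exponent a b \<otimes> q [^] reorder_exponent (a + b) c
    = q [^] reorder_exponent b c \<otimes> q [^] reorder_exponent a (b + c)"
    using q by (simp add: nat_pow_mult ac_simps)
  show "a \<in> veronese_exponents n v \<Longrightarrow> b \<in> veronese_exponents n v \<Longrightarrow> a + b \<in> veronese_exponents n v"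
    by (auto simp: veronese_exponents_def)
qed (use q finite_multiset_factorizations in \<open>auto simp: veronese_exponents_def ac_simps\<close>)

lemma single_mult_coeff:
  assumes "c \<in> carrier K" "\<And>a. f a \<in> carrier K"
  shows "(single K a c \<otimes>\<^bsub>TA\<^esub> f) (a + M) = \<sigma> a M \<otimes> (c \<otimes> f M)"
    and "(f \<otimes>\<^bsub>TA\<^esub> single K a c) (M + a) = \<sigma> M a \<otimes> (f M \<otimes> c)"
proof -
  have "(single K a c \<otimes>\<^bsub>TA\<^esub> f) (a + M) = \<sigma> a M \<otimes> (single K a c a \<otimes> f M)"
    by (rule TA_mult_coeff_unique) (use assms in \<open>auto simp: single_def\<close>)
  then show "(single K a c \<otimes>\<^bsub>TA\<^esub> f) (a + M) = \<sigma> a M \<otimes> (c \<otimes> f M)" by (simp add: single_def)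
  have "(f \<otimes>\<^bsub>TA\<^esub> single K a c) (M + a) = \<sigma> M a \<otimes> (f M \<otimes> single K a c a)"
    by (rule TA_mult_coeff_unique) (use assms in \<open>auto simp: single_def\<close>)
  then show "(f \<otimes>\<^bsub>TA\<^esub> single K a c) (M + a) = \<sigma> M a \<otimes> (f M \<otimes> c)" by (simp add: single_def)
qed

text \<open>
  The multiset order is total and compatible with sums, so the leading monomials of two
  nonzero elements multiply to the leading monomial of the product.
\<close>

lemma zero_divisor_free_TA: "zero_divisor_free TA"
  unfolding zero_divisor_free_def
proof (intro ballI impI)
  fix f g assume f: "f \<in> carrier TA" and g: "g \<in> carrier TA" and fg: "f \<otimes>\<^bsub>TA\<^esub> g = \<zero>\<^bsub>TA\<^esub>"
  show "f = \<zero>\<^bsub>TA\<^esub> \<or> g = \<zero>\<^bsub>TA\<^esub>"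
  proof (rule ccontr)
    assume "\<not> ?thesis"
    then have ne: "{a. f a \<noteq> \<zero>} \<noteq> {}" "{a. g a \<noteq> \<zero>} \<noteq> {}" by (auto simp: fun_eq_iff)
    have fin: "finite {a. f a \<noteq> \<zero>}" "finite {a. g a \<noteq> \<zero>}" using f g by (simp_all add: TA_carrier_iff)
    define A where "A = Max {a. f a \<noteq> \<zero>}"
    define B where "B = Max {a. g a \<noteq> \<zero>}"
    have A: "f A \<noteq> \<zero>" and B: "g B \<noteq> \<zero>"
      using Max_in[OF fin(1) ne(1)] Max_in[OF fin(2) ne(2)] by (simp_all add: A_def B_def)
    have A': "f a = \<zero>" if "A < a" for a
      using Max_ge[OF fin(1), of a] that unfolding A_def by (auto simp: linorder_not_less[symmetric])
    have B': "g a = \<zero>" if "B < a" for a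
      using Max_ge[OF fin(2), of a] that unfolding B_def by (auto simp: linorder_not_less[symmetric])
    have "(f \<otimes>\<^bsub>TA\<^esub> g) (A + B) = \<sigma> A B \<otimes> (f A \<otimes> g B)"
    proof (rule TA_mult_coeff_unique)
      fix a b assume ab: "a + b = A + B" "(a, b) \<noteq> (A, B)"
      have "A < a \<or> B < b"
      proof (rule ccontr)
        assume "\<not> ?thesis"
        then have le: "a \<le> A" "b \<le> B" by (simp_all add: linorder_not_less)
        then have "a + b < A + B"
          using ab(2) add_less_le_mono[of a A b B] add_le_less_mono[of a A b B] by (cases "a = A") auto
        then show False using ab(1) by simp
      qed
      then show "f a = \<zero> \<or> g b = \<zero>" using A' B' by blast
    qed (use f g in auto)
    moreover have "f A \<otimes> g B \<noteq> \<zero>" using A B f g by (simp add: integral_iff)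
    then have "\<sigma> A B \<otimes> (f A \<otimes> g B) \<noteq> \<zero>" using f g by (simp add: integral_iff)
    ultimately show False using fg by simp
  qed
qed

lemma single_central:
  assumes a: "a \<in> veronese_exponents n v" and r: "r \<in> carrier K"
    and comm: "\<And>b. b \<in> veronese_exponents n v \<Longrightarrow> \<sigma> b a = \<sigma> a b"
  shows "single K a r \<in> centre TA"
proof (rule centreI)
  show z: "single K a r \<in> carrier TA" using a r by (rule single_closed)
  interpret A: ring TA by (rule ring_TA)
  let ?T = "{y \<in> carrier TA. y \<otimes>\<^bsub>TA\<^esub> single K a r = single K a r \<otimes>\<^bsub>TA\<^esub> y}"
  have "carrier TA \<subseteq> ?T"
  proof (rule TA_generated)
    fix b c assume "b \<in> veronese_exponents n v" "c \<in> carrier K"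
    then show "single K b c \<in> ?T"
      using a r comm[of b] by (simp add: single_closed single_mult_single m_ac add.commute)
  next
    fix f g assume "f \<in> ?T" "g \<in> ?T"
    then show "f \<oplus>\<^bsub>TA\<^esub> g \<in> ?T"
      using A.l_distr[of f g "single K a r"] A.r_distr[of f g "single K a r"] A.a_closed[of f g] z
      by (simp del: TA_simps)
  qed
  then show "y \<otimes>\<^bsub>TA\<^esub> single K a r = single K a r \<otimes>\<^bsub>TA\<^esub> y" if "y \<in> carrier TA" for y
    using that by blast
qed

text \<open>
  Operators that send each monomial \<open>X\<^sup>c\<close> to the multiple \<open>\<kappa> c\<close> of \<open>X\<^sup>c\<^sup>+\<^sup>d\<close>, with the same shift \<open>d\<close> for all \<open>c\<close>.
\<close>

definition monomial_operator where
  "monomial_operator \<phi> d \<kappa> \<longleftrightarrow> \<phi> \<in> mult_algebra TA \<and> d \<in> veronese_exponents n v \<and>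
    (\<forall>c\<in>veronese_exponents n v. \<kappa> c \<in> carrier K \<and>
      (\<forall>r\<in>carrier K. \<phi> (single K c r) = single K (c + d) (\<kappa> c \<otimes> r)))"

lemma monomial_operator_commutator:
  assumes \<phi>: "monomial_operator \<phi> d \<kappa>" and b: "b \<in> veronese_exponents n v" and l: "l \<in> carrier K"
  shows "monomial_operator (\<lambda>u. (single K b \<one> \<otimes>\<^bsub>TA\<^esub> \<phi> u) \<oplus>\<^bsub>TA\<^esub> (\<phi> u \<otimes>\<^bsub>TA\<^esub> single K b (\<ominus> l)))
    (d + b) (\<lambda>c. (\<sigma> b (c + d) \<ominus> l \<otimes> \<sigma> (c + d) b) \<otimes> \<kappa> c)"
  unfolding monomial_operator_def
proof (intro conjI ballI)
  show "(\<lambda>u. (single K b \<one> \<otimes>\<^bsub>TA\<^esub> \<phi> u) \<oplus>\<^bsub>TA\<^esub> (\<phi> u \<otimes>\<^bsub>TA\<^esub> single K b (\<ominus> l))) \<in> mult_algebra TA"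
    using \<phi> b l by (intro mult_algebra.plus mult_algebra.left mult_algebra.right single_closed)
      (auto simp: monomial_operator_def)
  show "d + b \<in> veronese_exponents n v" using \<phi> b by (simp add: monomial_operator_def P_pl)
  fix c assume c: "c \<in> veronese_exponents n v"
  then have \<kappa>: "\<kappa> c \<in> carrier K" using \<phi> by (simp add: monomial_operator_def)
  then show "(\<sigma> b (c + d) \<ominus> l \<otimes> \<sigma> (c + d) b) \<otimes> \<kappa> c \<in> carrier K" using l by simp
  fix r assume r: "r \<in> carrier K"
  have e: "\<phi> (single K c r) = single K (c + d) (\<kappa> c \<otimes> r)" using \<phi> c r by (simp add: monomial_operator_def)
  have "\<sigma> b (c + d) \<otimes> (\<one> \<otimes> (\<kappa> c \<otimes> r)) \<oplus> \<sigma> (c + d) b \<otimes> (\<kappa> c \<otimes> r \<otimes> \<ominus> l)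
    = (\<sigma> b (c + d) \<ominus> l \<otimes> \<sigma> (c + d) b) \<otimes> \<kappa> c \<otimes> r"
    using \<kappa> l r q_pow(1)[of "reorder_exponent b (c + d)"] q_pow(1)[of "reorder_exponent (c + d) b"]
    by algebra
  moreover have "b + (c + d) = c + (d + b)" "c + d + b = c + (d + b)" by (simp_all add: ac_simps)
  ultimately show "(single K b \<one> \<otimes>\<^bsub>TA\<^esub> \<phi> (single K c r)) \<oplus>\<^bsub>TA\<^esub> (\<phi> (single K c r) \<otimes>\<^bsub>TA\<^esub> single K b (\<ominus> l))
    = single K (c + (d + b)) ((\<sigma> b (c + d) \<ominus> l \<otimes> \<sigma> (c + d) b) \<otimes> \<kappa> c \<otimes> r)"
    unfolding e using \<kappa> l r
    by (simp add: single_mult_single del: reorder_exponent_simps) (simp add: single_def fun_eq_iff)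
qed

lemma monomial_operator_right:
  assumes \<phi>: "monomial_operator \<phi> d \<kappa>" and b: "b \<in> veronese_exponents n v"
  shows "monomial_operator (\<lambda>u. \<phi> u \<otimes>\<^bsub>TA\<^esub> single K b \<one>) (d + b) (\<lambda>c. \<sigma> (c + d) b \<otimes> \<kappa> c)"
  unfolding monomial_operator_def
proof (intro conjI ballI)
  show "(\<lambda>u. \<phi> u \<otimes>\<^bsub>TA\<^esub> single K b \<one>) \<in> mult_algebra TA"
    using \<phi> b by (intro mult_algebra.right single_closed) (auto simp: monomial_operator_def)
  show "d + b \<in> veronese_exponents n v" using \<phi> b by (simp add: monomial_operator_def P_pl)
  fix c assume c: "c \<in> veronese_exponents n v"
  then have \<kappa>: "\<kappa> c \<in> carrier K" using \<phi> by (simp add: monomial_operator_def)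
  then show "\<sigma> (c + d) b \<otimes> \<kappa> c \<in> carrier K" by (simp del: reorder_exponent_simps)
  fix r assume r: "r \<in> carrier K"
  have e: "\<phi> (single K c r) = single K (c + d) (\<kappa> c \<otimes> r)" using \<phi> c r by (simp add: monomial_operator_def)
  show "\<phi> (single K c r) \<otimes>\<^bsub>TA\<^esub> single K b \<one> = single K (c + (d + b)) (\<sigma> (c + d) b \<otimes> \<kappa> c \<otimes> r)"
    unfolding e using \<kappa> r
    by (simp add: single_mult_single m_assoc add.assoc del: reorder_exponent_simps)
qed

end

section \<open>The central conductor of the model\<close>

locale quantum_root_of_unity = quantum_exponents K q n v
  for K :: "('k, 'm) ring_scheme" (structure) and q :: 'k and n v :: nat +
  fixes m :: nat
  assumes n: "n \<ge> 2" and m: "m > 0" and v: "v > 0"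
    and ord_q: "group.ord (mult_of K) q = m"
    and cond: "(even n \<and> \<not> m dvd v) \<or> (odd n \<and> gcd m v \<noteq> 1)"
begin

lemma q_pow_eq_iff: "q [^] (a::nat) = q [^] b \<longleftrightarrow> [a = b] (mod m)"
proof -
  interpret M: group "mult_of K" by (rule K.field_mult_group)
  have qm: "q \<in> carrier (mult_of K)" using q by simp
  have "q [^] a = q [^] b \<longleftrightarrow> q [^]\<^bsub>mult_of K\<^esub> int a = q [^]\<^bsub>mult_of K\<^esub> int b"
    by (simp only: int_pow_int nat_pow_mult_of)
  also have "\<dots> \<longleftrightarrow> int m dvd (int b - int a)" unfolding M.int_pow_eq[OF qm] ord_q ..
  also have "\<dots> \<longleftrightarrow> [a = b] (mod m)"
    unfolding cong_iff_dvd_diff[symmetric] cong_int_iff by (rule cong_sym_eq)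
  finally show ?thesis .
qed

text \<open>
  Composition with \<open>u \<mapsto> X\<^sup>b u - q\<^sup>j u X\<^sup>b\<close> for \<open>j = 1, \<dots>, k\<close>.  Shifting the argument by multiples of \<open>b\<close> does
  not change its commutation with \<open>X\<^sup>b\<close>, so the \<open>j\<close>-th factor kills the monomials \<open>X\<^sup>c\<^sup>+\<^sup>d\<close> for which \<open>X\<^sup>b X\<^sup>c\<^sup>+\<^sup>d\<close>
  is \<open>q\<^sup>j X\<^sup>c\<^sup>+\<^sup>d X\<^sup>b\<close>.
\<close>

lemma monomial_operator_power:
  assumes \<phi>: "monomial_operator \<phi> d \<kappa>" and b: "b \<in> veronese_exponents n v"
  shows "\<exists>\<phi>' \<kappa>'. monomial_operator \<phi>' (d + repeat_mset k b) \<kappa>' \<and>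
    (\<forall>c\<in>veronese_exponents n v. \<kappa>' c \<noteq> \<zero> \<longleftrightarrow> \<kappa> c \<noteq> \<zero> \<and>
      (\<forall>j\<in>{1..k}. \<not> [reorder_exponent b (c + d) = j + reorder_exponent (c + d) b] (mod m)))"
proof (induction k)
  case 0
  show ?case using \<phi> by (intro exI[of _ \<phi>] exI[of _ \<kappa>]) simp
next
  case (Suc k)
  let ?d = "d + repeat_mset k b"
  obtain \<phi>' \<kappa>' where \<phi>': "monomial_operator \<phi>' ?d \<kappa>'"
    and \<kappa>': "\<forall>c\<in>veronese_exponents n v. \<kappa>' c \<noteq> \<zero> \<longleftrightarrow> \<kappa> c \<noteq> \<zero> \<and>
      (\<forall>j\<in>{1..k}. \<not> [reorder_exponent b (c + d) = j + reorder_exponent (c + d) b] (mod m))"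
    using Suc by blast
  define \<kappa>2 where "\<kappa>2 c = (\<sigma> b (c + ?d) \<ominus> q [^] Suc k \<otimes> \<sigma> (c + ?d) b) \<otimes> \<kappa>' c" for c
  have "monomial_operator (\<lambda>u. (single K b \<one> \<otimes>\<^bsub>TA\<^esub> \<phi>' u) \<oplus>\<^bsub>TA\<^esub> (\<phi>' u \<otimes>\<^bsub>TA\<^esub> single K b (\<ominus> (q [^] Suc k))))
    (d + repeat_mset (Suc k) b) \<kappa>2"
  proof -
    have "?d + b = d + repeat_mset (Suc k) b" by (simp add: ac_simps)
    from monomial_operator_commutator[OF \<phi>' b q_pow(1)[of "Suc k"], unfolded this]
    show ?thesis unfolding \<kappa>2_def .
  qed
  moreover have "\<kappa>2 c \<noteq> \<zero> \<longleftrightarrow> \<kappa> c \<noteq> \<zero> \<and>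
      (\<forall>j\<in>{1..Suc k}. \<not> [reorder_exponent b (c + d) = j + reorder_exponent (c + d) b] (mod m))"
    if c: "c \<in> veronese_exponents n v" for c
  proof -
    have \<kappa>c: "\<kappa>' c \<in> carrier K" using \<phi>' c by (simp add: monomial_operator_def)
    have "\<kappa>2 c \<noteq> \<zero> \<longleftrightarrow> \<sigma> b (c + ?d) \<ominus> q [^] Suc k \<otimes> \<sigma> (c + ?d) b \<noteq> \<zero> \<and> \<kappa>' c \<noteq> \<zero>"
    proof -
      have "\<sigma> b (c + ?d) \<ominus> q [^] Suc k \<otimes> \<sigma> (c + ?d) b \<in> carrier K"
        by (intro minus_closed m_closed q_pow)
      from integral_iff[OF this \<kappa>c] show ?thesis unfolding \<kappa>2_def by blast
    qed
    also have "\<sigma> b (c + ?d) \<ominus> q [^] Suc k \<otimes> \<sigma> (c + ?d) b = \<zero>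
      \<longleftrightarrow> \<sigma> b (c + ?d) = q [^] Suc k \<otimes> \<sigma> (c + ?d) b"
      by (intro r_right_minus_eq m_closed q_pow)
    also have "\<dots> \<longleftrightarrow> \<sigma> b (c + ?d) = q [^] (Suc k + reorder_exponent (c + ?d) b)"
      using q(1) by (simp only: nat_pow_mult)
    also have "\<dots> \<longleftrightarrow> [reorder_exponent b (c + d) + k * reorder_exponent b b
      = (Suc k + reorder_exponent (c + d) b) + k * reorder_exponent b b] (mod m)"
      unfolding q_pow_eq_iff by (simp add: reorder_exponent_repeat add.assoc[symmetric])
    also have "\<dots> \<longleftrightarrow> [reorder_exponent b (c + d) = Suc k + reorder_exponent (c + d) b] (mod m)"
      by (rule cong_add_rcancel_nat)
    finally have "\<kappa>2 c \<noteq> \<zero> \<longleftrightarrow>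
        \<not> [reorder_exponent b (c + d) = Suc k + reorder_exponent (c + d) b] (mod m) \<and> \<kappa>' c \<noteq> \<zero>" .
    moreover have "{1..Suc k} = insert (Suc k) {1..k}" by (simp add: atLeastAtMostSuc_conv)
    ultimately show ?thesis using \<kappa>'[rule_format, OF c] by (simp only: ball_simps) blast
  qed
  ultimately show ?case by blast
qed

lemma cong_iff_no_shift:
  "[x = y] (mod m) \<longleftrightarrow> (\<forall>j\<in>{1..m - 1}. \<not> [x = j + y] (mod m))" for x y :: nat
proof
  assume xy: "[x = y] (mod m)"
  show "\<forall>j\<in>{1..m - 1}. \<not> [x = j + y] (mod m)"
  proof (intro ballI notI)
    fix j assume j: "j \<in> {1..m - 1}" "[x = j + y] (mod m)"
    have "[j + y = 0 + y] (mod m)" using cong_trans[OF cong_sym[OF j(2)] xy] by simp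
    then have "[j = 0] (mod m)" by (simp only: cong_add_rcancel_nat)
    then have "m dvd j" by (simp add: cong_0_iff)
    then show False using j(1) m by (auto dest: dvd_imp_le)
  qed
next
  assume no: "\<forall>j\<in>{1..m - 1}. \<not> [x = j + y] (mod m)"
  define j where "j = (x + (m - 1) * y) mod m"
  have "[j + y = (x + (m - 1) * y) + y] (mod m)"
    by (simp add: j_def cong_def mod_add_left_eq)
  also have "(x + (m - 1) * y) + y = x + m * y" using m by (cases m) simp_all
  also have "[x + m * y = x] (mod m)" by (simp add: cong_def)
  finally have xj: "[x = j + y] (mod m)" by (rule cong_sym)
  have "j < m" using m unfolding j_def by (rule mod_less_divisor)
  have "j = 0"
  proof (rule ccontr)
    assume "j \<noteq> 0"
    then have "j \<in> {1..m - 1}" using \<open>j < m\<close> by auto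
    then show False using no xj by blast
  qed
  then show "[x = y] (mod m)" using xj by simp
qed

text \<open>
  For \<open>k = m - 1\<close> only the monomials commuting with \<open>X\<^sup>b\<close> survive.  A further factor \<open>X\<^sup>b\<close> makes the total
  shift \<open>m b\<close>, which commutes with everything, so that blocks for different \<open>b\<close> do not interfere.
\<close>

lemma monomial_operator_block:
  assumes \<phi>: "monomial_operator \<phi> d \<kappa>" and b: "b \<in> veronese_exponents n v"
  shows "\<exists>\<phi>' \<kappa>'. monomial_operator \<phi>' (d + repeat_mset m b) \<kappa>' \<and>
    (\<forall>c\<in>veronese_exponents n v. \<kappa>' c \<noteq> \<zero> \<longleftrightarrow>
      \<kappa> c \<noteq> \<zero> \<and> [reorder_exponent b (c + d) = reorder_exponent (c + d) b] (mod m))"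
proof -
  let ?d = "d + repeat_mset (m - 1) b"
  obtain \<phi>' \<kappa>' where \<phi>': "monomial_operator \<phi>' ?d \<kappa>'"
    and \<kappa>': "\<forall>c\<in>veronese_exponents n v. \<kappa>' c \<noteq> \<zero> \<longleftrightarrow> \<kappa> c \<noteq> \<zero> \<and>
      (\<forall>j\<in>{1..m - 1}. \<not> [reorder_exponent b (c + d) = j + reorder_exponent (c + d) b] (mod m))"
    using monomial_operator_power[OF \<phi> b, of "m - 1"] by blast
  have "repeat_mset m b = repeat_mset (m - 1) b + b" using m by (cases m) simp_all
  then have d: "?d + b = d + repeat_mset m b" by (simp add: add.assoc)
  have "\<sigma> (c + ?d) b \<otimes> \<kappa>' c \<noteq> \<zero> \<longleftrightarrow> \<kappa>' c \<noteq> \<zero>" if c: "c \<in> veronese_exponents n v" for c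
  proof -
    have "\<kappa>' c \<in> carrier K" using \<phi>' c by (simp add: monomial_operator_def)
    then show ?thesis using integral_iff[OF q_pow(1)[of "reorder_exponent (c + ?d) b"]] q_pow(2) by blast
  qed
  moreover have "\<forall>c\<in>veronese_exponents n v. \<kappa>' c \<noteq> \<zero> \<longleftrightarrow>
      \<kappa> c \<noteq> \<zero> \<and> [reorder_exponent b (c + d) = reorder_exponent (c + d) b] (mod m)"
    using \<kappa>' by (simp only: cong_iff_no_shift[symmetric])
  ultimately show ?thesis
    using monomial_operator_right[OF \<phi>' b] unfolding d
    by (intro exI[of _ "\<lambda>u. \<phi>' u \<otimes>\<^bsub>TA\<^esub> single K b \<one>"] exI[of _ "\<lambda>c. \<sigma> (c + ?d) b \<otimes> \<kappa>' c"]) simp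
qed

text \<open>
  Every monomial of degree divisible by \<open>v\<close> is a product of monomials of degree \<open>v\<close>.
\<close>

lemma commutes_with_generators:
  assumes gens: "\<And>b. b \<in> veronese_exponents n v \<Longrightarrow> size b = v \<Longrightarrow>
      [reorder_exponent b c = reorder_exponent c b] (mod m)"
    and a: "a \<in> veronese_exponents n v"
  shows "[reorder_exponent a c = reorder_exponent c a] (mod m)"
  using a
proof (induction "size a" arbitrary: a rule: less_induct)
  case less
  show ?case
  proof (cases "a = {#}")
    case False
    obtain xs where xs: "a = mset xs" using ex_mset by metis
    let ?b = "mset (take v xs)" and ?a = "mset (drop v xs)"
    have dv: "v dvd length xs" using less.prems by (simp add: veronese_exponents_def xs)
    then have len: "v \<le> length xs" using False xs by (auto intro: dvd_imp_le)
    have ab: "a = ?b + ?a" by (simp add: xs flip: mset_append)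
    have sub: "set xs \<subseteq> {1..n}" using less.prems by (simp add: veronese_exponents_def xs)
    have b: "?b \<in> veronese_exponents n v" "size ?b = v"
      using sub len set_take_subset[of v xs] by (auto simp: veronese_exponents_def)
    have "?a \<in> veronese_exponents n v"
      using sub dv len set_drop_subset[of v xs] by (auto simp: veronese_exponents_def dvd_diff_nat)
    moreover have "size ?a < size a" using len v False xs by simp
    ultimately have "[reorder_exponent ?a c = reorder_exponent c ?a] (mod m)" using less.hyps by blast
    from cong_add[OF gens[OF b] this] show ?thesis
      unfolding reorder_exponent_simps(3,4)[symmetric] ab[symmetric] .
  qed simp
qed

text \<open>
  Composing the blocks for all monomials of degree \<open>v\<close> leaves only the central monomials, and
  these are mapped to nonzero multiples of central monomials; the empty monomial is one of them.
\<close>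

lemma central_conductor_nonzero:
  "\<exists>z\<in>central_conductor TA. z \<noteq> \<zero>\<^bsub>TA\<^esub>"
proof -
  interpret A: ring TA by (rule ring_TA)
  let ?P = "veronese_exponents n v"
  have exists_op: "\<exists>\<phi> s \<kappa>. s \<in> ?P \<and> monomial_operator \<phi> (repeat_mset m s) \<kappa> \<and>
    (\<forall>c\<in>?P. \<kappa> c \<noteq> \<zero> \<longleftrightarrow> (\<forall>b\<in>B. [reorder_exponent b c = reorder_exponent c b] (mod m)))"
    if "finite B" "B \<subseteq> ?P" for B
    using that
  proof (induction B)
    case empty
    have "monomial_operator (\<lambda>u. u) (repeat_mset m {#}) (\<lambda>_. \<one>)"
      unfolding monomial_operator_def by (simp add: mult_algebra.ident P_e)
    then show ?case using P_e by (intro exI[of _ "\<lambda>u. u"] exI[of _ "{#}"] exI[of _ "\<lambda>_. \<one>"]) simp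
  next
    case (insert b B)
    then obtain \<phi> s \<kappa> where s: "s \<in> ?P" and \<phi>: "monomial_operator \<phi> (repeat_mset m s) \<kappa>"
      and \<kappa>: "\<forall>c\<in>?P. \<kappa> c \<noteq> \<zero> \<longleftrightarrow> (\<forall>b\<in>B. [reorder_exponent b c = reorder_exponent c b] (mod m))"
      by blast
    have b: "b \<in> ?P" using insert by blast
    obtain \<phi>' \<kappa>' where \<phi>': "monomial_operator \<phi>' (repeat_mset m s + repeat_mset m b) \<kappa>'"
      and \<kappa>': "\<forall>c\<in>?P. \<kappa>' c \<noteq> \<zero> \<longleftrightarrow> \<kappa> c \<noteq> \<zero> \<and>
        [reorder_exponent b (c + repeat_mset m s) = reorder_exponent (c + repeat_mset m s) b] (mod m)"
      using monomial_operator_block[OF \<phi> b] by blast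
    have "[reorder_exponent b (c + repeat_mset m s) = reorder_exponent (c + repeat_mset m s) b] (mod m)
      \<longleftrightarrow> [reorder_exponent b c = reorder_exponent c b] (mod m)" for c
      by (simp add: reorder_exponent_repeat cong_def)
    moreover have "repeat_mset m s + repeat_mset m b = repeat_mset m (s + b)" by simp
    ultimately show ?case using \<phi>' \<kappa>' \<kappa> P_pl[OF s b] by (intro exI[of _ \<phi>'] exI[of _ "s + b"] exI[of _ \<kappa>']) auto
  qed
  let ?B = "{b \<in> ?P. size b = v}"
  have "finite ?B"
    by (rule finite_subset[OF _ finite_multisets_bounded[of "{1..n}" v]])
      (auto simp: veronese_exponents_def)
  from exists_op[OF this] obtain \<phi> s \<kappa> where s: "s \<in> ?P" and \<phi>: "monomial_operator \<phi> (repeat_mset m s) \<kappa>"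
    and \<kappa>: "\<forall>c\<in>?P. \<kappa> c \<noteq> \<zero> \<longleftrightarrow> (\<forall>b\<in>?B. [reorder_exponent b c = reorder_exponent c b] (mod m))"
    by auto
  have \<phi>M: "\<phi> \<in> mult_algebra TA" using \<phi> by (simp add: monomial_operator_def)
  have act: "\<phi> (single K c r) = single K (c + repeat_mset m s) (\<kappa> c \<otimes> r)" "\<kappa> c \<in> carrier K"
    if "c \<in> ?P" "r \<in> carrier K" for c r
    using \<phi> that by (simp_all add: monomial_operator_def)
  let ?T = "{u \<in> carrier TA. \<phi> u \<in> centre TA}"
  have "carrier TA \<subseteq> ?T"
  proof (rule TA_generated)
    fix c r assume c: "c \<in> ?P" and r: "r \<in> carrier K"
    have cs: "c + repeat_mset m s \<in> ?P" using \<phi> c by (simp add: monomial_operator_def P_pl)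
    have "single K (c + repeat_mset m s) (\<kappa> c \<otimes> r) \<in> centre TA"
    proof (cases "\<kappa> c = \<zero>")
      case True
      then have "single K (c + repeat_mset m s) (\<kappa> c \<otimes> r) = \<zero>\<^bsub>TA\<^esub>"
        using r by (simp add: single_def fun_eq_iff)
      then show ?thesis by (auto intro: centreI simp del: TA_simps)
    next
      case False
      then have gens: "\<forall>b\<in>?B. [reorder_exponent b c = reorder_exponent c b] (mod m)"
        using \<kappa> c by blast
      have comm: "[reorder_exponent b c = reorder_exponent c b] (mod m)" if "b \<in> ?P" for b
        by (rule commutes_with_generators[OF _ that]) (use gens in simp)
      show ?thesis
      proof (rule single_central[OF cs])
        show "\<sigma> b (c + repeat_mset m s) = \<sigma> (c + repeat_mset m s) b" if "b \<in> ?P" for b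
          unfolding q_pow_eq_iff reorder_exponent_simps reorder_exponent_repeat
          using comm[OF that] by (simp add: cong_def)
      qed (use act(2)[OF c r] r in simp)
    qed
    then show "single K c r \<in> ?T" using act[OF c r] single_closed[OF c r] by simp
  next
    fix f g assume f: "f \<in> ?T" and g: "g \<in> ?T"
    have "\<phi> f \<oplus>\<^bsub>TA\<^esub> \<phi> g \<in> centre TA"
    proof (rule centreI)
      have c: "\<phi> f \<in> centre TA" "\<phi> g \<in> centre TA" using f g by blast+
      note cl = centre_closed[OF c(1)] centre_closed[OF c(2)]
      show "\<phi> f \<oplus>\<^bsub>TA\<^esub> \<phi> g \<in> carrier TA" using cl by (rule A.a_closed)
      show "y \<otimes>\<^bsub>TA\<^esub> (\<phi> f \<oplus>\<^bsub>TA\<^esub> \<phi> g) = (\<phi> f \<oplus>\<^bsub>TA\<^esub> \<phi> g) \<otimes>\<^bsub>TA\<^esub> y" if y: "y \<in> carrier TA" for y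
        unfolding A.r_distr[OF cl y] A.l_distr[OF cl y]
        using centre_commute[OF c(1) y] centre_commute[OF c(2) y] by simp
    qed
    then show "f \<oplus>\<^bsub>TA\<^esub> g \<in> ?T"
      using f g A.mult_algebra_add[OF \<phi>M, of f g] A.a_closed[of f g] by (simp del: TA_simps)
  qed
  moreover have "\<phi> \<one>\<^bsub>TA\<^esub> \<noteq> \<zero>\<^bsub>TA\<^esub>"
  proof -
    have "\<phi> \<one>\<^bsub>TA\<^esub> = single K (repeat_mset m s) (\<kappa> {#})"
      using act[OF P_e, of \<one>] by simp
    moreover have "\<kappa> {#} \<noteq> \<zero>" using \<kappa> P_e by (simp add: cong_def)
    ultimately show ?thesis by (auto simp: single_def fun_eq_iff)
  qed
  ultimately show ?thesis
    using \<phi>M unfolding central_conductor_def by (intro bexI[of _ "\<phi> \<one>\<^bsub>TA\<^esub>"]) auto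
qed

text \<open>
  Equality in the quotient by the ideal of \<open>x\<^sub>i\<close>, expressed by coefficients.
\<close>

definition same_mod_var where
  "same_mod_var i f g \<longleftrightarrow> (\<forall>M. i \<notin># M \<longrightarrow> f M = (g M :: 'k))"

lemma same_mod_var_mult:
  assumes "f \<in> carrier TA" "f' \<in> carrier TA" "g \<in> carrier TA" "g' \<in> carrier TA"
    and "same_mod_var i f f'" "same_mod_var i g g'"
  shows "same_mod_var i (f \<otimes>\<^bsub>TA\<^esub> g) (f' \<otimes>\<^bsub>TA\<^esub> g')"
  unfolding same_mod_var_def
proof (intro allI impI)
  fix M assume M: "i \<notin># M"
  show "(f \<otimes>\<^bsub>TA\<^esub> g) M = (f' \<otimes>\<^bsub>TA\<^esub> g') M"
    unfolding TA_mult_coeff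
  proof (rule finsum_cong')
    fix p assume "p \<in> {p. fst p + snd p = M}"
    then have "i \<notin># fst p" "i \<notin># snd p" using M by auto
    then show "\<sigma> (fst p) (snd p) \<otimes> (f (fst p) \<otimes> g (snd p)) = \<sigma> (fst p) (snd p) \<otimes> (f' (fst p) \<otimes> g' (snd p))"
      using assms(5,6) by (simp add: same_mod_var_def)
  qed (use assms in auto)
qed

lemma same_mod_var_add:
  "same_mod_var i f f' \<Longrightarrow> same_mod_var i g g' \<Longrightarrow> same_mod_var i (f \<oplus>\<^bsub>TA\<^esub> g) (f' \<oplus>\<^bsub>TA\<^esub> g')"
  by (simp add: same_mod_var_def)

lemma same_mod_var_refl: "same_mod_var i f f"
  by (simp add: same_mod_var_def)

lemma same_mod_var_trans: "same_mod_var i f g \<Longrightarrow> same_mod_var i g h \<Longrightarrow> same_mod_var i f h"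
  by (simp add: same_mod_var_def)

text \<open>
  With \<open>X\<^sup>c\<close> from \<open>dual_exponent_exists\<close>, moving \<open>X\<^sup>c\<close> through the factors of an operator \<open>\<phi>\<close> gives
  \<open>\<phi> X\<^sup>c = X\<^sup>c \<phi> 1\<close> modulo \<open>x\<^sub>i\<close>.  If \<open>\<phi> 1\<close> contained \<open>X\<^sup>d\<close> with \<open>d\<close> free of \<open>i\<close>, then \<open>\<phi> X\<^sup>c\<close> would contain \<open>X\<^sup>c\<^sup>+\<^sup>d\<close>.
  Monomials in central elements are central, so \<open>X\<^sup>d\<close>, \<open>X\<^sup>c\<^sup>+\<^sup>d\<close> and hence \<open>X\<^sup>c\<close> would be central.
\<close>

lemma central_conductor_divisible:
  assumes z: "z \<in> central_conductor TA" and i: "i \<in> {1..n}" and d: "i \<notin># d"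
  shows "z d = \<zero>"
proof (rule ccontr)
  assume zd: "z d \<noteq> \<zero>"
  interpret A: ring TA by (rule ring_TA)
  let ?P = "veronese_exponents n v"
  obtain c where c: "c \<in> ?P" "i \<notin># c"
    and comm: "\<And>b. b \<in> ?P \<Longrightarrow> i \<notin># b \<Longrightarrow> [reorder_exponent b c = reorder_exponent c b] (mod m)"
    and ncomm: "\<exists>b\<in>?P. \<not> [reorder_exponent b c = reorder_exponent c b] (mod m)"
    using dual_exponent_exists[OF n m v cond i] by blast
  obtain b where b: "b \<in> ?P" "\<not> [reorder_exponent b c = reorder_exponent c b] (mod m)"
    using ncomm by blast
  obtain \<phi> where \<phi>: "\<phi> \<in> mult_algebra TA" "\<forall>u\<in>carrier TA. \<phi> u \<in> centre TA" "z = \<phi> \<one>\<^bsub>TA\<^esub>"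
    using z by (auto simp: central_conductor_def simp del: TA_simps)
  let ?X = "single K c \<one>"
  have X: "?X \<in> carrier TA" using c by (simp add: single_closed)
  have cl: "\<phi> \<one>\<^bsub>TA\<^esub> \<in> carrier TA" "\<phi> ?X \<in> carrier TA" if "\<phi> \<in> mult_algebra TA" for \<phi>
    using A.mult_algebra_closed[OF that] X A.one_closed by blast+
  let ?T = "{y \<in> carrier TA. same_mod_var i (y \<otimes>\<^bsub>TA\<^esub> ?X) (?X \<otimes>\<^bsub>TA\<^esub> y)}"
  have "carrier TA \<subseteq> ?T"
  proof (rule TA_generated)
    fix a r assume a: "a \<in> ?P" and r: "r \<in> carrier K"
    have "same_mod_var i (single K (a + c) (\<sigma> a c \<otimes> r)) (single K (c + a) (\<sigma> c a \<otimes> r))"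
    proof (cases "i \<in># a")
      case True
      then show ?thesis by (auto simp: same_mod_var_def single_def)
    next
      case False
      then have "\<sigma> a c = \<sigma> c a" using comm[OF a] by (simp add: q_pow_eq_iff)
      then show ?thesis by (simp add: add.commute same_mod_var_refl)
    qed
    then show "single K a r \<in> ?T" using a r by (simp add: single_closed single_mult_single)
  next
    fix f g assume f: "f \<in> ?T" and g: "g \<in> ?T"
    have fg: "f \<in> carrier TA" "g \<in> carrier TA" using f g by auto
    show "f \<oplus>\<^bsub>TA\<^esub> g \<in> ?T"
      using A.l_distr[OF fg X] A.r_distr[OF fg X] A.a_closed[OF fg] f g same_mod_var_add
      by (simp del: TA_simps)
  qed
  then have swap: "same_mod_var i (y \<otimes>\<^bsub>TA\<^esub> ?X) (?X \<otimes>\<^bsub>TA\<^esub> y)" if "y \<in> carrier TA" for y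
    using that by blast
  have key: "same_mod_var i (\<phi> ?X) (?X \<otimes>\<^bsub>TA\<^esub> \<phi> \<one>\<^bsub>TA\<^esub>)" if "\<phi> \<in> mult_algebra TA" for \<phi>
    using that
  proof (induction rule: mult_algebra.induct)
    case ident
    then show ?case using X by (simp add: same_mod_var_refl del: TA_simps)
  next
    case (left y \<phi>)
    note cl = cl[OF left(2)]
    have "same_mod_var i (y \<otimes>\<^bsub>TA\<^esub> \<phi> ?X) (y \<otimes>\<^bsub>TA\<^esub> (?X \<otimes>\<^bsub>TA\<^esub> \<phi> \<one>\<^bsub>TA\<^esub>))"
      by (rule same_mod_var_mult[OF left(1,1) cl(2) _ same_mod_var_refl left(3)]) (rule A.m_closed[OF X cl(1)])
    also have "y \<otimes>\<^bsub>TA\<^esub> (?X \<otimes>\<^bsub>TA\<^esub> \<phi> \<one>\<^bsub>TA\<^esub>) = (y \<otimes>\<^bsub>TA\<^esub> ?X) \<otimes>\<^bsub>TA\<^esub> \<phi> \<one>\<^bsub>TA\<^esub>"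
      using left(1) X cl by (simp add: A.m_assoc del: TA_simps)
    finally have 1: "same_mod_var i (y \<otimes>\<^bsub>TA\<^esub> \<phi> ?X) ((y \<otimes>\<^bsub>TA\<^esub> ?X) \<otimes>\<^bsub>TA\<^esub> \<phi> \<one>\<^bsub>TA\<^esub>)" .
    have 2: "same_mod_var i ((y \<otimes>\<^bsub>TA\<^esub> ?X) \<otimes>\<^bsub>TA\<^esub> \<phi> \<one>\<^bsub>TA\<^esub>) ((?X \<otimes>\<^bsub>TA\<^esub> y) \<otimes>\<^bsub>TA\<^esub> \<phi> \<one>\<^bsub>TA\<^esub>)"
      by (rule same_mod_var_mult[OF A.m_closed[OF left(1) X] A.m_closed[OF X left(1)] cl(1,1) swap[OF left(1)] same_mod_var_refl])
    from same_mod_var_trans[OF 1 2] show ?case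
      using left(1) X cl by (simp add: A.m_assoc del: TA_simps)
  next
    case (right y \<phi>)
    note cl = cl[OF right(2)]
    have "same_mod_var i (\<phi> ?X \<otimes>\<^bsub>TA\<^esub> y) ((?X \<otimes>\<^bsub>TA\<^esub> \<phi> \<one>\<^bsub>TA\<^esub>) \<otimes>\<^bsub>TA\<^esub> y)"
      by (rule same_mod_var_mult[OF cl(2) A.m_closed[OF X cl(1)] right(1,1) right(3) same_mod_var_refl])
    then show ?case using right(1) X cl by (simp add: A.m_assoc del: TA_simps)
  next
    case (plus \<phi> \<psi>)
    note cl = cl[OF plus(1)] cl[OF plus(2)]
    show ?case using same_mod_var_add[OF plus(3,4)] X cl by (simp add: A.r_distr del: TA_simps)
  qed
  define w where "w = \<phi> ?X"
  have wc: "w \<in> centre TA" and zc: "z \<in> centre TA" using \<phi> X A.one_closed by (simp_all add: w_def del: TA_simps)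
  have wA: "w \<in> carrier TA" and zA: "z \<in> carrier TA" using wc zc by (simp_all add: centre_closed)
  let ?Y = "single K b \<one>"
  have Y: "?Y \<in> carrier TA" using b by (simp add: single_closed)
  have shift: "[reorder_exponent b M = reorder_exponent M b] (mod m)"
    if u: "u \<in> centre TA" "u M \<noteq> \<zero>" for u M
  proof -
    have uA: "u \<in> carrier TA" using u by (simp add: centre_closed)
    have "(?Y \<otimes>\<^bsub>TA\<^esub> u) (b + M) = (u \<otimes>\<^bsub>TA\<^esub> ?Y) (M + b)"
      using centre_commute[OF u(1) Y] by (simp add: add.commute)
    then have "\<sigma> b M \<otimes> u M = \<sigma> M b \<otimes> u M" using uA by (simp add: single_mult_coeff)
    then have "\<sigma> b M = \<sigma> M b" using u(2) uA m_rcancel[of "u M" "\<sigma> b M" "\<sigma> M b"] by simp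
    then show ?thesis by (simp add: q_pow_eq_iff)
  qed
  have "w (c + d) = (?X \<otimes>\<^bsub>TA\<^esub> z) (c + d)"
    using key[OF \<phi>(1)] c(2) d by (simp add: same_mod_var_def w_def \<phi>(3) del: TA_simps)
  also have "\<dots> = \<sigma> c d \<otimes> z d" using zA by (simp add: single_mult_coeff)
  also have "\<dots> \<noteq> \<zero>" using zd zA by (simp add: integral_iff)
  finally have "[reorder_exponent b (c + d) = reorder_exponent (c + d) b] (mod m)" by (rule shift[OF wc])
  then have "[reorder_exponent b c + reorder_exponent b d = reorder_exponent c b + reorder_exponent d b] (mod m)"
    by simp
  moreover have "[reorder_exponent c b + reorder_exponent d b = reorder_exponent c b + reorder_exponent b d] (mod m)"
    using cong_add[OF cong_refl cong_sym[OF shift[OF zc zd]]] .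
  ultimately have "[reorder_exponent b c + reorder_exponent b d = reorder_exponent c b + reorder_exponent b d] (mod m)"
    by (rule cong_trans)
  then show False using b(2) by (simp only: cong_add_rcancel_nat)
qed

end

section \<open>Cancellation for the model\<close>

lemma isomorphic_algebras_if_constants_preserved:
  assumes A: "assoc_algebra K A" and B: "assoc_algebra K B"
    and h: "h \<in> algebra_iso K (poly_algebra A) (poly_algebra B)"
    and f: "f \<in> ring_iso A B" "\<forall>r\<in>carrier A. h (up_const A r) = up_const B (f r)"
  shows "isomorphic_algebras K A B"
proof -
  interpret A: assoc_algebra K A by fact
  interpret B: assoc_algebra K B by fact
  have "f (c \<odot>\<^bsub>A\<^esub> x) = c \<odot>\<^bsub>B\<^esub> f x" if c: "c \<in> carrier K" and x: "x \<in> carrier A" for c x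
  proof -
    have cx: "c \<odot>\<^bsub>A\<^esub> x \<in> carrier A" using c x by simp
    have "up_const A (c \<odot>\<^bsub>A\<^esub> x) = (\<lambda>i. c \<odot>\<^bsub>A\<^esub> up_const A x i)"
      using c by (auto simp: up_const_def fun_eq_iff)
    also have "\<dots> = c \<odot>\<^bsub>poly_algebra A\<^esub> up_const A x" by (simp add: poly_algebra_def)
    finally have "h (up_const A (c \<odot>\<^bsub>A\<^esub> x)) = h (c \<odot>\<^bsub>poly_algebra A\<^esub> up_const A x)" by simp
    also have "\<dots> = c \<odot>\<^bsub>poly_algebra B\<^esub> h (up_const A x)"
      using h c A.up_const_closed[OF x] unfolding algebra_iso_def
      by (auto simp: poly_algebra_def UP_def)
    also have "\<dots> = (\<lambda>i. c \<odot>\<^bsub>B\<^esub> up_const B (f x) i)" using f(2) x by (simp add: poly_algebra_def)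
    finally have "up_const B (f (c \<odot>\<^bsub>A\<^esub> x)) = (\<lambda>i. c \<odot>\<^bsub>B\<^esub> up_const B (f x) i)"
      using f(2) cx by simp
    from fun_cong[OF this, of 0] show ?thesis by (simp add: up_const_def)
  qed
  then show ?thesis using f(1) unfolding isomorphic_algebras_def algebra_iso_def by blast
qed

lemma ring_iso_poly_algebra: "ring_iso (poly_algebra A) (poly_algebra B) = ring_iso (UP A) (UP B)"
  unfolding ring_iso_def ring_hom_def poly_algebra_def by simp

context quantum_root_of_unity
begin

definition multiples_of_all_vars where
  "multiples_of_all_vars N = {f \<in> carrier TA. \<forall>M. f M \<noteq> \<zero> \<longrightarrow> (\<forall>i\<in>{1..n}. N \<le> count M i)}"

lemma multiples_of_all_vars_closed:
  "multiples_of_all_vars N \<subseteq> carrier TA"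
  "\<zero>\<^bsub>TA\<^esub> \<in> multiples_of_all_vars N"
  "f \<in> multiples_of_all_vars N \<Longrightarrow> g \<in> multiples_of_all_vars N \<Longrightarrow> f \<oplus>\<^bsub>TA\<^esub> g \<in> multiples_of_all_vars N"
proof -
  show "multiples_of_all_vars N \<subseteq> carrier TA" by (auto simp: multiples_of_all_vars_def)
  have "\<zero>\<^bsub>TA\<^esub> \<in> carrier TA" unfolding TA_carrier_iff by simp
  then show "\<zero>\<^bsub>TA\<^esub> \<in> multiples_of_all_vars N" by (simp add: multiples_of_all_vars_def)
  assume f: "f \<in> multiples_of_all_vars N" and g: "g \<in> multiples_of_all_vars N"
  have "f M \<noteq> \<zero> \<or> g M \<noteq> \<zero>" if "f M \<oplus> g M \<noteq> \<zero>" for M using that by auto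
  then show "f \<oplus>\<^bsub>TA\<^esub> g \<in> multiples_of_all_vars N"
    using f g TA_add_closed[of f g] unfolding multiples_of_all_vars_def TA_simps by blast
qed

lemma multiples_of_all_vars_mult:
  assumes f: "f \<in> multiples_of_all_vars N" and g: "g \<in> multiples_of_all_vars N'"
  shows "f \<otimes>\<^bsub>TA\<^esub> g \<in> multiples_of_all_vars (N + N')"
proof -
  have fg: "f \<in> carrier TA" "g \<in> carrier TA" using f g by (simp_all add: multiples_of_all_vars_def)
  have "N + N' \<le> count M i" if M: "(f \<otimes>\<^bsub>TA\<^esub> g) M \<noteq> \<zero>" and i: "i \<in> {1..n}" for M i
  proof -
    obtain a b where ab: "a + b = M" "f a \<noteq> \<zero>" "g b \<noteq> \<zero>"
      using TA_mult_coeff_zero[of f g M] M fg by (metis TA_coeff)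
    then have "N \<le> count a i" "N' \<le> count b i" using f g i by (simp_all add: multiples_of_all_vars_def)
    then show ?thesis using ab(1) by auto
  qed
  then show ?thesis using TA_mult_closed[OF fg] by (simp add: multiples_of_all_vars_def)
qed

lemma central_conductor_multiples:
  assumes "z \<in> central_conductor TA"
  shows "z \<in> multiples_of_all_vars 1"
proof -
  interpret A: ring TA by (rule ring_TA)
  have "z \<in> carrier TA"
    using assms unfolding central_conductor_def by (auto intro: A.mult_algebra_closed simp del: TA_simps)
  moreover have "1 \<le> count M i" if "z M \<noteq> \<zero>" "i \<in> {1..n}" for M i
    using central_conductor_divisible[OF assms that(2), of M] that(1) by (auto simp: Suc_le_eq)
  ultimately show ?thesis by (simp add: multiples_of_all_vars_def)
qed

text \<open>
  A monomial \<open>a\<close> divides \<open>M\<close> as soon as all exponents of \<open>M\<close> reach the degree of \<open>a\<close>.  The quotient has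
  degree divisible by \<open>v\<close> again, so the division takes place inside the Veronese subring.
\<close>

lemma multiples_of_all_vars_divide:
  assumes f: "f \<in> multiples_of_all_vars N" and a: "a \<in> veronese_exponents n v" "size a \<le> N"
    and r: "r \<in> carrier K" "r \<noteq> \<zero>"
  shows "single K a r \<otimes>\<^bsub>TA\<^esub> (\<lambda>M. inv (\<sigma> a M \<otimes> r) \<otimes> f (a + M)) = f"
    and "(\<lambda>M. inv (\<sigma> a M \<otimes> r) \<otimes> f (a + M)) \<in> carrier TA"
proof -
  have fA: "f \<in> carrier TA" using f by (simp add: multiples_of_all_vars_def)
  let ?w = "\<lambda>M. inv (\<sigma> a M \<otimes> r) \<otimes> f (a + M)"
  have u: "\<sigma> a M \<otimes> r \<in> Units K" for M
    using r by (simp add: field_Units integral_iff)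
  have wK: "?w M \<in> carrier K" for M using u fA by simp
  have "a \<subseteq># M" if "f M \<noteq> \<zero>" for M
  proof (rule mset_subset_eqI)
    fix i
    show "count a i \<le> count M i"
    proof (cases "i \<in> {1..n}")
      case True
      have "count a i \<le> size a" by (rule count_le_size)
      also have "\<dots> \<le> count M i" using f that True a(2) by (force simp: multiples_of_all_vars_def)
      finally show ?thesis .
    next
      case False
      then have "i \<notin># a" using a(1) by (auto simp: veronese_exponents_def)
      then show ?thesis by (simp add: not_in_iff)
    qed
  qed
  then have fz: "f M = \<zero>" if "\<not> a \<subseteq># M" for M using that by blast
  show "single K a r \<otimes>\<^bsub>TA\<^esub> ?w = f"
  proof
    fix M
    show "(single K a r \<otimes>\<^bsub>TA\<^esub> ?w) M = f M"
    proof (cases "a \<subseteq># M")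
      case True
      then obtain M' where M': "M = a + M'" by (metis subset_mset.add_diff_inverse)
      have i: "inv (\<sigma> a M' \<otimes> r) \<in> carrier K" and fc: "f (a + M') \<in> carrier K"
        using u[of M'] fA by simp_all
      have "(single K a r \<otimes>\<^bsub>TA\<^esub> ?w) M = \<sigma> a M' \<otimes> (r \<otimes> (inv (\<sigma> a M' \<otimes> r) \<otimes> f (a + M')))"
        unfolding M' by (rule single_mult_coeff(1)[OF r(1) wK])
      also have "\<dots> = (\<sigma> a M' \<otimes> r) \<otimes> inv (\<sigma> a M' \<otimes> r) \<otimes> f (a + M')"
        using m_assoc[OF q_pow(1) r(1) m_closed[OF i fc]] m_assoc[OF m_closed[OF q_pow(1) r(1)] i fc]
        by (simp only:)
      also have "\<dots> = f M" using u[of M'] fA by (simp add: M')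
      finally show ?thesis .
    next
      case False
      have "(single K a r \<otimes>\<^bsub>TA\<^esub> ?w) M = \<zero>"
        by (rule TA_mult_coeff_zero) (use r wK False in \<open>auto simp: single_def\<close>)
      then show ?thesis using fz[OF False] by simp
    qed
  qed
  show "?w \<in> carrier TA"
    unfolding TA_carrier_iff
  proof (intro conjI allI impI)
    have nz: "f (a + M) \<noteq> \<zero>" if "?w M \<noteq> \<zero>" for M using that u[of M] by auto
    have "(+) a ` {M. ?w M \<noteq> \<zero>} \<subseteq> {M. f M \<noteq> \<zero>}" using nz by blast
    then have "finite ((+) a ` {M. ?w M \<noteq> \<zero>})"
      by (rule finite_subset) (use fA in \<open>simp add: TA_carrier_iff\<close>)
    then show "finite {M. ?w M \<noteq> \<zero>}" by (rule finite_imageD) (simp add: inj_on_def)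
    fix M
    show "?w M \<in> carrier K" by (rule wK)
    assume "?w M \<noteq> \<zero>"
    then have "a + M \<in> veronese_exponents n v" using nz fA by (simp add: TA_carrier_iff)
    then show "M \<in> veronese_exponents n v"
      using a(1) by (auto simp: veronese_exponents_def dvd_add_right_iff)
  qed
qed

text \<open>
  Each variable divides \<open>p\<close>, so its \<open>N\<close>-th power divides the \<open>N\<close>-th power of \<open>p\<close>.  Passing to powers is necessary because
  the product of the variables need not lie in the Veronese subring.
\<close>

lemma conductor_power_divisible:
  assumes p: "p \<in> up TA" and pc: "\<And>k. p k \<in> central_conductor TA"
    and a: "a \<in> veronese_exponents n v" and r: "r \<in> carrier K" "r \<noteq> \<zero>"
  shows "\<exists>w\<in>up TA. p [^]\<^bsub>UP TA\<^esub> size a = up_const TA (single K a r) \<otimes>\<^bsub>UP TA\<^esub> w"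
proof -
  interpret A: ring TA by (rule ring_TA)
  interpret UPA: ring "UP TA" by (rule A.ring_UP)
  have pow: "p [^]\<^bsub>UP TA\<^esub> N \<in> up TA \<and> (\<forall>k. (p [^]\<^bsub>UP TA\<^esub> N) k \<in> multiples_of_all_vars N)" for N :: nat
  proof (induction N)
    case 0
    have "\<one>\<^bsub>TA\<^esub> \<in> multiples_of_all_vars 0" using A.one_closed by (simp add: multiples_of_all_vars_def)
    then show ?case
      using UPA.one_closed multiples_of_all_vars_closed(2)[of 0]
      by (simp add: A.UP_carrier A.UP_one_eq del: TA_simps) (simp add: up_const_def del: TA_simps)
  next
    case (Suc N)
    then have pN: "p [^]\<^bsub>UP TA\<^esub> N \<in> up TA" by blast
    have "(p [^]\<^bsub>UP TA\<^esub> Suc N) k \<in> multiples_of_all_vars (N + 1)" for k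
      unfolding UPA.nat_pow_Suc A.UP_mult_coeff[OF pN p]
      using Suc central_conductor_multiples[OF pc] multiples_of_all_vars_mult
      by (intro A.finsum_in_submonoid multiples_of_all_vars_closed) blast+
    moreover have "p [^]\<^bsub>UP TA\<^esub> Suc N \<in> up TA"
      using UPA.nat_pow_closed[of p "Suc N"] p unfolding A.UP_carrier by blast
    ultimately show ?case by simp
  qed
  define P where "P = p [^]\<^bsub>UP TA\<^esub> size a"
  have P: "P \<in> up TA" "\<And>k. P k \<in> multiples_of_all_vars (size a)" using pow[of "size a"] by (simp_all add: P_def)
  define w where "w k = (\<lambda>M. inv (\<sigma> a M \<otimes> r) \<otimes> P k (a + M))" for k
  note div = multiples_of_all_vars_divide[OF P(2) a order_refl r]
  have wA: "w k \<in> carrier TA" for k unfolding w_def by (rule div(2))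
  have u: "\<sigma> a M \<otimes> r \<in> Units K" for M using r by (simp add: field_Units integral_iff)
  have w: "w \<in> up TA"
  proof (rule mem_upI)
    show "w k \<in> carrier TA" for k by (rule wA)
    obtain b where b: "bound \<zero>\<^bsub>TA\<^esub> b P" using P(1) by (auto simp: up_def)
    have "bound \<zero>\<^bsub>TA\<^esub> b w"
      using bound.bound[OF b] u by (intro bound.intro) (simp add: w_def)
    then show "\<exists>b. bound \<zero>\<^bsub>TA\<^esub> b w" by blast
  qed
  have "P = up_const TA (single K a r) \<otimes>\<^bsub>UP TA\<^esub> w"
  proof
    fix k
    show "P k = (up_const TA (single K a r) \<otimes>\<^bsub>UP TA\<^esub> w) k"
      unfolding A.UP_const_mult[OF single_closed[OF a r(1)] w] unfolding w_def by (rule div(1)[symmetric])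
  qed
  then show ?thesis using w unfolding P_def by blast
qed

lemma veronese_model_cancels:
  assumes B: "assoc_algebra K B"
    and iso: "isomorphic_algebras K (poly_algebra TA) (poly_algebra B)"
  shows "isomorphic_algebras K TA B"
proof -
  obtain h where h: "h \<in> algebra_iso K (poly_algebra TA) (poly_algebra B)"
    using iso by (auto simp: isomorphic_algebras_def)
  then have hr: "h \<in> ring_iso (UP TA) (UP B)" unfolding algebra_iso_def ring_iso_poly_algebra by blast
  have ringB: "ring B" using B by (rule assoc_algebra.axioms(2))
  obtain z where z: "z \<in> central_conductor TA" "z \<noteq> \<zero>\<^bsub>TA\<^esub>" using central_conductor_nonzero by blast
  let ?G = "{single K a r | a r. a \<in> veronese_exponents n v \<and> r \<in> carrier K}"
  have "\<exists>f\<in>ring_iso TA B. \<forall>r\<in>carrier TA. h (up_const TA r) = up_const B (f r)"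
  proof (rule conductor_retraction[OF ring_TA ringB hr zero_divisor_free_TA z])
    show "carrier TA \<subseteq> T" if "?G \<subseteq> T" "\<And>x y. x \<in> T \<Longrightarrow> y \<in> T \<Longrightarrow> x \<oplus>\<^bsub>TA\<^esub> y \<in> T" for T
      by (rule TA_generated) (use that in blast)+
    show "?G \<subseteq> carrier TA" using single_closed by blast
    fix p g assume p: "p \<in> up TA" "\<And>k. p k \<in> central_conductor TA" and g: "g \<in> ?G"
    obtain a r where a: "g = single K a r" "a \<in> veronese_exponents n v" "r \<in> carrier K" using g by blast
    show "g = \<zero>\<^bsub>TA\<^esub> \<or> (\<exists>N::nat. \<exists>w\<in>up TA. p [^]\<^bsub>UP TA\<^esub> N = up_const TA g \<otimes>\<^bsub>UP TA\<^esub> w)"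
    proof (cases "r = \<zero>")
      case True
      then show ?thesis by (simp add: a single_def fun_eq_iff)
    next
      case False
      then show ?thesis using conductor_power_divisible[OF p a(2,3)] unfolding a(1) by blast
    qed
  qed
  then obtain f where f: "f \<in> ring_iso TA B" "\<forall>r\<in>carrier TA. h (up_const TA r) = up_const B (f r)" by blast
  show ?thesis
    by (rule isomorphic_algebras_if_constants_preserved[OF assoc_algebra_TA B h f])
qed

end

section \<open>Transport along isomorphisms\<close>

text \<open>
  A structure closed under its operations and mapped bijectively and compatibly onto an
  algebra is an algebra.  This yields the algebra axioms for the free algebra, the quantum
  polynomial ring and its Veronese subrings from those of twisted monoid algebras.
\<close>

lemma algebra_iso_induced:
  assumes M: "assoc_algebra K M" and bij: "bij_betw \<psi> (carrier A) (carrier M)"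
    and closed: "\<zero>\<^bsub>A\<^esub> \<in> carrier A" "\<one>\<^bsub>A\<^esub> \<in> carrier A"
      "\<And>x y. x \<in> carrier A \<Longrightarrow> y \<in> carrier A \<Longrightarrow> x \<oplus>\<^bsub>A\<^esub> y \<in> carrier A"
      "\<And>x y. x \<in> carrier A \<Longrightarrow> y \<in> carrier A \<Longrightarrow> x \<otimes>\<^bsub>A\<^esub> y \<in> carrier A"
      "\<And>c x. c \<in> carrier K \<Longrightarrow> x \<in> carrier A \<Longrightarrow> c \<odot>\<^bsub>A\<^esub> x \<in> carrier A"
    and hom: "\<psi> \<zero>\<^bsub>A\<^esub> = \<zero>\<^bsub>M\<^esub>" "\<psi> \<one>\<^bsub>A\<^esub> = \<one>\<^bsub>M\<^esub>"
      "\<And>x y. x \<in> carrier A \<Longrightarrow> y \<in> carrier A \<Longrightarrow> \<psi> (x \<oplus>\<^bsub>A\<^esub> y) = \<psi> x \<oplus>\<^bsub>M\<^esub> \<psi> y"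
      "\<And>x y. x \<in> carrier A \<Longrightarrow> y \<in> carrier A \<Longrightarrow> \<psi> (x \<otimes>\<^bsub>A\<^esub> y) = \<psi> x \<otimes>\<^bsub>M\<^esub> \<psi> y"
      "\<And>c x. c \<in> carrier K \<Longrightarrow> x \<in> carrier A \<Longrightarrow> \<psi> (c \<odot>\<^bsub>A\<^esub> x) = c \<odot>\<^bsub>M\<^esub> \<psi> x"
  shows "assoc_algebra K A" "\<psi> \<in> algebra_iso K A M"
proof -
  interpret M: assoc_algebra K M by fact
  have inj: "x = y" if "x \<in> carrier A" "y \<in> carrier A" "\<psi> x = \<psi> y" for x y
    using bij that unfolding bij_betw_def inj_on_def by blast
  have cl [simp]: "\<psi> x \<in> carrier M" if "x \<in> carrier A" for x using bij that by (auto simp: bij_betw_def)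
  have surj: "\<exists>x\<in>carrier A. \<psi> x = y" if "y \<in> carrier M" for y
  proof -
    have "y \<in> \<psi> ` carrier A" using bij that by (simp add: bij_betw_def)
    then show ?thesis by blast
  qed
  note [simp] = closed hom
  have ag: "abelian_group A"
  proof (rule abelian_groupI)
    fix x assume x: "x \<in> carrier A"
    obtain y where y: "y \<in> carrier A" "\<psi> y = \<ominus>\<^bsub>M\<^esub> \<psi> x" using surj[of "\<ominus>\<^bsub>M\<^esub> \<psi> x"] x by auto
    have "y \<oplus>\<^bsub>A\<^esub> x = \<zero>\<^bsub>A\<^esub>" by (rule inj) (use x y in \<open>simp_all add: M.l_neg\<close>)
    then show "\<exists>y\<in>carrier A. y \<oplus>\<^bsub>A\<^esub> x = \<zero>\<^bsub>A\<^esub>" using y by blast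
  qed (simp_all, (rule inj; simp add: M.a_ac)+)
  have mon: "Group.monoid A"
    by (rule monoidI; simp?) (rule inj; simp add: M.m_assoc)+
  show "assoc_algebra K A"
  proof (rule assoc_algebra.intro)
    show "module K A"
      by (rule moduleI[OF M.R.is_cring ag])
        (simp, (rule inj; simp add: M.smult_l_distr M.smult_r_distr M.smult_assoc1)+)
    show "ring A"
      by (rule ringI[OF ag mon]) (rule inj; simp add: M.l_distr M.r_distr)+
    show "assoc_algebra_axioms K A"
      by (rule assoc_algebra_axioms.intro)
        (rule inj; simp add: M.smult_mult_left M.smult_mult_right)+
  qed
  show "\<psi> \<in> algebra_iso K A M"
    unfolding algebra_iso_def ring_iso_def by (auto intro!: ring_hom_memI bij)
qed

lemma isomorphic_algebras_trans:
  "isomorphic_algebras K A B \<Longrightarrow> isomorphic_algebras K B C \<Longrightarrow> isomorphic_algebras K A C"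
proof -
  assume "isomorphic_algebras K A B" "isomorphic_algebras K B C"
  then obtain f g where f: "f \<in> algebra_iso K A B" and g: "g \<in> algebra_iso K B C"
    by (auto simp: isomorphic_algebras_def)
  have "g \<circ> f \<in> ring_iso A C" using f g by (auto simp: algebra_iso_def intro: ring_iso_set_trans)
  moreover have "(g \<circ> f) (c \<odot>\<^bsub>A\<^esub> x) = c \<odot>\<^bsub>C\<^esub> (g \<circ> f) x" if "c \<in> carrier K" "x \<in> carrier A" for c x
  proof -
    have "f x \<in> carrier B"
      using f that(2) unfolding algebra_iso_def ring_iso_def by (auto intro: ring_hom_closed)
    then show ?thesis using f g that by (simp add: algebra_iso_def)
  qed
  ultimately show "isomorphic_algebras K A C"
    unfolding isomorphic_algebras_def algebra_iso_def by blast
qed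

lemma isomorphic_algebras_sym:
  assumes A: "assoc_algebra K A" and iso: "isomorphic_algebras K A B"
  shows "isomorphic_algebras K B A"
proof -
  interpret A: assoc_algebra K A by fact
  obtain f where f: "f \<in> ring_iso A B" "\<And>c x. c \<in> carrier K \<Longrightarrow> x \<in> carrier A \<Longrightarrow> f (c \<odot>\<^bsub>A\<^esub> x) = c \<odot>\<^bsub>B\<^esub> f x"
    using iso by (auto simp: isomorphic_algebras_def algebra_iso_def)
  define g where "g = inv_into (carrier A) f"
  have bij: "bij_betw f (carrier A) (carrier B)" using f(1) by (simp add: ring_iso_def)
  have g: "g \<in> ring_iso B A" unfolding g_def by (rule ring_iso_set_sym[OF A.A.ring_axioms f(1)])
  have "g (c \<odot>\<^bsub>B\<^esub> y) = c \<odot>\<^bsub>A\<^esub> g y" if c: "c \<in> carrier K" and y: "y \<in> carrier B" for c y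
  proof -
    have gy: "g y \<in> carrier A" "f (g y) = y"
      using bij y by (auto simp: g_def bij_betw_def intro: inv_into_into f_inv_into_f)
    have "c \<odot>\<^bsub>B\<^esub> y = f (c \<odot>\<^bsub>A\<^esub> g y)" using f(2)[OF c gy(1)] gy(2) by simp
    then show ?thesis
      using bij c gy by (simp add: g_def bij_betw_def inv_into_f_f)
  qed
  then show ?thesis using g unfolding isomorphic_algebras_def algebra_iso_def by blast
qed

lemma isomorphic_poly_algebra:
  assumes A: "assoc_algebra K A" and B: "assoc_algebra K B" and iso: "isomorphic_algebras K A B"
  shows "isomorphic_algebras K (poly_algebra A) (poly_algebra B)"
proof -
  interpret A: assoc_algebra K A by fact
  interpret B: assoc_algebra K B by fact
  obtain f where f: "f \<in> ring_iso A B" "\<And>c x. c \<in> carrier K \<Longrightarrow> x \<in> carrier A \<Longrightarrow> f (c \<odot>\<^bsub>A\<^esub> x) = c \<odot>\<^bsub>B\<^esub> f x"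
    using iso by (auto simp: isomorphic_algebras_def algebra_iso_def)
  have fh: "f \<in> ring_hom A B" and bij: "bij_betw f (carrier A) (carrier B)"
    using f(1) by (simp_all add: ring_iso_def)
  interpret f: ring_hom_ring A B f
    by (rule ring_hom_ringI2[OF A.A.ring_axioms B.A.ring_axioms fh])
  define g where "g = inv_into (carrier A) f"
  have gf: "g (f x) = x" if "x \<in> carrier A" for x using bij that by (simp add: g_def bij_betw_def inv_into_f_f)
  have fg: "f (g y) = y" "g y \<in> carrier A" if "y \<in> carrier B" for y
    using bij that by (auto simp: g_def bij_betw_def intro: inv_into_into f_inv_into_f)
  have g0: "g \<zero>\<^bsub>B\<^esub> = \<zero>\<^bsub>A\<^esub>" using gf[of "\<zero>\<^bsub>A\<^esub>"] by simp
  let ?F = "\<lambda>p i. f (p i)" and ?G = "\<lambda>p i. g (p i)"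
  have FC: "?F p \<in> up B" if p: "p \<in> up A" for p
  proof (rule mem_upI)
    show "f (p k) \<in> carrier B" for k using p by (simp add: mem_upD)
    obtain b where b: "bound \<zero>\<^bsub>A\<^esub> b p" using p by (auto simp: up_def)
    show "\<exists>b. bound \<zero>\<^bsub>B\<^esub> b (?F p)" by (rule exI[of _ b]) (use bound.bound[OF b] in \<open>auto intro!: bound.intro\<close>)
  qed
  have GC: "?G p \<in> up A" if p: "p \<in> up B" for p
  proof (rule mem_upI)
    show "g (p k) \<in> carrier A" for k using p fg by (simp add: mem_upD)
    obtain b where b: "bound \<zero>\<^bsub>B\<^esub> b p" using p by (auto simp: up_def)
    show "\<exists>b. bound \<zero>\<^bsub>A\<^esub> b (?G p)" by (rule exI[of _ b]) (use bound.bound[OF b] g0 in \<open>auto intro!: bound.intro\<close>)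
  qed
  have UPA: "p \<in> up A \<Longrightarrow> q \<in> up A \<Longrightarrow> p \<otimes>\<^bsub>UP A\<^esub> q \<in> up A \<and> p \<oplus>\<^bsub>UP A\<^esub> q \<in> up A" for p q
    using ring.ring_simprules(1,5)[OF A.ring_UP, of p q] by (simp add: A.UP_carrier)
  have "?F \<in> ring_hom (UP A) (UP B)"
  proof (rule ring_hom_memI)
    fix p q assume "p \<in> carrier (UP A)" "q \<in> carrier (UP A)"
    then have p: "p \<in> up A" and q: "q \<in> up A" by (simp_all add: A.UP_carrier)
    show "?F p \<in> carrier (UP B)" using FC[OF p] by (simp add: B.UP_carrier)
    show "?F (p \<otimes>\<^bsub>UP A\<^esub> q) = ?F p \<otimes>\<^bsub>UP B\<^esub> ?F q"
    proof
      fix k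
      have "f ((p \<otimes>\<^bsub>UP A\<^esub> q) k) = (\<Oplus>\<^bsub>B\<^esub>i\<in>{..k}. f (p i \<otimes>\<^bsub>A\<^esub> q (k - i)))"
        unfolding A.UP_mult_coeff[OF p q]
        using f.hom_finsum[of "\<lambda>i. p i \<otimes>\<^bsub>A\<^esub> q (k - i)" "{..k}"] p q by (simp add: Pi_def mem_upD comp_def)
      also have "\<dots> = (\<Oplus>\<^bsub>B\<^esub>i\<in>{..k}. f (p i) \<otimes>\<^bsub>B\<^esub> f (q (k - i)))"
        by (rule B.finsum_cong') (use p q in \<open>auto simp: mem_upD\<close>)
      finally show "f ((p \<otimes>\<^bsub>UP A\<^esub> q) k) = (?F p \<otimes>\<^bsub>UP B\<^esub> ?F q) k"
        by (simp add: B.UP_mult_coeff[OF FC[OF p] FC[OF q]])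
    qed
    show "?F (p \<oplus>\<^bsub>UP A\<^esub> q) = ?F p \<oplus>\<^bsub>UP B\<^esub> ?F q"
      using p q by (auto simp: fun_eq_iff A.UP_add_coeff B.UP_add_coeff[OF FC FC] mem_upD)
  next
    show "?F \<one>\<^bsub>UP A\<^esub> = \<one>\<^bsub>UP B\<^esub>" by (auto simp: A.UP_one_eq B.UP_one_eq up_const_def fun_eq_iff)
  qed
  moreover have "bij_betw ?F (up A) (up B)"
    by (rule bij_betwI[where g = ?G]) (use FC GC gf fg in \<open>auto simp: mem_upD fun_eq_iff\<close>)
  ultimately have "?F \<in> ring_iso (poly_algebra A) (poly_algebra B)"
    unfolding ring_iso_poly_algebra by (simp add: ring_iso_def A.UP_carrier B.UP_carrier)
  moreover have "?F (c \<odot>\<^bsub>poly_algebra A\<^esub> p) = c \<odot>\<^bsub>poly_algebra B\<^esub> ?F p"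
    if "c \<in> carrier K" "p \<in> carrier (poly_algebra A)" for c p
    using that f(2) by (auto simp: poly_algebra_def UP_def fun_eq_iff mem_upD)
  ultimately show ?thesis unfolding isomorphic_algebras_def algebra_iso_def by blast
qed

lemma cancellative_if_isomorphic:
  fixes A :: "('k, 'a, 'r) module_scheme" and M :: "('k, 'c, 's) module_scheme"
  assumes A: "assoc_algebra K A" and M: "assoc_algebra K M" and iso: "isomorphic_algebras K A M"
    and M_cancel: "\<And>B :: ('k, 'b) module. assoc_algebra K B \<Longrightarrow>
      isomorphic_algebras K (poly_algebra M) (poly_algebra B) \<Longrightarrow> isomorphic_algebras K M B"
  shows "cancellative TYPE('b) K A"
  unfolding cancellative_def
proof (intro conjI allI impI A)
  fix B :: "('k, 'b) module"
  assume B: "assoc_algebra K B" and AB: "isomorphic_algebras K (poly_algebra A) (poly_algebra B)"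
  have "isomorphic_algebras K (poly_algebra M) (poly_algebra A)"
    by (rule isomorphic_poly_algebra[OF M A isomorphic_algebras_sym[OF A iso]])
  then have "isomorphic_algebras K (poly_algebra M) (poly_algebra B)"
    using AB by (rule isomorphic_algebras_trans)
  then have "isomorphic_algebras K M B" by (rule M_cancel[OF B])
  then show "isomorphic_algebras K A B" by (rule isomorphic_algebras_trans[OF iso])
qed

section \<open>Normal forms in the quantum polynomial ring\<close>

text \<open>
  Modulo the quantum relations a word equals its sorted word times \<open>q\<close> to this power.
\<close>

fun inversions :: "nat list \<Rightarrow> nat"
  where
    "inversions [] = 0"
  | "inversions (a # w) = length (filter (\<lambda>b. b < a) w) + inversions w"

lemma inversions_append:
  "inversions (u @ w) = inversions u + inversions w + reorder_exponent (mset u) (mset w)"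
proof (induction u)
  case (Cons a u)
  have "reorder_exponent {#a#} (mset w) = length (filter (\<lambda>b. b < a) w)"
    by (simp add: reorder_exponent_def flip: mset_filter)
  then show ?case using Cons reorder_exponent_simps(3)[of "{#a#}" "mset u" "mset w"] by simp
qed simp

lemma inversions_sorted: "sorted w \<Longrightarrow> inversions w = 0"
  by (induction w) (auto simp: filter_empty_conv)

lemma append_factorizations:
  "{p. fst p @ snd p = w} = (\<lambda>i. (take i w, drop i w)) ` {..length w}"
proof (intro equalityI subsetI)
  fix p assume "p \<in> {p. fst p @ snd p = w}"
  then have "p = (take (length (fst p)) w, drop (length (fst p)) w)" "length (fst p) \<le> length w"
    by (auto simp: prod_eq_iff)
  then show "p \<in> (\<lambda>i. (take i w, drop i w)) ` {..length w}" by blast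
qed auto

locale quantum_presentation = K?: field K
  for K :: "('k, 'm) ring_scheme" (structure) and q :: 'k and n v :: nat +
  assumes q: "q \<in> carrier K" "q \<noteq> \<zero>"
begin

\<comment> \<open>Otherwise the simplifier turns \<open>{1..n}\<close> into \<open>{Suc 0..n}\<close>.\<close>
declare One_nat_def [simp del]

sublocale Q: quantum_exponents K q n 1 by unfold_locales (rule q)+

sublocale V: quantum_exponents K q n v by unfold_locales (rule q)+

sublocale W: twisted_monoid K "(@)" "[]" "\<lambda>_ _. \<one>" "lists {1..n}"
proof
  show "finite {p. fst p @ snd p = (c :: nat list)}" for c
  proof (rule finite_subset)
    show "{p. fst p @ snd p = c} \<subseteq> (\<lambda>i. (take i c, drop i c)) ` {..length c}"
      by (simp add: append_factorizations)
  qed simp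
qed auto

abbreviation F where "F \<equiv> free_algebra K {1..n}"

lemma free_algebra_simps:
  "carrier F = carrier W.TA" "\<one>\<^bsub>F\<^esub> = \<one>\<^bsub>W.TA\<^esub>" "\<zero>\<^bsub>F\<^esub> = \<zero>\<^bsub>W.TA\<^esub>"
  "f \<oplus>\<^bsub>F\<^esub> g = f \<oplus>\<^bsub>W.TA\<^esub> g" "c \<odot>\<^bsub>F\<^esub> f = c \<odot>\<^bsub>W.TA\<^esub> f"
  unfolding free_algebra_def twisted_algebra_def
  by (simp_all only: partial_object.simps monoid.simps ring.simps module.simps)

lemma free_algebra_mult:
  assumes f: "f \<in> carrier F" and g: "g \<in> carrier F"
  shows "f \<otimes>\<^bsub>F\<^esub> g = f \<otimes>\<^bsub>W.TA\<^esub> g"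
proof
  fix w :: "nat list"
  let ?c = "\<lambda>i. (take i w, drop i w)"
  have fc: "f u \<in> carrier K" for u using f unfolding free_algebra_simps by (rule W.TA_coeff)
  have gc: "g u \<in> carrier K" for u using g unfolding free_algebra_simps by (rule W.TA_coeff)
  have inj: "inj_on ?c {..length w}"
  proof (rule inj_onI)
    fix i j assume "i \<in> {..length w}" "j \<in> {..length w}" "?c i = ?c j"
    then have "length (take i w) = length (take j w)" by simp
    then show "i = j" using \<open>i \<in> _\<close> \<open>j \<in> _\<close> by simp
  qed
  have "(f \<otimes>\<^bsub>W.TA\<^esub> g) w = (\<Oplus>p\<in>?c ` {..length w}. \<one> \<otimes> (f (fst p) \<otimes> g (snd p)))"
    unfolding append_factorizations[symmetric] by (rule W.TA_mult_coeff)
  also have "\<dots> = (\<Oplus>i\<in>{..length w}. \<one> \<otimes> (f (fst (?c i)) \<otimes> g (snd (?c i))))"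
    by (rule finsum_reindex[OF _ inj]) (simp add: fc gc)
  also have "\<dots> = (\<Oplus>i\<in>{..length w}. f (take i w) \<otimes> g (drop i w))"
    by (rule finsum_cong') (simp_all add: fc gc)
  also have "\<dots> = (f \<otimes>\<^bsub>F\<^esub> g) w" by (simp add: free_algebra_def)
  finally show "(f \<otimes>\<^bsub>F\<^esub> g) w = (f \<otimes>\<^bsub>W.TA\<^esub> g) w" by (rule sym)
qed

lemma assoc_algebra_free: "assoc_algebra K F"
proof (rule algebra_iso_induced(1)[OF W.assoc_algebra_TA, of id])
qed (use ring.ring_simprules(1,2,5,6)[OF W.ring_TA]
    module.smult_closed[OF assoc_algebra.axioms(1)[OF W.assoc_algebra_TA]]
  in \<open>simp_all add: free_algebra_simps free_algebra_mult del: W.TA_simps\<close>)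

sublocale F: assoc_algebra K F by (rule assoc_algebra_free)

end

context quantum_presentation
begin

abbreviation I where "I \<equiv> quantum_ideal K q n"

text \<open>
  The linear map from the free algebra to the quantum monomials that sends a word \<open>w\<close> to the
  monomial \<open>mset w\<close> times \<open>q\<close> to the power \<open>inversions w\<close>; the coefficient at \<open>M\<close> collects the
  rearrangements of \<open>M\<close>.
\<close>

definition normal_form where
  "normal_form f = (\<lambda>M. \<Oplus>w\<in>permutations_of_multiset M. q [^] inversions w \<otimes> f w)"

text \<open>
  The section of \<open>normal_form\<close> that reads a monomial as its sorted word.
\<close>

definition sorted_lift :: "(nat multiset \<Rightarrow> 'k) \<Rightarrow> nat list \<Rightarrow> 'k" where
  "sorted_lift g = (\<lambda>w. if sorted w then g (mset w) else \<zero>)"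

lemma perm_iff: "w \<in> permutations_of_multiset M \<longleftrightarrow> mset w = M"
  by (simp add: permutations_of_multiset_def)

lemma normal_form_single:
  assumes c: "c \<in> carrier K"
  shows "normal_form (single K w c) = single K (mset w) (q [^] inversions w \<otimes> c)"
proof
  fix M
  have "normal_form (single K w c) M
    = (\<Oplus>u\<in>permutations_of_multiset M. if w = u then q [^] inversions u \<otimes> c else \<zero>)"
    unfolding normal_form_def by (rule finsum_cong') (use c in \<open>auto simp: single_def\<close>)
  also have "\<dots> = single K (mset w) (q [^] inversions w \<otimes> c) M"
  proof (cases "mset w = M")
    case True
    then have "w \<in> permutations_of_multiset M" by (simp add: perm_iff)
    then have "(\<Oplus>u\<in>permutations_of_multiset M. if w = u then q [^] inversions u \<otimes> c else \<zero>) = q [^] inversions w \<otimes> c"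
      using c by (intro finsum_singleton) auto
    then show ?thesis using True by (simp add: single_def)
  next
    case False
    have "(\<Oplus>u\<in>permutations_of_multiset M. if w = u then q [^] inversions u \<otimes> c else \<zero>)
      = (\<Oplus>u\<in>permutations_of_multiset M. \<zero>)"
      by (rule finsum_cong') (use False in \<open>auto simp: perm_iff\<close>)
    then show ?thesis using False by (simp add: single_def)
  qed
  finally show "normal_form (single K w c) M = single K (mset w) (q [^] inversions w \<otimes> c) M" .
qed

lemma free_coeff: "f \<in> carrier F \<Longrightarrow> f w \<in> carrier K"
  unfolding free_algebra_simps by (rule W.TA_coeff)

lemma free_add: "f \<oplus>\<^bsub>F\<^esub> g = (\<lambda>w. f w \<oplus> g w)"
  by (simp add: free_algebra_simps(4))

lemma free_add_closed: "f \<in> carrier F \<Longrightarrow> g \<in> carrier F \<Longrightarrow> f \<oplus>\<^bsub>F\<^esub> g \<in> carrier F"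
  using ring.ring_simprules(1)[OF F.A.ring_axioms] .

lemma free_smult: "c \<odot>\<^bsub>F\<^esub> f = (\<lambda>w. c \<otimes> f w)"
  by (simp add: free_algebra_simps(5))

lemma free_single_closed: "w \<in> lists {1..n} \<Longrightarrow> c \<in> carrier K \<Longrightarrow> single K w c \<in> carrier F"
  unfolding free_algebra_simps by (rule W.single_closed)

lemma free_single_mult:
  assumes "u \<in> lists {1..n}" "w \<in> lists {1..n}" "c \<in> carrier K" "d \<in> carrier K"
  shows "single K u c \<otimes>\<^bsub>F\<^esub> single K w d = single K (u @ w) (c \<otimes> d)"
  using free_algebra_mult[OF free_single_closed[OF assms(1,3)] free_single_closed[OF assms(2,4)]]
    W.single_mult_single[OF assms(3,4)] assms by simp

lemma free_generated:
  assumes "\<And>w c. w \<in> lists {1..n} \<Longrightarrow> c \<in> carrier K \<Longrightarrow> single K w c \<in> T"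
    and "\<And>f g. f \<in> T \<Longrightarrow> g \<in> T \<Longrightarrow> f \<oplus>\<^bsub>F\<^esub> g \<in> T"
  shows "carrier F \<subseteq> T"
  unfolding free_algebra_simps(1)
  by (rule W.TA_generated) (use assms in \<open>simp_all only: free_algebra_simps(4)\<close>)

lemma normal_form_add:
  assumes "f \<in> carrier F" "g \<in> carrier F"
  shows "normal_form (f \<oplus>\<^bsub>F\<^esub> g) = normal_form f \<oplus>\<^bsub>Q.TA\<^esub> normal_form g"
proof
  fix M
  have fg: "f w \<in> carrier K" "g w \<in> carrier K" for w using assms by (simp_all add: free_coeff)
  have "normal_form (f \<oplus>\<^bsub>F\<^esub> g) M
    = (\<Oplus>w\<in>permutations_of_multiset M. q [^] inversions w \<otimes> f w \<oplus> q [^] inversions w \<otimes> g w)"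
    unfolding normal_form_def free_add by (rule finsum_cong') (use fg in \<open>auto simp: r_distr\<close>)
  also have "\<dots> = normal_form f M \<oplus> normal_form g M"
    unfolding normal_form_def by (rule finsum_addf) (use fg in auto)
  finally show "normal_form (f \<oplus>\<^bsub>F\<^esub> g) M = (normal_form f \<oplus>\<^bsub>Q.TA\<^esub> normal_form g) M" by simp
qed

lemma normal_form_smult:
  assumes "f \<in> carrier F" "c \<in> carrier K"
  shows "normal_form (c \<odot>\<^bsub>F\<^esub> f) = c \<odot>\<^bsub>Q.TA\<^esub> normal_form f"
proof
  fix M
  have f: "f w \<in> carrier K" for w using assms by (simp add: free_coeff)
  have "c \<otimes> normal_form f M = (\<Oplus>w\<in>permutations_of_multiset M. c \<otimes> (q [^] inversions w \<otimes> f w))"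
    unfolding normal_form_def by (rule finsum_rdistr) (use f assms in auto)
  also have "\<dots> = normal_form (c \<odot>\<^bsub>F\<^esub> f) M"
    unfolding normal_form_def free_smult by (rule finsum_cong') (use f assms in \<open>auto simp: m_lcomm\<close>)
  finally show "normal_form (c \<odot>\<^bsub>F\<^esub> f) M = (c \<odot>\<^bsub>Q.TA\<^esub> normal_form f) M" by simp
qed

lemma lists_exponents: "w \<in> lists {1..n} \<longleftrightarrow> mset w \<in> veronese_exponents n 1"
  by (auto simp: veronese_exponents_def)

lemma normal_form_closed: "f \<in> carrier F \<Longrightarrow> normal_form f \<in> carrier Q.TA"
proof -
  let ?T = "{f \<in> carrier F. normal_form f \<in> carrier Q.TA}"
  have "carrier F \<subseteq> ?T"
  proof (rule free_generated)
    fix w c assume "w \<in> lists {1..n}" "c \<in> carrier K"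
    then show "single K w c \<in> ?T"
      by (simp add: free_single_closed normal_form_single Q.single_closed lists_exponents del: in_lists_conv_set)
  next
    fix f g assume "f \<in> ?T" "g \<in> ?T"
    then show "f \<oplus>\<^bsub>F\<^esub> g \<in> ?T"
      using Q.TA_add_closed[of "normal_form f" "normal_form g"] by (simp add: normal_form_add)
  qed
  then show "f \<in> carrier F \<Longrightarrow> normal_form f \<in> carrier Q.TA" by blast
qed

text \<open>
  By additivity in both arguments it suffices to consider two words, where the claim is
  \<open>inversions_append\<close>.
\<close>

lemma normal_form_mult:
  assumes f: "f \<in> carrier F" and g: "g \<in> carrier F"
  shows "normal_form (f \<otimes>\<^bsub>F\<^esub> g) = normal_form f \<otimes>\<^bsub>Q.TA\<^esub> normal_form g"
proof -
  interpret QT: ring Q.TA by (rule Q.ring_TA)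
  let ?U = "\<lambda>f. {g \<in> carrier F. normal_form (f \<otimes>\<^bsub>F\<^esub> g) = normal_form f \<otimes>\<^bsub>Q.TA\<^esub> normal_form g}"
  have single: "carrier F \<subseteq> ?U (single K u c)" if u: "u \<in> lists {1..n}" "c \<in> carrier K" for u c
  proof (rule free_generated)
    fix w d assume w: "w \<in> lists {1..n}" "d \<in> carrier K"
    have "q [^] inversions (u @ w) \<otimes> (c \<otimes> d)
      = q [^] reorder_exponent (mset u) (mset w) \<otimes> ((q [^] inversions u \<otimes> c) \<otimes> (q [^] inversions w \<otimes> d))"
      using u w q by (simp add: inversions_append m_ac flip: nat_pow_mult)
    then show "single K w d \<in> ?U (single K u c)"
      using u w by (simp add: free_single_closed free_single_mult normal_form_single Q.single_mult_single
          del: in_lists_conv_set)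
  next
    fix g h assume g: "g \<in> ?U (single K u c)" and h: "h \<in> ?U (single K u c)"
    have s: "single K u c \<in> carrier F" by (rule free_single_closed[OF u])
    have gh: "g \<in> carrier F" "h \<in> carrier F" using g h by blast+
    have "normal_form (single K u c \<otimes>\<^bsub>F\<^esub> (g \<oplus>\<^bsub>F\<^esub> h))
      = normal_form (single K u c \<otimes>\<^bsub>F\<^esub> g) \<oplus>\<^bsub>Q.TA\<^esub> normal_form (single K u c \<otimes>\<^bsub>F\<^esub> h)"
      unfolding F.A.r_distr[OF gh s] by (rule normal_form_add[OF F.A.m_closed[OF s gh(1)] F.A.m_closed[OF s gh(2)]])
    also have "\<dots> = normal_form (single K u c) \<otimes>\<^bsub>Q.TA\<^esub> normal_form (g \<oplus>\<^bsub>F\<^esub> h)"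
      unfolding normal_form_add[OF gh]
        QT.r_distr[OF normal_form_closed[OF gh(1)] normal_form_closed[OF gh(2)] normal_form_closed[OF s]]
      using g h by (simp del: Q.TA_simps)
    finally show "g \<oplus>\<^bsub>F\<^esub> h \<in> ?U (single K u c)" using free_add_closed[OF gh] by blast
  qed
  let ?T = "{f \<in> carrier F. \<forall>g\<in>carrier F. normal_form (f \<otimes>\<^bsub>F\<^esub> g) = normal_form f \<otimes>\<^bsub>Q.TA\<^esub> normal_form g}"
  have "carrier F \<subseteq> ?T"
  proof (rule free_generated)
    fix w c assume "w \<in> lists {1..n}" "c \<in> carrier K"
    from single[OF this] free_single_closed[OF this] show "single K w c \<in> ?T" by blast
  next
    fix f h assume f: "f \<in> ?T" and h: "h \<in> ?T"
    have fh: "f \<in> carrier F" "h \<in> carrier F" using f h by blast+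
    have "normal_form ((f \<oplus>\<^bsub>F\<^esub> h) \<otimes>\<^bsub>F\<^esub> g) = normal_form (f \<oplus>\<^bsub>F\<^esub> h) \<otimes>\<^bsub>Q.TA\<^esub> normal_form g"
      if g: "g \<in> carrier F" for g
    proof -
      have "normal_form ((f \<oplus>\<^bsub>F\<^esub> h) \<otimes>\<^bsub>F\<^esub> g)
        = normal_form (f \<otimes>\<^bsub>F\<^esub> g) \<oplus>\<^bsub>Q.TA\<^esub> normal_form (h \<otimes>\<^bsub>F\<^esub> g)"
        unfolding F.A.l_distr[OF fh g] by (rule normal_form_add[OF F.A.m_closed[OF fh(1) g] F.A.m_closed[OF fh(2) g]])
      also have "\<dots> = normal_form (f \<oplus>\<^bsub>F\<^esub> h) \<otimes>\<^bsub>Q.TA\<^esub> normal_form g"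
        unfolding normal_form_add[OF fh]
          QT.l_distr[OF normal_form_closed[OF fh(1)] normal_form_closed[OF fh(2)] normal_form_closed[OF g]]
        using f h g by (simp del: Q.TA_simps)
      finally show ?thesis .
    qed
    then show "f \<oplus>\<^bsub>F\<^esub> h \<in> ?T" using free_add_closed[OF fh] by blast
  qed
  then show ?thesis using f g by blast
qed

lemma free_one: "\<one>\<^bsub>F\<^esub> = single K [] \<one>"
  by (simp add: free_algebra_simps(2))

lemma normal_form_hom: "ring_hom_ring F Q.TA normal_form"
proof (rule ring_hom_ringI2[OF F.A.ring_axioms Q.ring_TA], rule ring_hom_memI)
  show "normal_form \<one>\<^bsub>F\<^esub> = \<one>\<^bsub>Q.TA\<^esub>" by (simp add: free_one normal_form_single)
qed (simp_all only: normal_form_closed normal_form_mult normal_form_add)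

lemma sorted_lift_single: "sorted_lift (single K M c) = single K (sorted_list_of_multiset M) c"
  by (auto simp: sorted_lift_def single_def fun_eq_iff sorted_sort_id mset_eq_setD dest: sym)

lemma sorted_lift_normal_form_inverse:
  assumes "g \<in> carrier Q.TA"
  shows "sorted_lift g \<in> carrier F" "normal_form (sorted_lift g) = g"
proof -
  have add: "sorted_lift (f \<oplus>\<^bsub>Q.TA\<^esub> g) = sorted_lift f \<oplus>\<^bsub>F\<^esub> sorted_lift g" for f g
    by (simp add: free_add sorted_lift_def fun_eq_iff)
  let ?T = "{g \<in> carrier Q.TA. sorted_lift g \<in> carrier F \<and> normal_form (sorted_lift g) = g}"
  have "carrier Q.TA \<subseteq> ?T"
  proof (rule Q.TA_generated)
    fix M c assume M: "M \<in> veronese_exponents n 1" and c: "c \<in> carrier K"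
    have l: "sorted_list_of_multiset M \<in> lists {1..n}" using M by (simp only: lists_exponents mset_sorted_list_of_multiset)
    show "single K M c \<in> ?T"
      using Q.single_closed[OF M c] free_single_closed[OF l c] c
      by (simp add: sorted_lift_single normal_form_single inversions_sorted)
  next
    fix f g assume f: "f \<in> ?T" and g: "g \<in> ?T"
    then have "sorted_lift f \<in> carrier F" "sorted_lift g \<in> carrier F" by blast+
    note normal_form_add[OF this] free_add_closed[OF this]
    moreover have "f \<oplus>\<^bsub>Q.TA\<^esub> g \<in> carrier Q.TA"
      using f g ring.ring_simprules(1)[OF Q.ring_TA, of f g] by blast
    ultimately show "f \<oplus>\<^bsub>Q.TA\<^esub> g \<in> ?T" using f g by (simp add: add del: Q.TA_simps)
  qed
  then show "sorted_lift g \<in> carrier F" "normal_form (sorted_lift g) = g" using assms by blast+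
qed

end

context quantum_presentation
begin

lemma quantum_relations_closed:
  "{free_gen K j \<otimes>\<^bsub>F\<^esub> free_gen K i \<ominus>\<^bsub>F\<^esub> q \<odot>\<^bsub>F\<^esub> (free_gen K i \<otimes>\<^bsub>F\<^esub> free_gen K j) | i j. 1 \<le> i \<and> i < j \<and> j \<le> n}
    \<subseteq> carrier F" (is "?R \<subseteq> _")
proof
  fix r assume "r \<in> ?R"
  then obtain i j where ij: "1 \<le> i" "i < j" "j \<le> n"
    and r: "r = free_gen K j \<otimes>\<^bsub>F\<^esub> free_gen K i \<ominus>\<^bsub>F\<^esub> q \<odot>\<^bsub>F\<^esub> (free_gen K i \<otimes>\<^bsub>F\<^esub> free_gen K j)" by blast
  have "free_gen K k \<in> carrier F" if "k \<in> {1..n}" for k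
    using free_single_closed[of "[k]" \<one>] that by (simp add: free_gen_def single_def)
  then show "r \<in> carrier F" unfolding r using ij q by (intro abelian_group.minus_closed[OF ring.is_abelian_group[OF F.A.ring_axioms]] F.A.m_closed F.smult_closed) auto
qed

lemma quantum_ideal_ideal: "ideal I F"
  unfolding quantum_ideal_def Let_def by (rule F.A.genideal_ideal[OF quantum_relations_closed])

sublocale I: ideal I F by (rule quantum_ideal_ideal)

abbreviation coset where "coset f \<equiv> I +>\<^bsub>F\<^esub> f"

lemma coset_eq_iff:
  "f \<in> carrier F \<Longrightarrow> g \<in> carrier F \<Longrightarrow> coset f = coset g \<longleftrightarrow> f \<ominus>\<^bsub>F\<^esub> g \<in> I"
  using F.A.quotient_eq_iff_same_a_r_cos[OF quantum_ideal_ideal] by blast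

lemma coset_mult:
  "f \<in> carrier F \<Longrightarrow> g \<in> carrier F \<Longrightarrow> coset (f \<otimes>\<^bsub>F\<^esub> g) = coset f \<otimes>\<^bsub>F Quot I\<^esub> coset g"
  using ring_hom_mult[OF I.rcos_ring_hom] by blast

lemma coset_add:
  "f \<in> carrier F \<Longrightarrow> g \<in> carrier F \<Longrightarrow> coset (f \<oplus>\<^bsub>F\<^esub> g) = coset f \<oplus>\<^bsub>F Quot I\<^esub> coset g"
  using ring_hom_add[OF I.rcos_ring_hom] by blast

lemma free_gen_single: "free_gen K k = single K [k] \<one>"
  by (simp add: free_gen_def single_def)

lemma quantum_relation:
  assumes "1 \<le> i" "i < j" "j \<le> n"
  shows "free_gen K j \<otimes>\<^bsub>F\<^esub> free_gen K i \<ominus>\<^bsub>F\<^esub> q \<odot>\<^bsub>F\<^esub> (free_gen K i \<otimes>\<^bsub>F\<^esub> free_gen K j) \<in> I"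
proof -
  have "{free_gen K j \<otimes>\<^bsub>F\<^esub> free_gen K i \<ominus>\<^bsub>F\<^esub> q \<odot>\<^bsub>F\<^esub> (free_gen K i \<otimes>\<^bsub>F\<^esub> free_gen K j) | i j. 1 \<le> i \<and> i < j \<and> j \<le> n} \<subseteq> I"
    unfolding quantum_ideal_def Let_def by (rule F.A.genideal_self[OF quantum_relations_closed])
  then show ?thesis using assms by blast
qed

lemma coset_swap:
  assumes "1 \<le> i" "i < j" "j \<le> n"
  shows "coset (single K [j, i] \<one>) = coset (single K [i, j] q)"
proof -
  have l: "[i] \<in> lists {1..n}" "[j] \<in> lists {1..n}" "[i, j] \<in> lists {1..n}" "[j, i] \<in> lists {1..n}"
    using assms by auto
  have "free_gen K j \<otimes>\<^bsub>F\<^esub> free_gen K i = single K [j, i] \<one>"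
    unfolding free_gen_single free_single_mult[OF l(2,1) one_closed one_closed] by simp
  moreover have "q \<odot>\<^bsub>F\<^esub> (free_gen K i \<otimes>\<^bsub>F\<^esub> free_gen K j) = single K [i, j] q"
    unfolding free_gen_single free_single_mult[OF l(1,2) one_closed one_closed] free_smult
    using q by (auto simp: single_def fun_eq_iff)
  ultimately show ?thesis
    using quantum_relation[OF assms] coset_eq_iff[OF free_single_closed[OF l(4)] free_single_closed[OF l(3)]] q
    by simp
qed

text \<open>
  Insertion sort modulo the relations: \<open>x\<^sub>a\<close> moves past each smaller letter at the cost of a factor \<open>q\<close>.
\<close>

lemma coset_insort:
  assumes "a \<in> {1..n}" "u \<in> lists {1..n}" "sorted u" "c \<in> carrier K"
  shows "coset (single K (a # u) c) = coset (single K (insort a u) (q [^] length (filter (\<lambda>b. b < a) u) \<otimes> c))"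
  using assms(2,3,4)
proof (induction u arbitrary: c rule: list.induct)
  case Nil
  then show ?case by simp
next
  case (Cons b u)
  have b: "b \<in> {1..n}" and u: "u \<in> lists {1..n}" "sorted u" using Cons.prems by auto
  have c: "c \<in> carrier K" by fact
  show ?case
  proof (cases "a \<le> b")
    case True
    then have "filter (\<lambda>d. d < a) (b # u) = []" using Cons.prems(2) by (auto simp: filter_empty_conv)
    then show ?thesis using True c by simp
  next
    case False
    then have ba: "b < a" by simp
    let ?k = "length (filter (\<lambda>d. d < a) u)"
    have l: "[a, b] \<in> lists {1..n}" "[b, a] \<in> lists {1..n}" "[b] \<in> lists {1..n}"
      "a # u \<in> lists {1..n}" "insort a u \<in> lists {1..n}"
      using b u(1) assms(1) by (auto simp: in_lists_conv_set set_insort_key)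
    have qc: "q \<otimes> c \<in> carrier K" "q [^] ?k \<otimes> (q \<otimes> c) \<in> carrier K" using q c by simp_all
    have "coset (single K (a # b # u) c) = coset (single K [a, b] \<one> \<otimes>\<^bsub>F\<^esub> single K u c)"
      using free_single_mult[OF l(1) u(1) one_closed c] c by simp
    also have "\<dots> = coset (single K [b, a] q) \<otimes>\<^bsub>F Quot I\<^esub> coset (single K u c)"
      using coset_mult[OF free_single_closed[OF l(1) one_closed] free_single_closed[OF u(1) c]]
        coset_swap[of b a] b assms(1) ba by simp
    also have "\<dots> = coset (single K [b, a] q \<otimes>\<^bsub>F\<^esub> single K u c)"
      using coset_mult[OF free_single_closed[OF l(2) q(1)] free_single_closed[OF u(1) c]] by simp
    also have "single K [b, a] q \<otimes>\<^bsub>F\<^esub> single K u c = single K [b] \<one> \<otimes>\<^bsub>F\<^esub> single K (a # u) (q \<otimes> c)"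
      using free_single_mult[OF l(2) u(1) q(1) c] free_single_mult[OF l(3,4) one_closed qc(1)] qc by simp
    also have "coset \<dots> = coset (single K [b] \<one>) \<otimes>\<^bsub>F Quot I\<^esub> coset (single K (a # u) (q \<otimes> c))"
      by (rule coset_mult[OF free_single_closed[OF l(3) one_closed] free_single_closed[OF l(4) qc(1)]])
    also have "\<dots> = coset (single K [b] \<one>) \<otimes>\<^bsub>F Quot I\<^esub> coset (single K (insort a u) (q [^] ?k \<otimes> (q \<otimes> c)))"
      using Cons.IH[OF u qc(1)] by simp
    also have "\<dots> = coset (single K [b] \<one> \<otimes>\<^bsub>F\<^esub> single K (insort a u) (q [^] ?k \<otimes> (q \<otimes> c)))"
      using coset_mult[OF free_single_closed[OF l(3) one_closed] free_single_closed[OF l(5) qc(2)]] by simp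
    also have "single K [b] \<one> \<otimes>\<^bsub>F\<^esub> single K (insort a u) (q [^] ?k \<otimes> (q \<otimes> c))
      = single K (b # insort a u) (q [^] Suc ?k \<otimes> c)"
      using free_single_mult[OF l(3,5) one_closed qc(2)] q c qc by (simp add: m_assoc)
    finally show ?thesis using False ba by simp
  qed
qed

lemma coset_sort:
  assumes "w \<in> lists {1..n}" "c \<in> carrier K"
  shows "coset (single K w c) = coset (single K (sort w) (q [^] inversions w \<otimes> c))"
  using assms
proof (induction w arbitrary: c rule: list.induct)
  case Nil
  then show ?case by simp
next
  case (Cons a w)
  have a: "a \<in> {1..n}" "[a] \<in> lists {1..n}" and w: "w \<in> lists {1..n}" "sort w \<in> lists {1..n}"
    using Cons.prems by auto
  have c: "c \<in> carrier K" "q [^] inversions w \<otimes> c \<in> carrier K" using Cons.prems q by simp_all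
  let ?k = "length (filter (\<lambda>b. b < a) w)"
  have k: "length (filter (\<lambda>b. b < a) (sort w)) = ?k"
    by (metis mset_filter mset_sort size_mset)
  have "coset (single K (a # w) c) = coset (single K [a] \<one> \<otimes>\<^bsub>F\<^esub> single K w c)"
    using free_single_mult[OF a(2) w(1) one_closed c(1)] c by simp
  also have "\<dots> = coset (single K [a] \<one>) \<otimes>\<^bsub>F Quot I\<^esub> coset (single K (sort w) (q [^] inversions w \<otimes> c))"
    using coset_mult[OF free_single_closed[OF a(2) one_closed] free_single_closed[OF w(1) c(1)]]
      Cons.IH[OF w(1) c(1)] by simp
  also have "\<dots> = coset (single K [a] \<one> \<otimes>\<^bsub>F\<^esub> single K (sort w) (q [^] inversions w \<otimes> c))"
    using coset_mult[OF free_single_closed[OF a(2) one_closed] free_single_closed[OF w(2) c(2)]] by simp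
  also have "\<dots> = coset (single K (a # sort w) (q [^] inversions w \<otimes> c))"
    using free_single_mult[OF a(2) w(2) one_closed c(2)] c by simp
  also have "\<dots> = coset (single K (insort a (sort w)) (q [^] ?k \<otimes> (q [^] inversions w \<otimes> c)))"
    using coset_insort[OF a(1) w(2) sorted_sort c(2)] unfolding k .
  also have "q [^] ?k \<otimes> (q [^] inversions w \<otimes> c) = q [^] inversions (a # w) \<otimes> c"
    using q c by (simp add: m_assoc flip: nat_pow_mult)
  finally show ?case by simp
qed

lemma coset_normal_form:
  assumes "f \<in> carrier F"
  shows "coset f = coset (sorted_lift (normal_form f))"
proof -
  have lift: "sorted_lift (normal_form f) \<in> carrier F" if "f \<in> carrier F" for f
    by (rule sorted_lift_normal_form_inverse(1)[OF normal_form_closed[OF that]])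
  let ?T = "{f \<in> carrier F. coset f = coset (sorted_lift (normal_form f))}"
  have "carrier F \<subseteq> ?T"
  proof (rule free_generated)
    fix w c assume w: "w \<in> lists {1..n}" "c \<in> carrier K"
    show "single K w c \<in> ?T"
      using free_single_closed[OF w] coset_sort[OF w]
      by (simp add: normal_form_single[OF w(2)] sorted_lift_single sorted_list_of_multiset_mset)
  next
    fix f g assume f: "f \<in> ?T" and g: "g \<in> ?T"
    have fg: "f \<in> carrier F" "g \<in> carrier F" using f g by blast+
    have "sorted_lift (normal_form (f \<oplus>\<^bsub>F\<^esub> g)) = sorted_lift (normal_form f) \<oplus>\<^bsub>F\<^esub> sorted_lift (normal_form g)"
      unfolding normal_form_add[OF fg] by (simp add: free_add sorted_lift_def fun_eq_iff)
    then have "coset (f \<oplus>\<^bsub>F\<^esub> g) = coset (sorted_lift (normal_form (f \<oplus>\<^bsub>F\<^esub> g)))"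
      using coset_add[OF fg] coset_add[OF lift[OF fg(1)] lift[OF fg(2)]] f g by simp
    then show "f \<oplus>\<^bsub>F\<^esub> g \<in> ?T" using free_add_closed[OF fg] by blast
  qed
  then show ?thesis using assms by blast
qed

sublocale nf: ring_hom_ring F Q.TA normal_form by (rule normal_form_hom)

text \<open>
  The relations have normal form zero.  Conversely, every element is congruent to the sorted
  lift of its normal form, which vanishes with the normal form.
\<close>

lemma quantum_ideal_eq_kernel: "I = a_kernel F Q.TA normal_form"
proof
  have "{free_gen K j \<otimes>\<^bsub>F\<^esub> free_gen K i \<ominus>\<^bsub>F\<^esub> q \<odot>\<^bsub>F\<^esub> (free_gen K i \<otimes>\<^bsub>F\<^esub> free_gen K j) | i j. 1 \<le> i \<and> i < j \<and> j \<le> n}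
    \<subseteq> a_kernel F Q.TA normal_form" (is "?R \<subseteq> _")
  proof
    fix r assume r: "r \<in> ?R"
    then obtain i j where ij: "1 \<le> i" "i < j" "j \<le> n"
      and re: "r = free_gen K j \<otimes>\<^bsub>F\<^esub> free_gen K i \<ominus>\<^bsub>F\<^esub> q \<odot>\<^bsub>F\<^esub> (free_gen K i \<otimes>\<^bsub>F\<^esub> free_gen K j)" by blast
    have l: "[i] \<in> lists {1..n}" "[j] \<in> lists {1..n}" "[i, j] \<in> lists {1..n}" "[j, i] \<in> lists {1..n}"
      using ij by auto
    have a: "free_gen K j \<otimes>\<^bsub>F\<^esub> free_gen K i = single K [j, i] \<one>"
      unfolding free_gen_single free_single_mult[OF l(2,1) one_closed one_closed] by simp
    have b: "q \<odot>\<^bsub>F\<^esub> (free_gen K i \<otimes>\<^bsub>F\<^esub> free_gen K j) = single K [i, j] q"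
      unfolding free_gen_single free_single_mult[OF l(1,2) one_closed one_closed] free_smult
      using q by (auto simp: single_def fun_eq_iff)
    have cl: "single K [j, i] \<one> \<in> carrier F" "single K [i, j] q \<in> carrier F"
      using free_single_closed l(3,4) q by blast+
    have "normal_form (single K [j, i] \<one>) = normal_form (single K [i, j] q)"
      using ij q by (simp add: normal_form_single add_mset_commute)
    then have "normal_form (single K [j, i] \<one> \<ominus>\<^bsub>F\<^esub> single K [i, j] q) = \<zero>\<^bsub>Q.TA\<^esub>"
      unfolding a_minus_def nf.hom_add[OF cl(1) abelian_group.a_inv_closed[OF ring.is_abelian_group[OF F.A.ring_axioms] cl(2)]]
        nf.hom_a_inv[OF cl(2)]
      using abelian_group.r_neg[OF ring.is_abelian_group[OF Q.ring_TA] normal_form_closed[OF cl(2)]] by simp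
    then show "r \<in> a_kernel F Q.TA normal_form"
      using r quantum_relations_closed unfolding a_kernel_def' re a b by blast
  qed
  then show "I \<subseteq> a_kernel F Q.TA normal_form"
    unfolding quantum_ideal_def Let_def by (rule F.A.genideal_minimal[OF nf.kernel_is_ideal])
  show "a_kernel F Q.TA normal_form \<subseteq> I"
  proof
    fix f assume "f \<in> a_kernel F Q.TA normal_form"
    then have f: "f \<in> carrier F" "normal_form f = \<zero>\<^bsub>Q.TA\<^esub>" unfolding a_kernel_def' by blast+
    have "sorted_lift (normal_form f) = \<zero>\<^bsub>F\<^esub>"
      unfolding f(2) by (simp add: sorted_lift_def free_algebra_simps(3) fun_eq_iff)
    then have "coset f = coset \<zero>\<^bsub>F\<^esub>" using coset_normal_form[OF f(1)] by simp
    then have "f \<in> coset \<zero>\<^bsub>F\<^esub>" using I.a_rcos_self[OF f(1)] by simp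
    then obtain h where h: "h \<in> I" "f = h \<oplus>\<^bsub>F\<^esub> \<zero>\<^bsub>F\<^esub>" unfolding a_r_coset_def' by blast
    have "h \<in> carrier F" using h(1) by (rule I.Icarr)
    then show "f \<in> I" using h by (simp add: free_add free_algebra_simps(3) free_coeff)

  qed
qed

end

section \<open>The Veronese subring\<close>

lemma (in twisted_monoid) TA_finsum_coeff:
  assumes "\<And>i. i \<in> A \<Longrightarrow> f i \<in> carrier TA" "finite A"
  shows "finsum TA f A x = (\<Oplus>i\<in>A. f i x)"
  using assms(2,1)
proof (induction A)
  case empty
  interpret T: ring TA by (rule ring_TA)
  have "finsum TA f {} = \<zero>\<^bsub>TA\<^esub>" by (rule abelian_monoid.finsum_empty) (rule T.abelian_monoid_axioms)
  then show ?case by simp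
next
  case (insert i A)
  interpret T: ring TA by (rule ring_TA)
  have "finsum TA f (insert i A) = f i \<oplus>\<^bsub>TA\<^esub> finsum TA f A"
    using insert by (intro abelian_monoid.finsum_insert[OF T.abelian_monoid_axioms]) auto
  moreover have "(\<Oplus>j\<in>insert i A. f j x) = f i x \<oplus> (\<Oplus>j\<in>A. f j x)"
    using insert by (intro finsum_insert) auto
  ultimately show ?case using insert by simp
qed

context quantum_presentation
begin

abbreviation C where "C \<equiv> quantum_poly K q n"

definition quotient_normal_form where
  "quotient_normal_form X = the_elem (normal_form ` X)"

lemma quotient_normal_form_coset:
  "f \<in> carrier F \<Longrightarrow> quotient_normal_form (coset f) = normal_form f"
  unfolding quotient_normal_form_def quantum_ideal_eq_kernel by (rule nf.the_elem_simp)

lemma quotient_normal_form_iso: "quotient_normal_form \<in> ring_iso (F Quot I) Q.TA"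
proof -
  have "normal_form ` carrier F = carrier Q.TA"
  proof
    show "carrier Q.TA \<subseteq> normal_form ` carrier F"
    proof
      fix g assume "g \<in> carrier Q.TA"
      from sorted_lift_normal_form_inverse[OF this] show "g \<in> normal_form ` carrier F" by force
    qed
  qed (auto intro: normal_form_closed)
  from nf.FactRing_iso_set[OF this] show ?thesis
    unfolding quantum_ideal_eq_kernel quotient_normal_form_def[abs_def] .
qed

lemma quantum_poly_simps:
  "carrier C = carrier (F Quot I)" "X \<otimes>\<^bsub>C\<^esub> Y = X \<otimes>\<^bsub>F Quot I\<^esub> Y" "\<one>\<^bsub>C\<^esub> = \<one>\<^bsub>F Quot I\<^esub>"
  "\<zero>\<^bsub>C\<^esub> = \<zero>\<^bsub>F Quot I\<^esub>" "X \<oplus>\<^bsub>C\<^esub> Y = X \<oplus>\<^bsub>F Quot I\<^esub> Y"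
  "c \<odot>\<^bsub>C\<^esub> X = (\<Union>x\<in>X. coset (c \<odot>\<^bsub>F\<^esub> x))"
  by (simp_all add: quantum_poly_def quot_algebra_def)

lemma quantum_poly_carrier: "carrier C = coset ` carrier F"
  unfolding quantum_poly_simps(1) FactRing_def A_RCOSETS_def' by auto

lemma quantum_poly_smult:
  assumes c: "c \<in> carrier K" and f: "f \<in> carrier F"
  shows "c \<odot>\<^bsub>C\<^esub> coset f = coset (c \<odot>\<^bsub>F\<^esub> f)"
proof -
  have "coset (c \<odot>\<^bsub>F\<^esub> g) = coset (c \<odot>\<^bsub>F\<^esub> f)" if g: "g \<in> coset f" for g
  proof -
    obtain h where h: "h \<in> I" "g = h \<oplus>\<^bsub>F\<^esub> f" using g unfolding a_r_coset_def' by blast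
    have hF: "h \<in> carrier F" using h(1) by (rule I.Icarr)
    then have gF: "g \<in> carrier F" unfolding h(2) using f by (rule free_add_closed)
    have "coset g = coset f" using g f by (rule I.a_repr_independence'[symmetric])
    then have nf: "normal_form g = normal_form f"
      using quotient_normal_form_coset[OF gF] quotient_normal_form_coset[OF f] by simp
    have "coset (c \<odot>\<^bsub>F\<^esub> g) = coset (sorted_lift (normal_form (c \<odot>\<^bsub>F\<^esub> g)))"
      by (rule coset_normal_form[OF F.smult_closed[OF c gF]])
    also have "normal_form (c \<odot>\<^bsub>F\<^esub> g) = normal_form (c \<odot>\<^bsub>F\<^esub> f)"
      unfolding normal_form_smult[OF gF c] normal_form_smult[OF f c] nf ..
    also have "coset (sorted_lift (normal_form (c \<odot>\<^bsub>F\<^esub> f))) = coset (c \<odot>\<^bsub>F\<^esub> f)"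
      by (rule coset_normal_form[OF F.smult_closed[OF c f], symmetric])
    finally show ?thesis .
  qed
  moreover have "f \<in> coset f" by (rule I.a_rcos_self[OF f])
  ultimately show ?thesis unfolding quantum_poly_simps(6) by blast
qed

lemma quantum_poly_iso:
  "assoc_algebra K C" "quotient_normal_form \<in> algebra_iso K C Q.TA"
proof -
  have hom: "quotient_normal_form \<in> ring_hom (F Quot I) Q.TA"
    and bij: "bij_betw quotient_normal_form (carrier (F Quot I)) (carrier Q.TA)"
    using quotient_normal_form_iso unfolding ring_iso_def by blast+
  interpret QR: ring "F Quot I" by (rule I.quotient_is_ring)
  interpret QH: ring_hom_ring "F Quot I" Q.TA quotient_normal_form
    by (rule ring_hom_ringI2[OF QR.ring_axioms Q.ring_TA hom])
  have smult: "c \<odot>\<^bsub>C\<^esub> X \<in> carrier C"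
    "quotient_normal_form (c \<odot>\<^bsub>C\<^esub> X) = c \<odot>\<^bsub>Q.TA\<^esub> quotient_normal_form X"
    if c: "c \<in> carrier K" and X: "X \<in> carrier C" for c X
  proof -
    obtain f where f: "f \<in> carrier F" "X = coset f" using X unfolding quantum_poly_carrier by blast
    have cf: "c \<odot>\<^bsub>F\<^esub> f \<in> carrier F" by (rule F.smult_closed[OF c f(1)])
    show "c \<odot>\<^bsub>C\<^esub> X \<in> carrier C"
      unfolding f(2) quantum_poly_smult[OF c f(1)] quantum_poly_carrier using cf by blast
    show "quotient_normal_form (c \<odot>\<^bsub>C\<^esub> X) = c \<odot>\<^bsub>Q.TA\<^esub> quotient_normal_form X"
      unfolding f(2) quantum_poly_smult[OF c f(1)] quotient_normal_form_coset[OF cf]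
        quotient_normal_form_coset[OF f(1)] normal_form_smult[OF f(1) c] ..
  qed
  have zero: "quotient_normal_form \<zero>\<^bsub>F Quot I\<^esub> = \<zero>\<^bsub>Q.TA\<^esub>" by (rule QH.hom_zero)
  note closed = ring.ring_simprules(1,2,5,6)[OF QR.ring_axioms]
  note ax = Q.assoc_algebra_TA bij[folded quantum_poly_simps(1)]
  have a: "\<zero>\<^bsub>C\<^esub> \<in> carrier C" "\<one>\<^bsub>C\<^esub> \<in> carrier C"
    "\<And>x y. x \<in> carrier C \<Longrightarrow> y \<in> carrier C \<Longrightarrow> x \<oplus>\<^bsub>C\<^esub> y \<in> carrier C"
    "\<And>x y. x \<in> carrier C \<Longrightarrow> y \<in> carrier C \<Longrightarrow> x \<otimes>\<^bsub>C\<^esub> y \<in> carrier C"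
    unfolding quantum_poly_simps(1-5) using closed by blast+
  have b: "quotient_normal_form \<zero>\<^bsub>C\<^esub> = \<zero>\<^bsub>Q.TA\<^esub>" "quotient_normal_form \<one>\<^bsub>C\<^esub> = \<one>\<^bsub>Q.TA\<^esub>"
    "\<And>x y. x \<in> carrier C \<Longrightarrow> y \<in> carrier C \<Longrightarrow>
      quotient_normal_form (x \<oplus>\<^bsub>C\<^esub> y) = quotient_normal_form x \<oplus>\<^bsub>Q.TA\<^esub> quotient_normal_form y"
    "\<And>x y. x \<in> carrier C \<Longrightarrow> y \<in> carrier C \<Longrightarrow>
      quotient_normal_form (x \<otimes>\<^bsub>C\<^esub> y) = quotient_normal_form x \<otimes>\<^bsub>Q.TA\<^esub> quotient_normal_form y"
    unfolding quantum_poly_simps(1-5)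
    by (rule zero QH.hom_one QH.hom_add QH.hom_mult; assumption?)+
  show "assoc_algebra K C" "quotient_normal_form \<in> algebra_iso K C Q.TA"
    by (rule algebra_iso_induced[OF ax a smult(1) b smult(2)]; assumption)+
qed

abbreviation A where "A \<equiv> veronese C (quantum_component K q n) v"

lemma veronese_simps:
  "carrier A = {\<Oplus>\<^bsub>C\<^esub>i\<in>S. f i | S f. finite S \<and> f \<in> (\<Pi> i\<in>S. quantum_component K q n (int v * i))}"
  "X \<otimes>\<^bsub>A\<^esub> Y = X \<otimes>\<^bsub>C\<^esub> Y" "\<one>\<^bsub>A\<^esub> = \<one>\<^bsub>C\<^esub>" "\<zero>\<^bsub>A\<^esub> = \<zero>\<^bsub>C\<^esub>" "X \<oplus>\<^bsub>A\<^esub> Y = X \<oplus>\<^bsub>C\<^esub> Y"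
  "c \<odot>\<^bsub>A\<^esub> X = c \<odot>\<^bsub>C\<^esub> X"
  unfolding veronese_def by simp_all

lemma veronese_model_simps:
  "X \<otimes>\<^bsub>V.TA\<^esub> Y = X \<otimes>\<^bsub>Q.TA\<^esub> Y" "\<one>\<^bsub>V.TA\<^esub> = \<one>\<^bsub>Q.TA\<^esub>" "\<zero>\<^bsub>V.TA\<^esub> = \<zero>\<^bsub>Q.TA\<^esub>"
  "X \<oplus>\<^bsub>V.TA\<^esub> Y = X \<oplus>\<^bsub>Q.TA\<^esub> Y" "c \<odot>\<^bsub>V.TA\<^esub> X = c \<odot>\<^bsub>Q.TA\<^esub> X"
  unfolding twisted_algebra_def by (simp_all only: partial_object.simps monoid.simps ring.simps module.simps)

lemma veronese_model_carrier:
  "g \<in> carrier V.TA \<longleftrightarrow> g \<in> carrier Q.TA \<and> (\<forall>M. g M \<noteq> \<zero> \<longrightarrow> v dvd size M)"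
  unfolding V.TA_carrier_iff Q.TA_carrier_iff by (auto simp: veronese_exponents_def)

lemma quantum_component_normal_form:
  assumes "X \<in> quantum_component K q n d"
  shows "X \<in> carrier C" "quotient_normal_form X M \<noteq> \<zero> \<Longrightarrow> int (size M) = d"
proof -
  obtain f where f: "f \<in> carrier F" "\<forall>w. f w \<noteq> \<zero> \<longrightarrow> int (length w) = d" "X = coset f"
    using assms unfolding quantum_component_def by blast
  show "X \<in> carrier C" unfolding quantum_poly_carrier using f by blast
  assume nz: "quotient_normal_form X M \<noteq> \<zero>"
  show "int (size M) = d"
  proof (rule ccontr)
    assume ne: "int (size M) \<noteq> d"
    have "normal_form f M = (\<Oplus>w\<in>permutations_of_multiset M. \<zero>)"
      unfolding normal_form_def
    proof (rule finsum_cong')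
      fix w assume "w \<in> permutations_of_multiset M"
      then have "length w = size M" by (auto simp: perm_iff)
      then have "f w = \<zero>" using f(2) ne by auto
      then show "q [^] inversions w \<otimes> f w = \<zero>" by simp
    qed auto
    then show False using nz unfolding f(3) quotient_normal_form_coset[OF f(1)] by simp
  qed
qed

text \<open>
  An element whose normal form has only degrees divisible by \<open>v\<close> is the sum of its homogeneous
  parts; the index set consists of the finitely many quotients by \<open>v\<close> of the degrees that occur.
\<close>

lemma veronese_carrier:
  assumes v: "v > 0"
  shows "X \<in> carrier A \<longleftrightarrow> X \<in> carrier C \<and> quotient_normal_form X \<in> carrier V.TA"
proof -
  interpret C: assoc_algebra K C by (rule quantum_poly_iso(1))
  have ri: "quotient_normal_form \<in> ring_iso C Q.TA"
    using quantum_poly_iso(2) unfolding algebra_iso_def by blast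
  have hom: "quotient_normal_form \<in> ring_hom C Q.TA"
    and bij: "bij_betw quotient_normal_form (carrier C) (carrier Q.TA)"
    using ri unfolding ring_iso_def by blast+
  interpret h: ring_hom_ring C Q.TA quotient_normal_form
    by (rule ring_hom_ringI2[OF C.A.ring_axioms Q.ring_TA hom])
  have abC: "abelian_monoid C"
    by (rule abelian_group.axioms(1)[OF ring.is_abelian_group[OF C.A.ring_axioms]])
  have abQ: "abelian_monoid Q.TA" by (rule abelian_group.axioms(1)[OF Q.abelian_group_TA])
  have hsum: "quotient_normal_form (\<Oplus>\<^bsub>C\<^esub>i\<in>S. f i) = (\<Oplus>\<^bsub>Q.TA\<^esub>i\<in>S. quotient_normal_form (f i))"
    if "f \<in> S \<rightarrow> carrier C" for f :: "int \<Rightarrow> _" and S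
    using h.hom_finsum[OF that] by (simp add: comp_def)
  show ?thesis
  proof
    assume "X \<in> carrier A"
    then obtain S f where S: "finite S" and f: "\<And>i. i \<in> S \<Longrightarrow> f i \<in> quantum_component K q n (int v * i)"
      and X: "X = (\<Oplus>\<^bsub>C\<^esub>i\<in>S. f i)"
      unfolding veronese_simps(1) by blast
    have fC: "f \<in> S \<rightarrow> carrier C" using quantum_component_normal_form(1)[OF f] by blast
    have fV: "quotient_normal_form (f i) \<in> carrier V.TA" if i: "i \<in> S" for i
      unfolding veronese_model_carrier
    proof (intro conjI allI impI)
      show "quotient_normal_form (f i) \<in> carrier Q.TA" using h.hom_closed fC i by blast
      fix M assume "quotient_normal_form (f i) M \<noteq> \<zero>"
      then have "int (size M) = int v * i" by (rule quantum_component_normal_form(2)[OF f[OF i]])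
      then have "int v dvd int (size M)" by simp
      then show "v dvd size M" by simp
    qed
    have "quotient_normal_form X \<in> carrier V.TA"
      unfolding X hsum[OF fC]
    proof (rule abelian_monoid.finsum_in_submonoid[OF abQ])
      show "carrier V.TA \<subseteq> carrier Q.TA" unfolding veronese_model_carrier[abs_def] by (auto simp: veronese_model_carrier)
      show "\<zero>\<^bsub>Q.TA\<^esub> \<in> carrier V.TA"
        unfolding veronese_model_simps(3)[symmetric] by (rule ring.ring_simprules(2)[OF V.ring_TA])
      show "x \<oplus>\<^bsub>Q.TA\<^esub> y \<in> carrier V.TA" if "x \<in> carrier V.TA" "y \<in> carrier V.TA" for x y
        unfolding veronese_model_simps(4)[symmetric] by (rule ring.ring_simprules(1)[OF V.ring_TA that])
    qed (rule fV)
    moreover have "X \<in> carrier C" unfolding X by (rule abelian_monoid.finsum_closed[OF abC fC])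
    ultimately show "X \<in> carrier C \<and> quotient_normal_form X \<in> carrier V.TA" by blast
  next
    assume X: "X \<in> carrier C \<and> quotient_normal_form X \<in> carrier V.TA"
    define g where "g = quotient_normal_form X"
    have gV: "g \<in> carrier V.TA" and gQ: "g \<in> carrier Q.TA"
      using X by (simp_all add: g_def veronese_model_carrier)
    have gK: "g M \<in> carrier K" for M using gQ by (rule Q.TA_coeff)
    define part where "part i M = (if int (size M) = int v * i then g M else \<zero>)" for i :: int and M
    have partQ: "part i \<in> carrier Q.TA" for i
      using gQ unfolding Q.TA_carrier_iff part_def
      by (auto elim!: finite_subset[rotated])
    define S where "S = (\<lambda>M. int (size M div v)) ` {M. g M \<noteq> \<zero>}"
    have S: "finite S" using gQ unfolding S_def Q.TA_carrier_iff by blast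
    define f where "f i = coset (sorted_lift (part i))" for i
    have fG: "f i \<in> quantum_component K q n (int v * i)" for i
    proof -
      have "int (length w) = int v * i" if "sorted_lift (part i) w \<noteq> \<zero>" for w
        using that by (auto simp: sorted_lift_def part_def split: if_splits)
      then show ?thesis
        unfolding quantum_component_def f_def using sorted_lift_normal_form_inverse(1)[OF partQ] by blast
    qed
    have fC: "f \<in> S \<rightarrow> carrier C" using quantum_component_normal_form(1)[OF fG] by blast
    have fp: "quotient_normal_form (f i) = part i" for i
      unfolding f_def quotient_normal_form_coset[OF sorted_lift_normal_form_inverse(1)[OF partQ]]
      by (rule sorted_lift_normal_form_inverse(2)[OF partQ])
    have "quotient_normal_form (\<Oplus>\<^bsub>C\<^esub>i\<in>S. f i) = g"
    proof
      fix M
      have "quotient_normal_form (\<Oplus>\<^bsub>C\<^esub>i\<in>S. f i) M = (\<Oplus>i\<in>S. part i M)"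
        unfolding hsum[OF fC] fp by (rule Q.TA_finsum_coeff[OF partQ S])
      also have "\<dots> = g M"
      proof (cases "g M = \<zero>")
        case True
        then have "(\<Oplus>i\<in>S. part i M) = (\<Oplus>i\<in>S. \<zero>)" by (intro finsum_cong') (auto simp: part_def)
        then show ?thesis using True by simp
      next
        case False
        let ?i = "int (size M div v)"
        have iS: "?i \<in> S" using False unfolding S_def by blast
        have "v dvd size M" using gV False unfolding veronese_model_carrier by blast
        then have sz: "int (size M) = int v * ?i" by (simp flip: of_nat_mult)
        have "(\<Oplus>i\<in>S. part i M) = (\<Oplus>i\<in>S. if ?i = i then g M else \<zero>)"
        proof (rule finsum_cong')
          fix i
          show "part i M = (if ?i = i then g M else \<zero>)" using v unfolding part_def sz by simp
        qed (use gK in auto)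
        also have "\<dots> = g M" by (rule finsum_singleton[OF iS S]) (use gK in auto)
        finally show ?thesis .
      qed
      finally show "quotient_normal_form (\<Oplus>\<^bsub>C\<^esub>i\<in>S. f i) M = g M" .
    qed
    then have "quotient_normal_form (\<Oplus>\<^bsub>C\<^esub>i\<in>S. f i) = quotient_normal_form X" by (simp add: g_def)
    moreover have "(\<Oplus>\<^bsub>C\<^esub>i\<in>S. f i) \<in> carrier C" by (rule abelian_monoid.finsum_closed[OF abC fC])
    ultimately have "X = (\<Oplus>\<^bsub>C\<^esub>i\<in>S. f i)"
      using X by (intro inj_onD[OF bij_betw_imp_inj_on[OF bij]]) simp_all
    then show "X \<in> carrier A" unfolding veronese_simps(1) using S fG by blast
  qed
qed

lemma veronese_iso:
  assumes v: "v > 0"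
  shows "assoc_algebra K A" "isomorphic_algebras K A V.TA"
proof -
  interpret C: assoc_algebra K C by (rule quantum_poly_iso(1))
  have smult: "\<And>c x. c \<in> carrier K \<Longrightarrow> x \<in> carrier C \<Longrightarrow> quotient_normal_form (c \<odot>\<^bsub>C\<^esub> x) = c \<odot>\<^bsub>Q.TA\<^esub> quotient_normal_form x"
    and ri: "quotient_normal_form \<in> ring_iso C Q.TA"
    using quantum_poly_iso(2) unfolding algebra_iso_def by blast+
  have hom: "quotient_normal_form \<in> ring_hom C Q.TA"
    and bij: "bij_betw quotient_normal_form (carrier C) (carrier Q.TA)"
    using ri unfolding ring_iso_def by blast+
  interpret h: ring_hom_ring C Q.TA quotient_normal_form
    by (rule ring_hom_ringI2[OF C.A.ring_axioms Q.ring_TA hom])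
  note Ccl = ring.ring_simprules(1,2,5,6)[OF C.A.ring_axioms]
  note Vcl = ring.ring_simprules(1,2,5,6)[OF V.ring_TA]
  note Vsm = module.smult_closed[OF assoc_algebra.axioms(1)[OF V.assoc_algebra_TA]]
  note car = veronese_carrier[OF v]
  have AC: "carrier A = {X \<in> carrier C. quotient_normal_form X \<in> carrier V.TA}" using car by blast
  have "quotient_normal_form ` carrier A = carrier V.TA"
  proof
    show "quotient_normal_form ` carrier A \<subseteq> carrier V.TA" using AC by blast
    show "carrier V.TA \<subseteq> quotient_normal_form ` carrier A"
    proof
      fix g assume g: "g \<in> carrier V.TA"
      then have "g \<in> quotient_normal_form ` carrier C"
        unfolding veronese_model_carrier bij_betw_imp_surj_on[OF bij] by blast
      then obtain X where "X \<in> carrier C" "quotient_normal_form X = g" by blast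
      then show "g \<in> quotient_normal_form ` carrier A" using g unfolding AC by blast
    qed
  qed
  moreover have "inj_on quotient_normal_form (carrier A)"
    unfolding AC by (rule inj_on_subset[OF bij_betw_imp_inj_on[OF bij]]) blast
  ultimately have bijA: "bij_betw quotient_normal_form (carrier A) (carrier V.TA)"
    unfolding bij_betw_def by blast
  have AD: "X \<in> carrier C" "quotient_normal_form X \<in> carrier V.TA" if "X \<in> carrier A" for X
    using that unfolding car by simp_all
  have AI: "X \<in> carrier A" if "X \<in> carrier C" "quotient_normal_form X \<in> carrier V.TA" for X
    using that unfolding car by simp
  have hom_A: "quotient_normal_form \<zero>\<^bsub>A\<^esub> = \<zero>\<^bsub>V.TA\<^esub>" "quotient_normal_form \<one>\<^bsub>A\<^esub> = \<one>\<^bsub>V.TA\<^esub>"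
    "\<And>x y. x \<in> carrier A \<Longrightarrow> y \<in> carrier A \<Longrightarrow>
      quotient_normal_form (x \<oplus>\<^bsub>A\<^esub> y) = quotient_normal_form x \<oplus>\<^bsub>V.TA\<^esub> quotient_normal_form y"
    "\<And>x y. x \<in> carrier A \<Longrightarrow> y \<in> carrier A \<Longrightarrow>
      quotient_normal_form (x \<otimes>\<^bsub>A\<^esub> y) = quotient_normal_form x \<otimes>\<^bsub>V.TA\<^esub> quotient_normal_form y"
    "\<And>c x. c \<in> carrier K \<Longrightarrow> x \<in> carrier A \<Longrightarrow>
      quotient_normal_form (c \<odot>\<^bsub>A\<^esub> x) = c \<odot>\<^bsub>V.TA\<^esub> quotient_normal_form x"
    unfolding veronese_simps(2-6) veronese_model_simps
    by (rule h.hom_zero, rule h.hom_one, rule h.hom_add[OF AD(1) AD(1)], assumption+,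
        rule h.hom_mult[OF AD(1) AD(1)], assumption+, rule smult[OF _ AD(1)], assumption+)
  have closed_A: "\<zero>\<^bsub>A\<^esub> \<in> carrier A" "\<one>\<^bsub>A\<^esub> \<in> carrier A"
    "\<And>x y. x \<in> carrier A \<Longrightarrow> y \<in> carrier A \<Longrightarrow> x \<oplus>\<^bsub>A\<^esub> y \<in> carrier A"
    "\<And>x y. x \<in> carrier A \<Longrightarrow> y \<in> carrier A \<Longrightarrow> x \<otimes>\<^bsub>A\<^esub> y \<in> carrier A"
    "\<And>c x. c \<in> carrier K \<Longrightarrow> x \<in> carrier A \<Longrightarrow> c \<odot>\<^bsub>A\<^esub> x \<in> carrier A"
  proof -
    fix x y assume x: "x \<in> carrier A" and y: "y \<in> carrier A"
    show "x \<oplus>\<^bsub>A\<^esub> y \<in> carrier A"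
    proof (rule AI)
      show "x \<oplus>\<^bsub>A\<^esub> y \<in> carrier C" unfolding veronese_simps by (rule Ccl(1)[OF AD(1)[OF x] AD(1)[OF y]])
      show "quotient_normal_form (x \<oplus>\<^bsub>A\<^esub> y) \<in> carrier V.TA"
        unfolding hom_A(3)[OF x y] by (rule Vcl(1)[OF AD(2)[OF x] AD(2)[OF y]])
    qed
    show "x \<otimes>\<^bsub>A\<^esub> y \<in> carrier A"
    proof (rule AI)
      show "x \<otimes>\<^bsub>A\<^esub> y \<in> carrier C" unfolding veronese_simps by (rule Ccl(3)[OF AD(1)[OF x] AD(1)[OF y]])
      show "quotient_normal_form (x \<otimes>\<^bsub>A\<^esub> y) \<in> carrier V.TA"
        unfolding hom_A(4)[OF x y] by (rule Vcl(3)[OF AD(2)[OF x] AD(2)[OF y]])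
    qed
  next
    fix c x assume c: "c \<in> carrier K" and x: "x \<in> carrier A"
    show "c \<odot>\<^bsub>A\<^esub> x \<in> carrier A"
    proof (rule AI)
      show "c \<odot>\<^bsub>A\<^esub> x \<in> carrier C" unfolding veronese_simps by (rule C.smult_closed[OF c AD(1)[OF x]])
      show "quotient_normal_form (c \<odot>\<^bsub>A\<^esub> x) \<in> carrier V.TA"
        unfolding hom_A(5)[OF c x] by (rule Vsm[OF c AD(2)[OF x]])
    qed
  next
    show "\<zero>\<^bsub>A\<^esub> \<in> carrier A"
      by (rule AI) (unfold hom_A(1), unfold veronese_simps(4), rule Ccl(2), rule Vcl(2))
    show "\<one>\<^bsub>A\<^esub> \<in> carrier A"
      by (rule AI) (unfold hom_A(2), unfold veronese_simps(3), rule Ccl(4), rule Vcl(4))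
  qed
  note iso = algebra_iso_induced[OF V.assoc_algebra_TA bijA closed_A hom_A]
  show "assoc_algebra K A" by (rule iso(1))
  show "isomorphic_algebras K A V.TA" using iso(2) unfolding isomorphic_algebras_def by blast
qed

end

theorem theorem0p4:
  fixes K :: "('k, 'm) ring_scheme" and q :: 'k and n m v :: nat
  assumes "field K"
    and "n \<ge> 2"
    and "q \<in> carrier (mult_of K)"
    and "q \<noteq> \<one>\<^bsub>K\<^esub>"
    and "m > 0"
    and "group.ord (mult_of K) q = m"
    and "v > 0"
    and "(even n \<and> \<not> m dvd v) \<or> (odd n \<and> gcd m v \<noteq> 1)"
  shows "cancellative TYPE('b) K (veronese (quantum_poly K q n) (quantum_component K q n) v)"
proof -
  have q: "q \<in> carrier K" "q \<noteq> \<zero>\<^bsub>K\<^esub>" using assms(3) by simp_all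
  interpret presentation: quantum_presentation K q n v
    by (intro quantum_presentation.intro quantum_presentation_axioms.intro assms(1) q)
  have model: "quantum_root_of_unity K q n v m"
    by (intro quantum_root_of_unity.intro quantum_root_of_unity_axioms.intro
        presentation.V.quantum_exponents_axioms assms)
  note iso = presentation.veronese_iso[OF assms(7)]
  show ?thesis
    by (rule cancellative_if_isomorphic[OF iso(1) presentation.V.assoc_algebra_TA iso(2)])
      (rule quantum_root_of_unity.veronese_model_cancels[OF model])
qed

end
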